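(* Let $\alpha>0$, $\theta\in(0,1)$ and $\sigma\in(1/2,1)$ be fixed. There is a positive, effectively computable constant $C(\sigma,\theta)$, depending on $\sigma$ and $\theta$, such that for all sufficiently large $N$ (in terms of $\alpha,\theta,\sigma$), $$\max_{\substack{\ell\in\mathbb{Z}\\ N^\theta\le \ell\le N}} -\operatorname{Re}\frac{\zeta'}{\zeta}(\sigma+i\alpha\ell)\ \ge\ C(\sigma,\theta)\,(\log N)^{1-\sigma}(\log_2 N)^{1-\sigma}.$$
   Context: $\zeta$ is the Riemann zeta function and $\frac{\zeta'}{\zeta}(s)=\zeta'(s)/\zeta(s)$ is its logarithmic derivative. $\log_j$ denotes the $j$-th iterated natural logarithm, so $\log_2 x=\log\log x$ (not a base-2 logarithm). The variable $\ell$ ranges over integers. *)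

theory Defs
  imports "HOL-Complex_Analysis.Complex_Analysis" "HOL-Library.Nat_Bijection"
begin

section \<open>The Riemann zeta function\<close>

text \<open>
  The analytic continuation of the Dirichlet series to the plane without the pole \<^term>\<open>1::complex\<close>,
  where the value is set to 0 so that the function is unique.
  Existence and uniqueness are proved below (theorem \<open>zeta_ex1\<close>).
  At a zero \<open>s\<close> of \<open>zeta\<close> the quotient \<open>deriv zeta s / zeta s\<close> is 0 by the convention for
  division by zero, so such a point cannot attain a positive maximum of \<open>- Re (deriv zeta s / zeta s)\<close>.
\<close>

definition is_zeta :: "(complex \<Rightarrow> complex) \<Rightarrow> bool" where
  "is_zeta f \<longleftrightarrow> f holomorphic_on (- {1})
     \<and> (\<forall>s. Re s > 1 \<longrightarrow> (\<lambda>n. of_nat (Suc n) powr (- s)) sums f s)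
     \<and> f 1 = 0"

definition zeta :: "complex \<Rightarrow> complex" where
  "zeta = (THE f. is_zeta f)"

definition falling :: "nat \<Rightarrow> complex \<Rightarrow> complex" where
  "falling k s = (\<Prod>j<k. 1 - s - of_nat j)"

definition zeta_rem :: "nat \<Rightarrow> nat \<Rightarrow> complex \<Rightarrow> complex" where
  "zeta_rem K n s = of_nat (Suc (Suc n)) powr (1 - s)
     - (\<Sum>k\<le>K. falling k s / fact k * of_nat (Suc n) powr (1 - s - of_nat k))"

lemma zeta_rem_bound:
  assumes "a + real K \<ge> 0" "Re s \<ge> a" "norm s \<le> R"
  shows "norm (zeta_rem K n s)
    \<le> (\<Prod>j<Suc K. 1 + R + real j) * real (Suc n) powr (- a - real K)"
proof -
  define w where "w = complex_of_nat (Suc n)"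
  define z where "z = complex_of_nat (Suc (Suc n))"
  define f where "f = (\<lambda>i x. falling i s * x powr (1 - s - of_nat i))"
  define B where "B = (\<Prod>j<Suc K. 1 + R + real j) * real (Suc n) powr (- a - real K)"
  define S where "S = closed_segment w z"
  have R0: "R \<ge> 0" using assms(3) norm_ge_zero order_trans by blast
  have S: "\<exists>t. x = of_real t \<and> t \<ge> real (Suc n)" if "x \<in> S" for x
  proof -
    obtain u where u: "0 \<le> u" "x = (1 - u) *\<^sub>R w + u *\<^sub>R z"
      using \<open>x \<in> S\<close> unfolding S_def in_segment by blast
    have "x = of_real (real (Suc n) + u)"
      unfolding u w_def z_def by (simp add: scaleR_conv_of_real algebra_simps)
    thus ?thesis using u(1) by (intro exI[of _ "real (Suc n) + u"]) auto
  qed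
  have der: "(f i has_field_derivative f (Suc i) x) (at x within S)" if "x \<in> S" for i x
  proof -
    obtain t where t: "x = of_real t" "t \<ge> real (Suc n)" using S[OF \<open>x \<in> S\<close>] by blast
    have "x \<notin> \<real>\<^sub>\<le>\<^sub>0" using t by (auto simp: complex_nonpos_Reals_iff)
    hence "(f i has_field_derivative
        falling i s * ((1 - s - of_nat i) * x powr (1 - s - of_nat i - 1))) (at x)"
      unfolding f_def by (auto intro!: derivative_eq_intros)
    also have "falling i s * ((1 - s - of_nat i) * x powr (1 - s - of_nat i - 1)) = f (Suc i) x"
      unfolding f_def falling_def by (simp add: algebra_simps)
    finally show ?thesis by (rule has_field_derivative_at_within)
  qed
  have bd: "norm (f (Suc K) x) \<le> B" if "x \<in> S" for x
  proof -
    obtain t where t: "x = of_real t" "t \<ge> real (Suc n)" using S[OF \<open>x \<in> S\<close>] by blast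
    have "norm (x powr (1 - s - of_nat (Suc K))) = t powr (- Re s - real K)"
      using t by (subst norm_powr_real_powr) auto
    also have "\<dots> \<le> t powr (- a - real K)"
      using t assms by (intro powr_mono) auto
    also have "\<dots> \<le> real (Suc n) powr (- a - real K)"
      using t assms by (intro powr_mono2') auto
    finally have 1: "norm (x powr (1 - s - of_nat (Suc K))) \<le> real (Suc n) powr (- a - real K)" .
    have "norm (falling (Suc K) s) \<le> (\<Prod>j<Suc K. 1 + R + real j)"
      unfolding falling_def prod_norm[symmetric]
    proof (rule prod_mono, safe)
      fix j
      have "norm (1 - s - of_nat j) \<le> norm (1 - s) + norm (of_nat j :: complex)"
        by (rule norm_triangle_ineq4)
      also have "norm (1 - s) \<le> norm (1::complex) + norm s" by (rule norm_triangle_ineq4)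
      finally show "norm (1 - s - of_nat j) \<le> 1 + R + real j" using assms(3) by simp
    qed auto
    moreover have "0 \<le> (\<Prod>j<Suc K. 1 + R + real j)"
      using R0 by (intro prod_nonneg) auto
    ultimately show ?thesis unfolding f_def B_def norm_mult
      using 1 by (intro mult_mono norm_ge_zero)
  qed
  have "norm (f 0 z - (\<Sum>i\<le>K. f i w * (z - w) ^ i / fact i)) \<le> B * norm (z - w) ^ Suc K / fact K"
    by (rule complex_Taylor[of S]) (use der bd in \<open>auto simp: S_def\<close>)
  moreover have "z - w = 1" by (simp add: z_def w_def)
  moreover have "f 0 z - (\<Sum>i\<le>K. f i w / fact i) = zeta_rem K n s"
    by (simp add: f_def zeta_rem_def falling_def z_def w_def)
  moreover have "B / fact K \<le> B"
  proof -
    have "0 \<le> B" unfolding B_def using R0 by (intro mult_nonneg_nonneg prod_nonneg) auto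
    moreover have "(1::real) \<le> fact K" by simp
    ultimately show ?thesis by (simp add: divide_le_eq mult_le_cancel_left1)
  qed
  ultimately show ?thesis unfolding B_def by simp
qed

lemma zeta_rem_limit:
  assumes "a + real K > 1"
  shows "uniform_limit (cball 0 R \<inter> {s. Re s \<ge> a}) (\<lambda>N s. \<Sum>n<N. zeta_rem K n s)
           (\<lambda>s. \<Sum>n. zeta_rem K n s) sequentially"
proof (rule Weierstrass_m_test)
  show "norm (zeta_rem K n s) \<le> (\<Prod>j<Suc K. 1 + R + real j) * real (Suc n) powr (- a - real K)"
    if "s \<in> cball 0 R \<inter> {s. Re s \<ge> a}" for n s
    using assms that by (intro zeta_rem_bound) auto
  have "summable (\<lambda>n. real (Suc n) powr (- a - real K))"
    using assms by (subst summable_Suc_iff) (simp add: summable_real_powr_iff)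
  thus "summable (\<lambda>n. (\<Prod>j<Suc K. 1 + R + real j) * real (Suc n) powr (- a - real K))"
    by (rule summable_mult)
qed

lemma zeta_rem_cball:
  assumes "Re s > 1 - real K"
  obtains d where "d > 0" "cball s d \<subseteq> {s. Re s > 1 - real K}"
    "uniform_limit (cball s d) (\<lambda>N s. \<Sum>n<N. zeta_rem K n s)
           (\<lambda>s. \<Sum>n. zeta_rem K n s) sequentially"
proof -
  define d where "d = (Re s - (1 - real K)) / 2"
  have d: "d > 0" using assms by (simp add: d_def)
  have re: "Re z \<ge> Re s - d" if "z \<in> cball s d" for z
    using that abs_Re_le_cmod[of "s - z"] by (auto simp: dist_norm)
  have sub: "cball s d \<subseteq> cball 0 (norm s + d) \<inter> {z. Re z \<ge> Re s - d}"
  proof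
    fix z assume z: "z \<in> cball s d"
    have "norm z \<le> norm s + dist s z"
      using norm_triangle_ineq4[of s "s - z"] by (simp add: dist_norm)
    thus "z \<in> cball 0 (norm s + d) \<inter> {z. Re z \<ge> Re s - d}" using z re[OF z] by auto
  qed
  have "Re s - d + real K > 1" using assms by (simp add: d_def field_simps)
  note lim = uniform_limit_on_subset[OF zeta_rem_limit[OF this] sub]
  moreover have "cball s d \<subseteq> {s. Re s > 1 - real K}"
    using re \<open>Re s - d + real K > 1\<close> by force
  ultimately show ?thesis using d that by blast
qed

lemma falling_holomorphic [holomorphic_intros]: "falling k holomorphic_on A"
  unfolding falling_def by (intro holomorphic_intros)

lemma zeta_rem_holomorphic:
  "(\<lambda>s. \<Sum>n. zeta_rem K n s) holomorphic_on {s. Re s > 1 - real K}"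
proof (rule holomorphic_uniform_sequence)
  show "open {s. Re s > 1 - real K}" by (rule open_halfspace_Re_gt)
  show "(\<lambda>s. \<Sum>n<N. zeta_rem K n s) holomorphic_on {s. Re s > 1 - real K}"
    for N :: nat
    unfolding zeta_rem_def by (intro holomorphic_intros) auto
next
  fix s assume "s \<in> {s. Re s > 1 - real K}"
  thus "\<exists>d>0. cball s d \<subseteq> {s. Re s > 1 - real K} \<and>
    uniform_limit (cball s d) (\<lambda>N s. \<Sum>n<N. zeta_rem K n s) (\<lambda>s. \<Sum>n. zeta_rem K n s) sequentially"
    by (elim CollectE zeta_rem_cball) (intro exI conjI)
qed

lemma zeta_series_summable:
  assumes "Re s > 1"
  shows "summable (\<lambda>n. of_nat (Suc n) powr (- s))"
proof (rule summable_norm_cancel)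
  have "norm (of_nat (Suc n) powr (- s)) = real (Suc n) powr (- Re s)" for n
    by (subst norm_powr_real_powr) auto
  moreover have "summable (\<lambda>n. real (Suc n) powr (- Re s))"
    using assms by (subst summable_Suc_iff) (simp add: summable_real_powr_iff)
  ultimately show "summable (\<lambda>n. norm (of_nat (Suc n) powr (- s)))" by simp
qed

definition dirichlet :: "complex \<Rightarrow> complex" where
  "dirichlet s = (\<Sum>n. of_nat (Suc n) powr (- s))"

lemma dirichlet_sums: "Re s > 1 \<Longrightarrow> (\<lambda>n. of_nat (Suc n) powr (- s)) sums dirichlet s"
  unfolding dirichlet_def by (rule summable_sums[OF zeta_series_summable])

lemma powr_telescope_sums:
  assumes "Re s > 1"
  shows "(\<lambda>n. of_nat (Suc (Suc n)) powr (1 - s) - of_nat (Suc n) powr (1 - s)) sums (- 1 :: complex)"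
proof -
  have "(\<lambda>n. complex_of_nat (Suc n) powr (1 - s)) \<longlonglongrightarrow> 0"
  proof (rule tendsto_norm_zero_cancel)
    have "norm (complex_of_nat (Suc n) powr (1 - s)) = real (Suc n) powr (1 - Re s)" for n
      by (subst norm_powr_real_powr) auto
    moreover have "(\<lambda>n. real (Suc n) powr (1 - Re s)) \<longlonglongrightarrow> 0"
      using assms by (intro tendsto_neg_powr filterlim_compose[OF filterlim_real_sequentially filterlim_Suc]) auto
    ultimately show "(\<lambda>n. norm (complex_of_nat (Suc n) powr (1 - s))) \<longlonglongrightarrow> 0" by simp
  qed
  from telescope_sums[OF this] show ?thesis by simp
qed

lemma zeta_rem_sum:
  assumes "Re s > 1"
  shows "(\<Sum>n. zeta_rem (Suc m) n s) = - 1 + (s - 1) * dirichlet s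
    - (\<Sum>k=2..Suc m. falling k s / fact k * dirichlet (s - 1 + of_nat k))"
proof -
  have eq: "zeta_rem (Suc m) n s = (of_nat (Suc (Suc n)) powr (1 - s) - of_nat (Suc n) powr (1 - s))
      + (s - 1) * of_nat (Suc n) powr (- s)
      - (\<Sum>k=2..Suc m. falling k s / fact k * of_nat (Suc n) powr (- (s - 1 + of_nat k)))" for n
  proof -
    have "{..Suc m} = insert 0 (insert 1 {2..Suc m})" by auto
    thus ?thesis unfolding zeta_rem_def
      by (simp add: falling_def algebra_simps)
  qed
  have "(\<lambda>n. zeta_rem (Suc m) n s) sums (- 1 + (s - 1) * dirichlet s
    - (\<Sum>k=2..Suc m. falling k s / fact k * dirichlet (s - 1 + of_nat k)))"
    unfolding eq using assms
    by (intro sums_add sums_diff sums_sum sums_mult powr_telescope_sums dirichlet_sums) auto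
  thus ?thesis by (rule sums_unique[symmetric])
qed

lemma zeta_step:
  "\<exists>g. g holomorphic_on {s. Re s > 1 - real m} \<and> (\<forall>s. Re s > 1 \<longrightarrow> g s = (s - 1) * dirichlet s)"
proof (induction m)
  case 0
  have "(\<lambda>s. 1 + (\<Sum>n. zeta_rem 1 n s)) holomorphic_on {s. Re s > 1 - real 0}"
    by (intro holomorphic_intros holomorphic_on_subset[OF zeta_rem_holomorphic]) auto
  moreover have "1 + (\<Sum>n. zeta_rem 1 n s) = (s - 1) * dirichlet s" if "Re s > 1" for s
    using zeta_rem_sum[OF that, of 0] by simp
  ultimately show ?case by blast
next
  case (Suc m)
  then obtain g where g: "g holomorphic_on {s. Re s > 1 - real m}"
    and gd: "\<And>s. Re s > 1 \<Longrightarrow> g s = (s - 1) * dirichlet s" by blast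
  define G where "G = (\<lambda>s. 1 + (\<Sum>n. zeta_rem (Suc m) n s)
    - (\<Sum>k=2..Suc m. falling (k - 1) s / fact k * g (s - 1 + of_nat k)))"
  have "(\<lambda>s. g (s - 1 + of_nat k)) holomorphic_on {s. Re s > 1 - real (Suc m)}"
    if "k \<in> {2..Suc m}" for k
    by (rule holomorphic_on_compose_gen[OF _ g, unfolded o_def])
       (use that in \<open>auto intro!: holomorphic_intros\<close>)
  hence "G holomorphic_on {s. Re s > 1 - real (Suc m)}"
    unfolding G_def by (intro holomorphic_intros zeta_rem_holomorphic) auto
  moreover have "G s = (s - 1) * dirichlet s" if s: "Re s > 1" for s
  proof -
    have "falling (k - 1) s / fact k * g (s - 1 + of_nat k)
        = - (falling k s / fact k * dirichlet (s - 1 + of_nat k))" if k: "k \<in> {2..Suc m}" for k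
    proof -
      obtain j where j: "k = Suc j" using k by (cases k) auto
      have "g (s - 1 + of_nat k) = (s + of_nat j - 1) * dirichlet (s - 1 + of_nat k)"
        using k s by (subst gd) (auto simp: j algebra_simps)
      moreover have "falling k s = - (falling j s * (s + of_nat j - 1))"
        unfolding j falling_def by (simp add: algebra_simps)
      ultimately show ?thesis by (simp add: j)
    qed
    hence "(\<Sum>k=2..Suc m. falling (k - 1) s / fact k * g (s - 1 + of_nat k))
      = - (\<Sum>k=2..Suc m. falling k s / fact k * dirichlet (s - 1 + of_nat k))"
      by (simp add: sum_negf)
    thus ?thesis unfolding G_def zeta_rem_sum[OF s] by simp
  qed
  ultimately show ?case by blast
qed

lemma holomorphic_eq_from_halfplane:
  assumes "f holomorphic_on A" "g holomorphic_on A" "open A" "connected A"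
    "{s. Re s > 1} \<subseteq> A" "\<And>s. Re s > 1 \<Longrightarrow> f s = g s" "z \<in> A"
  shows "f z = g z"
proof (rule analytic_continuation_open[of "{s. Re s > 1}" A f g])
  show "{s. Re s > 1} \<noteq> {}"
  proof -
    have "2 \<in> {s :: complex. Re s > 1}" by simp
    thus ?thesis by blast
  qed
qed (use assms in \<open>auto simp: open_halfspace_Re_gt\<close>)

theorem zeta_ex1: "\<exists>!f. is_zeta f"
proof (rule ex_ex1I)
  have "\<exists>g. \<forall>m. g m holomorphic_on {s. Re s > 1 - real m}
      \<and> (\<forall>s. Re s > 1 \<longrightarrow> g m s = (s - 1) * dirichlet s)"
    by (intro choice allI zeta_step)
  then obtain g where g: "\<And>m. g m holomorphic_on {s. Re s > 1 - real m}"
    and gd: "\<And>m s. Re s > 1 \<Longrightarrow> g m s = (s - 1) * dirichlet s"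
    by blast
  have eq: "g m s = g n s" if "Re s > 1 - real m" "m \<le> n" for m n s
  proof (rule holomorphic_eq_from_halfplane[of "g m" "{s. Re s > 1 - real m}" "g n"])
    show "g n holomorphic_on {s. Re s > 1 - real m}"
      by (rule holomorphic_on_subset[OF g[of n]]) (use that in auto)
  qed (use that g in \<open>auto simp: gd open_halfspace_Re_gt convex_halfspace_Re_gt convex_connected\<close>)
  define h where "h = (\<lambda>s. g (nat \<lceil>2 - Re s\<rceil>) s)"
  have hg: "h s = g m s" if s: "Re s > 1 - real m" for m s
  proof -
    have "Re s > 1 - real (nat \<lceil>2 - Re s\<rceil>)" by linarith
    thus ?thesis unfolding h_def using s eq[of m s] eq[of "nat \<lceil>2 - Re s\<rceil>" s]
      by (metis nle_le)
  qed
  have "h holomorphic_on (\<Union>m. {s. Re s > 1 - real m})"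
  proof (rule holomorphic_on_UN_open)
    show "h holomorphic_on {s. Re s > 1 - real m}" for m
      using g[of m] by (rule holomorphic_transform) (auto simp: hg)
  qed (auto simp: open_halfspace_Re_gt)
  also have "(\<Union>m. {s. Re s > 1 - real m}) = UNIV"
  proof safe
    fix s :: complex
    show "s \<in> (\<Union>m. {s. Re s > 1 - real m})"
      by (rule UN_I[of "nat \<lceil>2 - Re s\<rceil>"]) (simp, simp, linarith)
  qed auto
  finally have hol: "h holomorphic_on UNIV" .
  have "is_zeta (\<lambda>s. h s / (s - 1))"
    unfolding is_zeta_def
  proof (intro conjI allI impI)
    show "(\<lambda>s. h s / (s - 1)) holomorphic_on - {1}"
      by (intro holomorphic_intros holomorphic_on_subset[OF hol]) auto
    fix s :: complex assume s: "Re s > 1"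
    have "h s = (s - 1) * dirichlet s" using s hg[of 0 s] gd[of s 0] by simp
    moreover have "s - 1 \<noteq> 0" using s by auto
    ultimately have "h s / (s - 1) = dirichlet s" by simp
    thus "(\<lambda>n. of_nat (Suc n) powr (- s)) sums (h s / (s - 1))" using dirichlet_sums[OF s] by simp
  qed simp
  thus "\<exists>f. is_zeta f" by (rule exI[of is_zeta])
next
  fix f g :: "complex \<Rightarrow> complex"
  assume f: "is_zeta f" and g: "is_zeta g"
  show "f = g"
  proof
    fix z
    show "f z = g z"
    proof (cases "z = 1")
      case False
      show ?thesis
      proof (rule holomorphic_eq_from_halfplane[of f "- {1}" g])
        show "connected (- {1 :: complex})" by (rule connected_punctured_universe) simp
        show "f s = g s" if "Re s > 1" for s
          using f g that unfolding is_zeta_def by (blast intro: sums_unique2)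
      qed (use f g False in \<open>auto simp: is_zeta_def\<close>)
    qed (use f g in \<open>auto simp: is_zeta_def\<close>)
  qed
qed

lemma is_zeta_zeta: "is_zeta zeta"
  unfolding zeta_def by (rule theI'[OF zeta_ex1])


section \<open>Effectively computable functions of real parameters\<close>

text \<open>
  Kleene's partial recursive functions relative to finitely many oracles
  (\<open>os ! i\<close> is the \<open>i\<close>-th oracle), as a syntax of programs with a big-step semantics:
  \<open>rec_eval os p xs y\<close> says that \<open>p\<close> halts on the arguments \<open>xs\<close> with output \<open>y\<close>.
  A program does not depend on the oracles it is run with.
\<close>

datatype recf =
    Zero
  | Succ
  | Proj nat
  | Orac nat
  | Comp recf "recf list"
  | PrimRec recf recf
  | Minim recf

inductive rec_eval :: "(nat \<Rightarrow> nat) list \<Rightarrow> recf \<Rightarrow> nat list \<Rightarrow> nat \<Rightarrow> bool"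
  for os :: "(nat \<Rightarrow> nat) list"
  where
    rec_zero: "rec_eval os Zero xs 0"
  | rec_succ: "rec_eval os Succ (x # xs) (Suc x)"
  | rec_proj: "i < length xs \<Longrightarrow> rec_eval os (Proj i) xs (xs ! i)"
  | rec_orac: "i < length os \<Longrightarrow> rec_eval os (Orac i) (x # xs) ((os ! i) x)"
  | rec_comp: "list_all2 (\<lambda>q y. rec_eval os q xs y) qs ys \<Longrightarrow> rec_eval os p ys z
      \<Longrightarrow> rec_eval os (Comp p qs) xs z"
  | rec_prim_0: "rec_eval os p xs y \<Longrightarrow> rec_eval os (PrimRec p q) (0 # xs) y"
  | rec_prim_Suc: "rec_eval os (PrimRec p q) (n # xs) y \<Longrightarrow> rec_eval os q (n # y # xs) z
      \<Longrightarrow> rec_eval os (PrimRec p q) (Suc n # xs) z"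
  | rec_minim: "rec_eval os p (n # xs) 0 \<Longrightarrow> (\<forall>k<n. \<exists>y. rec_eval os p (k # xs) (Suc y))
      \<Longrightarrow> rec_eval os (Minim p) xs n"
  monos list.rel_mono

text \<open>
  A name of a real number \<open>x\<close> lists dyadic approximations of \<open>x\<close> with error at most \<open>2\<^sup>-\<^sup>n\<close>,
  the integer numerators being coded as natural numbers.
\<close>

definition real_name :: "(nat \<Rightarrow> nat) \<Rightarrow> real \<Rightarrow> bool" where
  "real_name \<phi> x \<longleftrightarrow> (\<forall>n. \<bar>of_int (int_decode (\<phi> n)) / 2 ^ n - x\<bar> \<le> 1 / 2 ^ n)"

text \<open>
  The usual computability of a real function (Grzegorczyk, Lacombe, Ko--Friedman, Weihrauch):
  one program turns arbitrary names of the arguments, supplied as oracles, into a name of the value.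
\<close>

definition computable_real2_on :: "(real \<times> real) set \<Rightarrow> (real \<Rightarrow> real \<Rightarrow> real) \<Rightarrow> bool" where
  "computable_real2_on D f \<longleftrightarrow>
     (\<exists>p. \<forall>(x, y)\<in>D. \<forall>\<phi> \<psi>. real_name \<phi> x \<longrightarrow> real_name \<psi> y \<longrightarrow>
        (\<exists>\<rho>. real_name \<rho> (f x y) \<and> (\<forall>n. rec_eval [\<phi>, \<psi>] p [n] (\<rho> n))))"

end

theory Submission
  imports Defs "HOL-Number_Theory.Prime_Powers" "HOL-Computational_Algebra.Squarefree"
    "HOL-Real_Asymp.Real_Asymp"
begin

text \<open>
  Round \<open>\<alpha> l ln n / 2 \<pi>\<close> modulo 1 to sixths for about \<open>log N\<close> prime powers \<open>n\<close> of size about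
  \<open>log N log log N\<close>. Among the pairs of integers \<open>l, l' < N\<close> with equal roundings, every sum
  \<open>\<Sum> cos (\<alpha> (l - l') ln n)\<close> is nonnegative, being a sum of squares, and the chosen \<open>n\<close> contribute at
  least half of the trivial bound. Hence a Dirichlet polynomial \<open>\<Sum> a n cos (\<alpha> h ln n)\<close> with \<open>a \<ge> 0\<close>
  is large at some \<open>h = \<bar>l - l'\<bar>\<close>, even outside a given set of at most \<open>N\<close> to the power \<open>1 - \<delta>\<close> integers.
  The excluded \<open>h\<close> are the small ones and those for which zeta has a zero in a disc about
  \<open>2 + \<i> \<alpha> h\<close> reaching to the left of \<open>\<sigma>\<close>; the latter are few because zeta times a mollifier is close
  to 1 in mean square. For the other \<open>h\<close>, \<open>- zeta' / zeta (\<sigma> + \<i> \<alpha> h)\<close> is given up to a bounded error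
  by its Taylor polynomial of degree \<open>O(log log N)\<close> at \<open>2 + \<i> \<alpha> h\<close>, and since \<open>\<sigma> < 2\<close> this is a
  Dirichlet series with nonnegative coefficients.
\<close>

section \<open>Tails of the zeta series\<close>

text \<open>No hypothesis on the zeros of zeta is at hand, so a large Dirichlet polynomial at some
  height says nothing about \<open>zeta' / zeta\<close> there unless the height avoids the zeros. A
  single shift supplied by Dirichlet's approximation theorem might be exceptional. Counting pairs
  removes this obstacle: at least a fraction \<open>N powr (- 3 * \<epsilon>)\<close> of all pairs
  has equal roundings, while an exceptional shift spoils at most \<open>2 * N\<close> pairs, so a
  saving \<open>\<delta> > 3 * \<epsilon>\<close> in the number of exceptions suffices. The lower
  end \<open>N powr \<theta>\<close> of the range is treated as one more exceptional set and costs
  \<open>3 * \<epsilon> < 1 - \<theta>\<close>. Both demands hold for a small multiple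
  \<open>\<epsilon>\<close> of \<open>(2 * \<sigma> - 1)^2 * (1 - \<theta>)\<close>, and the
  constant of the theorem is again a multiple of this polynomial, so that its computability reduces
  to integer arithmetic. The degree \<open>K\<close> of the Taylor polynomial matters only through
  \<open>4 ^ K\<close>, which bounds the sum of all coefficients up to a constant: it is a power of
  \<open>log N\<close> and thus negligible against a power of \<open>N\<close>.\<close>

definition ztail :: "nat \<Rightarrow> complex \<Rightarrow> complex" where
  "ztail Y s = zeta s - (\<Sum>n<Y. of_nat (Suc n) powr (- s))"

lemma zeta_holomorphic: "zeta holomorphic_on - {1}"
  using is_zeta_zeta by (simp add: is_zeta_def)

lemma zeta_eq_dirichlet: "Re s > 1 \<Longrightarrow> zeta s = dirichlet s"
  using is_zeta_zeta dirichlet_sums sums_unique2 unfolding is_zeta_def by blast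

text \<open>The identity \<open>zeta_rem_sum\<close> moved to the left by analytic continuation. The
  continuation takes place above the real axis because the poles of all the shifted functions
  \<open>zeta (s - 1 + of_nat k)\<close> are real; what remains of the half-plane is convex, hence
  connected.\<close>

lemma zeta_rem_sum_continued:
  assumes "Im s > 0" "Re s > - real m"
  shows "(\<Sum>n. zeta_rem (Suc m) n s) = - 1 + (s - 1) * zeta s
    - (\<Sum>k=2..Suc m. falling k s / fact k * zeta (s - 1 + of_nat k))"
proof (rule analytic_continuation_open[of "{s. Re s > 1} \<inter> {s. Im s > 0}"
      "{s. Re s > - real m} \<inter> {s. Im s > 0}" "\<lambda>s. \<Sum>n. zeta_rem (Suc m) n s"
      "\<lambda>s. - 1 + (s - 1) * zeta s
         - (\<Sum>k=2..Suc m. falling k s / fact k * zeta (s - 1 + of_nat k))"])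
  show "open ({s. Re s > 1} \<inter> {s. Im s > 0})" "open ({s. Re s > - real m} \<inter> {s. Im s > 0})"
    by (intro open_Int open_halfspace_Re_gt open_halfspace_Im_gt)+
  have "Complex 2 1 \<in> {s. Re s > 1} \<inter> {s. Im s > 0}" by simp
  thus "{s. Re s > 1} \<inter> {s. Im s > 0} \<noteq> {}" by blast
  show "connected ({s. Re s > - real m} \<inter> {s. Im s > 0})"
    by (intro convex_connected convex_Int convex_halfspace_Re_gt convex_halfspace_Im_gt)
  show "{s. Re s > 1} \<inter> {s. Im s > 0} \<subseteq> {s. Re s > - real m} \<inter> {s. Im s > 0}" by auto
  show "(\<lambda>s. \<Sum>n. zeta_rem (Suc m) n s) holomorphic_on {s. Re s > - real m} \<inter> {s. Im s > 0}"
    by (rule holomorphic_on_subset[OF zeta_rem_holomorphic]) auto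
  have "(\<lambda>s. zeta (s - 1 + of_nat k)) holomorphic_on {s. Re s > - real m} \<inter> {s. Im s > 0}" for k
    by (rule holomorphic_on_compose_gen[OF _ zeta_holomorphic, unfolded o_def])
       (auto intro!: holomorphic_intros simp: complex_eq_iff)
  moreover have "zeta holomorphic_on {s. Re s > - real m} \<inter> {s. Im s > 0}"
    by (rule holomorphic_on_subset[OF zeta_holomorphic]) auto
  ultimately show "(\<lambda>s. - 1 + (s - 1) * zeta s
    - (\<Sum>k=2..Suc m. falling k s / fact k * zeta (s - 1 + of_nat k)))
     holomorphic_on {s. Re s > - real m} \<inter> {s. Im s > 0}"
    by (intro holomorphic_intros) auto
  show "(\<Sum>n. zeta_rem (Suc m) n z) = - 1 + (z - 1) * zeta z
    - (\<Sum>k=2..Suc m. falling k z / fact k * zeta (z - 1 + of_nat k))"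
    if "z \<in> {s. Re s > 1} \<inter> {s. Im s > 0}" for z
  proof -
    have "Re z > 1" using that by auto
    moreover have "(\<Sum>k=2..Suc m. falling k z / fact k * zeta (z - 1 + of_nat k))
       = (\<Sum>k=2..Suc m. falling k z / fact k * dirichlet (z - 1 + of_nat k))"
      using \<open>Re z > 1\<close> by (intro sum.cong refl) (subst zeta_eq_dirichlet, auto)
    ultimately show ?thesis using zeta_rem_sum[of z m] by (simp add: zeta_eq_dirichlet)
  qed
qed (use assms in auto)

text \<open>The same Taylor identity summed over \<open>n < Y\<close> only. The telescoping part now
  keeps its end term, which becomes the main term of the tail in
  \<open>ztail_identity\<close>.\<close>

lemma zeta_rem_partial_sum:
  "(\<Sum>n<Y. zeta_rem (Suc m) n s) = of_nat (Suc Y) powr (1 - s) - 1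
     + (s - 1) * (\<Sum>n<Y. of_nat (Suc n) powr (- s))
     - (\<Sum>k=2..Suc m. falling k s / fact k * (\<Sum>n<Y. of_nat (Suc n) powr (- (s - 1 + of_nat k))))"
proof -
  have eq: "zeta_rem (Suc m) n s = (of_nat (Suc (Suc n)) powr (1 - s) - of_nat (Suc n) powr (1 - s))
      + (s - 1) * of_nat (Suc n) powr (- s)
      - (\<Sum>k=2..Suc m. falling k s / fact k * of_nat (Suc n) powr (- (s - 1 + of_nat k)))" for n
  proof -
    have "{..Suc m} = insert 0 (insert 1 {2..Suc m})" by auto
    thus ?thesis unfolding zeta_rem_def
      by (simp add: falling_def algebra_simps)
  qed
  have "(\<Sum>n<Y. of_nat (Suc (Suc n)) powr (1 - s) - of_nat (Suc n) powr (1 - s))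
      = of_nat (Suc Y) powr (1 - s) - (1::complex)"
    using sum_lessThan_telescope[of "\<lambda>n. of_nat (Suc n) powr (1 - s) :: complex" Y] by simp
  moreover have "(\<Sum>n<Y. \<Sum>k=2..Suc m. falling k s / fact k * of_nat (Suc n) powr (- (s - 1 + of_nat k)))
     = (\<Sum>k=2..Suc m. falling k s / fact k * (\<Sum>n<Y. of_nat (Suc n) powr (- (s - 1 + of_nat k))))"
    by (subst sum.swap) (simp add: sum_distrib_left)
  ultimately show ?thesis
    unfolding eq sum_subtractf sum.distrib sum_distrib_left[symmetric] by simp
qed

text \<open>Comparison with the telescoping series of \<open>x powr (- (1 / 2))\<close>, whose
  differences dominate a multiple of \<open>x powr (- 3 / 2)\<close>. The remaining factor
  \<open>x powr (3 / 2 - b)\<close> does not increase, since \<open>b \<ge> 3 / 2\<close>, and is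
  taken at \<open>x = Suc Y\<close>. The comparison yields the constant 15 / 4, rounded up to
  6.\<close>

lemma powr_tail_sum:
  fixes b :: real
  assumes "b \<ge> 3 / 2"
  shows "summable (\<lambda>n. real (Suc (n + Y)) powr (- b))"
    and "(\<Sum>n. real (Suc (n + Y)) powr (- b)) \<le> 6 * real (Suc Y) powr (1 - b)"
proof -
  let ?f = "\<lambda>n. real (Suc (n + Y)) powr (- (1 / 2))"
  have ps: "y powr (- (1 / 2)) = 1 / sqrt y" if "y > 0" for y :: real
    using that by (simp only: powr_minus_divide powr_half_sqrt less_imp_le)
  let ?c = "6 * real (Suc Y) powr (3 / 2 - b)"
  have lim: "?f \<longlonglongrightarrow> 0"
    by (intro tendsto_neg_powr filterlim_compose[OF filterlim_real_sequentially]
      filterlim_compose[OF filterlim_Suc] filterlim_add_const_nat_at_top) auto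
  have t: "(\<lambda>n. ?f n - ?f (Suc n)) sums ?f 0"
    using telescope_sums'[OF lim] by simp
  have le: "real (Suc (n + Y)) powr (- b) \<le> ?c * (?f n - ?f (Suc n))" for n
  proof -
    define x where "x = real (Suc (n + Y))"
    define a where "a = sqrt x"
    define c where "c = sqrt (x + 1)"
    have x: "x \<ge> 1" "x \<ge> real (Suc Y)" by (auto simp: x_def)
    have a: "a \<ge> 1" "a\<^sup>2 = x" "c > 0" "c\<^sup>2 = a\<^sup>2 + 1" using x by (auto simp: a_def c_def)
    have "c\<^sup>2 \<le> (3 / 2 * a)\<^sup>2" using a(4) one_le_power[OF a(1), of 2]
      by (simp add: power_mult_distrib power_divide)
    hence c: "c \<le> 3 / 2 * a" by (rule power2_le_imp_le) (use a in simp)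
    have "(c - a) * (c + a) = 1" using a(4) by (simp add: algebra_simps power2_eq_square)
    have "1 / a - 1 / c = (c - a) / (a * c)" using a by (simp add: field_simps)
    also have "c - a = 1 / (c + a)" using a \<open>(c - a) * (c + a) = 1\<close> by (simp add: field_simps)
    also have "1 / (c + a) / (a * c) = 1 / ((c + a) * (a * c))" by simp
    also have "\<dots> \<ge> 1 / ((5 / 2 * a) * (a * (3 / 2 * a)))"
      using a c by (intro divide_left_mono mult_mono mult_pos_pos add_pos_pos) auto
    also have "1 / ((5 / 2 * a) * (a * (3 / 2 * a))) = 4 / 15 * (1 / a ^ 3)"
      by (simp add: power3_eq_cube)
    finally have "4 / 15 * (1 / a ^ 3) \<le> 1 / a - 1 / c" .
    moreover have "0 \<le> 1 / a ^ 3" using a by simp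
    ultimately have "1 / a ^ 3 \<le> 6 * (1 / a - 1 / c)" by argo
    moreover have "1 / a = ?f n"
      unfolding x_def[symmetric] a_def using x by (subst ps) auto
    moreover have "1 / c = ?f (Suc n)"
    proof -
      have "real (Suc (Suc n + Y)) = x + 1" by (simp add: x_def)
      thus ?thesis unfolding c_def using x by (simp only:) (subst ps, auto)
    qed
    moreover have "1 / a ^ 3 = x powr (- 3 / 2)"
    proof -
      have "x powr (3 / 2) = x powr (1 + 1 / 2)" by simp
      also have "\<dots> = x * a" unfolding powr_add using x by (simp add: a_def powr_half_sqrt)
      also have "\<dots> = a ^ 3" using a(2) by (simp add: power3_eq_cube power2_eq_square)
      finally show ?thesis using x powr_minus_divide[of x "3 / 2"] by simp
    qed
    ultimately have 1: "x powr (- 3 / 2) \<le> 6 * (?f n - ?f (Suc n))" by simp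
    have "x powr (- b) = x powr (3 / 2 - b) * x powr (- 3 / 2)" by (simp add: powr_add[symmetric])
    also have "\<dots> \<le> real (Suc Y) powr (3 / 2 - b) * (6 * (?f n - ?f (Suc n)))"
      using x assms 1 by (intro mult_mono powr_mono2') auto
    finally show ?thesis by (simp add: x_def algebra_simps)
  qed
  show sm: "summable (\<lambda>n. real (Suc (n + Y)) powr (- b))"
    by (rule summable_comparison_test'[of "\<lambda>n. ?c * (?f n - ?f (Suc n))"])
       (use le t in \<open>auto intro!: summable_mult sums_summable\<close>)
  have "(\<Sum>n. real (Suc (n + Y)) powr (- b)) \<le> (\<Sum>n. ?c * (?f n - ?f (Suc n)))"
    using t by (intro suminf_le sm le summable_mult) (auto simp: sums_iff)
  also have "\<dots> = ?c * ?f 0" using t by (simp add: suminf_mult sums_iff)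
  also have "\<dots> = 6 * real (Suc Y) powr (1 - b)" by (simp add: powr_add[symmetric])
  finally show "(\<Sum>n. real (Suc (n + Y)) powr (- b)) \<le> 6 * real (Suc Y) powr (1 - b)" .
qed

lemma zeta_rem_tail_bound:
  assumes "Re s \<ge> 1 / 2"
  shows "summable (\<lambda>n. zeta_rem (Suc m) n s)"
    "norm (\<Sum>n. zeta_rem (Suc m) (n + Y) s)
     \<le> (\<Prod>j<Suc (Suc m). 1 + norm s + real j) * (6 * real (Suc Y) powr (- Re s - real m))"
proof -
  define P where "P = (\<Prod>j<Suc (Suc m). 1 + norm s + real j)"
  have P: "P \<ge> 0" unfolding P_def by (intro prod_nonneg) auto
  have le: "norm (zeta_rem (Suc m) (n + Y) s) \<le> P * real (Suc (n + Y)) powr (- (Re s + real (Suc m)))" for n Y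
  proof -
    have e: "- Re s - real (Suc m) = - (Re s + real (Suc m))" by simp
    have "0 \<le> Re s + real (Suc m)" using assms by simp
    from zeta_rem_bound[OF this order.refl order.refl, of "n + Y"] show ?thesis
      unfolding P_def e .
  qed
  have b: "Re s + real (Suc m) \<ge> 3 / 2" using assms by simp
  note S = powr_tail_sum[OF b]
  have sm: "summable (\<lambda>n. norm (zeta_rem (Suc m) (n + Y) s))" for Y
    by (rule summable_comparison_test'[of "\<lambda>n. P * real (Suc (n + Y)) powr (- (Re s + real (Suc m)))"])
       (use le S(1) in \<open>auto intro!: summable_mult\<close>)
  show "summable (\<lambda>n. zeta_rem (Suc m) n s)" using summable_norm_cancel[OF sm[of 0]] by simp
  have "norm (\<Sum>n. zeta_rem (Suc m) (n + Y) s) \<le> (\<Sum>n. norm (zeta_rem (Suc m) (n + Y) s))"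
    by (rule summable_norm[OF sm])
  also have "\<dots> \<le> (\<Sum>n. P * real (Suc (n + Y)) powr (- (Re s + real (Suc m))))"
    by (intro suminf_le le sm summable_mult S)
  also have "\<dots> = P * (\<Sum>n. real (Suc (n + Y)) powr (- (Re s + real (Suc m))))"
    by (intro suminf_mult S)
  also have "\<dots> \<le> P * (6 * real (Suc Y) powr (1 - (Re s + real (Suc m))))"
    by (intro mult_left_mono S P)
  also have "1 - (Re s + real (Suc m)) = - Re s - real m" by simp
  finally show "norm (\<Sum>n. zeta_rem (Suc m) (n + Y) s)
     \<le> (\<Prod>j<Suc (Suc m). 1 + norm s + real j) * (6 * real (Suc Y) powr (- Re s - real m))"
    unfolding P_def .
qed

text \<open>The difference of the full and the partial Taylor identity. It expresses the tail at
  \<open>s\<close> through the tails at \<open>s + 1\<close>, ..., \<open>s + m\<close>, which are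
  smaller by powers of \<open>Suc Y\<close>, and does the work of the Euler-Maclaurin
  formula.\<close>

lemma ztail_identity:
  assumes "Re s \<ge> 1 / 2" "Im s > 0"
  shows "(s - 1) * ztail Y s = of_nat (Suc Y) powr (1 - s)
    + (\<Sum>k=2..Suc m. falling k s / fact k * ztail Y (s - 1 + of_nat k))
    + (\<Sum>n. zeta_rem (Suc m) (n + Y) s)"
proof -
  have "(\<Sum>n. zeta_rem (Suc m) (n + Y) s)
      = (\<Sum>n. zeta_rem (Suc m) n s) - (\<Sum>n<Y. zeta_rem (Suc m) n s)"
    by (rule suminf_minus_initial_segment[OF zeta_rem_tail_bound(1)[OF assms(1)]])
  also have "(\<Sum>n. zeta_rem (Suc m) n s) = - 1 + (s - 1) * zeta s
    - (\<Sum>k=2..Suc m. falling k s / fact k * zeta (s - 1 + of_nat k))"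
    using assms by (intro zeta_rem_sum_continued) auto
  finally show ?thesis
    unfolding zeta_rem_partial_sum ztail_def right_diff_distrib sum_subtractf by simp
qed

lemma norm_falling_le:
  assumes "norm s \<le> D * t" "t \<ge> 1"
  shows "norm (falling k s) \<le> (\<Prod>j<k. 1 + D + real j) * t ^ k"
    "(\<Prod>j<k. 1 + norm s + real j) \<le> (\<Prod>j<k. 1 + D + real j) * t ^ k"
proof -
  have le: "1 + norm s + real j \<le> (1 + D + real j) * t" for j
    using assms mult_left_mono[of 1 t "1 + real j"] by (simp add: algebra_simps)
  have "(\<Prod>j<k. 1 + norm s + real j) \<le> (\<Prod>j<k. (1 + D + real j) * t)"
    by (intro prod_mono conjI le) auto
  also have "\<dots> = (\<Prod>j<k. 1 + D + real j) * t ^ k" by (simp add: prod.distrib)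
  finally show 2: "(\<Prod>j<k. 1 + norm s + real j) \<le> (\<Prod>j<k. 1 + D + real j) * t ^ k" .
  have "norm (falling k s) \<le> (\<Prod>j<k. 1 + norm s + real j)"
    unfolding falling_def prod_norm[symmetric]
  proof (intro prod_mono conjI)
    fix j
    have "norm (1 - s - of_nat j) \<le> norm (1 - s) + norm (of_nat j :: complex)"
      by (rule norm_triangle_ineq4)
    also have "norm (1 - s) \<le> norm (1::complex) + norm s" by (rule norm_triangle_ineq4)
    finally show "norm (1 - s - of_nat j) \<le> 1 + norm s + real j" by simp
  qed auto
  thus "norm (falling k s) \<le> (\<Prod>j<k. 1 + D + real j) * t ^ k" using 2 by simp
qed

text \<open>Put \<open>t = Im s\<close>, \<open>Z = Suc Y\<close> and
  \<open>r = t / Z \<le> 1\<close>. In \<open>ztail_identity\<close> the factor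
  \<open>falling k s\<close> is \<open>O(t ^ k)\<close>, and the assumed bound supplies
  \<open>k - 1\<close> factors \<open>1 / Z\<close>, so the summand is
  \<open>t * r ^ (k - 1)\<close> times the old bracket; \<open>k \<ge> 2\<close> leaves at least one
  factor \<open>r\<close>. As \<open>r * (1 / t + r ^ m) \<le> 1 / t + r ^ Suc m\<close>, the
  exponent grows by one, and division by \<open>norm (s - 1) \<ge> t\<close> removes the factor
  \<open>t\<close>.\<close>

lemma ztail_step:
  fixes B C :: real
  assumes "B \<ge> 1" "C \<ge> 0"
  shows "\<exists>C'>0. \<forall>Y s. 1 / 2 \<le> Re s \<longrightarrow> Re s \<le> B \<longrightarrow> 1 \<le> Im s \<longrightarrow> Im s \<le> real (Suc Y) \<longrightarrow>
    (\<forall>k\<in>{2..Suc m}. norm (ztail Y (s - 1 + of_nat k))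
        \<le> C * real (Suc Y) powr (2 - Re s - real k) * (1 / Im s + (Im s / real (Suc Y)) ^ m)) \<longrightarrow>
    norm (ztail Y s) \<le> C' * real (Suc Y) powr (1 - Re s) * (1 / Im s + (Im s / real (Suc Y)) ^ Suc m)"
proof -
  define P where "P = (\<lambda>k. \<Prod>j<k. 1 + (1 + B) + real j)"
  have P: "P k \<ge> 0" for k unfolding P_def using assms by (intro prod_nonneg) auto
  define C' where "C' = 1 + (\<Sum>k=2..Suc m. P k * C) + 6 * P (Suc (Suc m))"
  have "C' > 0" unfolding C'_def using P assms by (intro add_pos_nonneg sum_nonneg mult_nonneg_nonneg) auto
  moreover have "norm (ztail Y s) \<le> C' * real (Suc Y) powr (1 - Re s) * (1 / Im s + (Im s
    / real (Suc Y)) ^ Suc m)"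
    if s: "1 / 2 \<le> Re s" "Re s \<le> B" "1 \<le> Im s" "Im s \<le> real (Suc Y)"
    and hyp: "\<forall>k\<in>{2..Suc m}. norm (ztail Y (s - 1 + of_nat k))
        \<le> C * real (Suc Y) powr (2 - Re s - real k) * (1 / Im s + (Im s / real (Suc Y)) ^ m)" for Y s
  proof -
    define t where "t = Im s"
    define Z where "Z = real (Suc Y)"
    define r where "r = t / Z"
    define E where "E = Z powr (1 - Re s)"
    define W where "W = t * E * (1 / t + r ^ Suc m)"
    have t: "t \<ge> 1" "Z \<ge> 1" "t \<le> Z" using s by (auto simp: t_def Z_def)
    have r: "0 < r" "r \<le> 1" using t by (auto simp: r_def)
    have E: "E \<ge> 0" by (simp add: E_def)
    have "norm s \<le> \<bar>Re s\<bar> + \<bar>Im s\<bar>" by (rule cmod_le)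
    also have "\<dots> \<le> B + t" using s by (simp add: t_def)
    also have "\<dots> \<le> (1 + B) * t" using assms t mult_left_mono[of 1 t B] by (simp add: algebra_simps)
    finally have ns: "norm s \<le> (1 + B) * t" .
    have fb: "norm (falling k s) \<le> P k * t ^ k"
      "(\<Prod>j<k. 1 + norm s + real j) \<le> P k * t ^ k" for k
      unfolding P_def by (rule norm_falling_le[OF ns t(1)])+
    have pw: "Z powr (1 - Re s - real j) = E / Z ^ j" for j
      unfolding E_def powr_diff using t by (simp add: powr_realpow)
    have b1: "norm (of_nat (Suc Y) powr (1 - s)) \<le> W"
    proof -
      have "norm (of_nat (Suc Y) powr (1 - s)) = E"
        unfolding E_def Z_def by (subst norm_powr_real_powr) auto
      also have "E = t * E * (1 / t + 0)" using t by simp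
      also have "\<dots> \<le> W" unfolding W_def using t E r by (intro mult_left_mono add_left_mono) auto
      finally show ?thesis .
    qed
    have b2: "norm (falling k s / fact k * ztail Y (s - 1 + of_nat k)) \<le> P k * C * W"
      if k: "k \<in> {2..Suc m}" for k
    proof -
      have "k = Suc (Suc (k - 2))" using k by auto
      then obtain j where j: "k = Suc (Suc j)" by blast
      have "norm (falling k s / fact k) \<le> norm (falling k s)"
        by (simp add: norm_divide divide_le_eq mult_le_cancel_left1)
      also have "\<dots> \<le> P k * t ^ k" by (rule fb)
      finally have 1: "norm (falling k s / fact k) \<le> P k * t ^ k" .
      have "2 - Re s - real k = 1 - Re s - real (Suc j)" by (simp add: j)
      moreover have "norm (ztail Y (s - 1 + of_nat k)) \<le> C * Z powr (2 - Re s - real k) * (1 / t + r ^ m)"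
        using bspec[OF hyp k] unfolding t_def Z_def r_def .
      ultimately have 2: "norm (ztail Y (s - 1 + of_nat k)) \<le> C * (E / Z ^ Suc j) * (1 / t + r ^ m)"
        by (simp only: pw)
      have "norm (falling k s / fact k * ztail Y (s - 1 + of_nat k))
         \<le> (P k * t ^ k) * (C * (E / Z ^ Suc j) * (1 / t + r ^ m))"
        unfolding norm_mult using 1 2 P t by (intro mult_mono) auto
      also have "\<dots> = P k * C * (t * E * (r ^ Suc j * (1 / t + r ^ m)))"
        unfolding r_def j by (simp add: power_divide)
      also have "r ^ Suc j * (1 / t + r ^ m) \<le> r * (1 / t + r ^ m)"
        using r t power_decreasing[of 1 "Suc j" r] by (intro mult_right_mono) auto
      also have "\<dots> \<le> 1 / t + r ^ Suc m"
        using r t mult_right_mono[of r 1 "1 / t"] by (simp add: algebra_simps)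
      finally show ?thesis unfolding W_def using P assms t E by (simp add: mult_left_mono)
    qed
    have b3: "norm (\<Sum>n. zeta_rem (Suc m) (n + Y) s) \<le> 6 * P (Suc (Suc m)) * W"
    proof -
      have e: "- Re s - real m = 1 - Re s - real (Suc m)" by simp
      have "norm (\<Sum>n. zeta_rem (Suc m) (n + Y) s)
        \<le> (\<Prod>j<Suc (Suc m). 1 + norm s + real j) * (6 * (E / Z ^ Suc m))"
        using zeta_rem_tail_bound(2)[OF s(1), of m Y] unfolding Z_def[symmetric] e pw .
      also have "\<dots> \<le> (P (Suc (Suc m)) * t ^ Suc (Suc m)) * (6 * (E / Z ^ Suc m))"
        using t E by (intro mult_right_mono fb) auto
      also have "\<dots> = 6 * P (Suc (Suc m)) * (t * E * (0 + r ^ Suc m))"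
        by (simp add: r_def power_divide)
      also have "\<dots> \<le> 6 * P (Suc (Suc m)) * W"
        unfolding W_def using t E P r by (intro mult_left_mono add_right_mono) auto
      finally show ?thesis .
    qed
    have "norm ((s - 1) * ztail Y s) \<le> norm (of_nat (Suc Y) powr (1 - s) :: complex)
       + norm (\<Sum>k=2..Suc m. falling k s / fact k * ztail Y (s - 1 + of_nat k))
       + norm (\<Sum>n. zeta_rem (Suc m) (n + Y) s)"
      using s by (subst ztail_identity[of s Y m]) (auto intro!: norm_triangle_le)
    also have "norm (\<Sum>k=2..Suc m. falling k s / fact k * ztail Y (s - 1 + of_nat k))
       \<le> (\<Sum>k=2..Suc m. P k * C * W)" by (rule sum_norm_le) (rule b2)
    also have "\<dots> = (\<Sum>k=2..Suc m. P k * C) * W" by (simp only: sum_distrib_right)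
    finally have "norm (s - 1) * norm (ztail Y s) \<le> C' * W"
      using b1 b3 unfolding C'_def norm_mult distrib_right by linarith
    moreover have "t * norm (ztail Y s) \<le> norm (s - 1) * norm (ztail Y s)"
      using abs_Im_le_cmod[of "s - 1"] t by (intro mult_right_mono) (auto simp: t_def)
    ultimately have "t * norm (ztail Y s) \<le> t * (C' * E * (1 / t + r ^ Suc m))"
      unfolding W_def by (simp add: mult_ac)
    thus ?thesis using t unfolding E_def r_def t_def[symmetric] Z_def by (simp add: mult_le_cancel_left)
  qed
  ultimately show ?thesis by blast
qed

text \<open>Induction by \<open>ztail_step\<close>. The bound \<open>B\<close> is kept arbitrary
  because each step refers to points further to the right.\<close>

lemma ztail_bound_power:
  "\<exists>C>0. \<forall>Y s. 1 / 2 \<le> Re s \<longrightarrow> Re s \<le> B \<longrightarrow> 1 \<le> Im s \<longrightarrow> Im s \<le> real (Suc Y) \<longrightarrow>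
    norm (ztail Y s) \<le> C * real (Suc Y) powr (1 - Re s) * (1 / Im s + (Im s / real (Suc Y)) ^ Suc m)"
proof (induction m arbitrary: B)
  case 0
  have B: "max B 1 \<ge> 1" by simp
  \<comment> \<open>For \<open>m = 0\<close> the range of \<open>k\<close> is empty, so the
    hypothesis on the tails holds vacuously and the constant 0 may be inserted for it.\<close>
  from ztail_step[OF B order.refl, of 0] obtain C' where C': "C' > 0"
   "\<And>Y s. 1 / 2 \<le> Re s \<Longrightarrow> Re s \<le> max B 1 \<Longrightarrow> 1 \<le> Im s \<Longrightarrow> Im s \<le> real (Suc Y) \<Longrightarrow>
    (\<forall>k\<in>{2..Suc 0}. norm (ztail Y (s - 1 + of_nat k))
        \<le> 0 * real (Suc Y) powr (2 - Re s - real k) * (1 / Im s + (Im s / real (Suc Y)) ^ 0)) \<Longrightarrow>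
    norm (ztail Y s) \<le> C' * real (Suc Y) powr (1 - Re s) * (1 / Im s + (Im s / real (Suc Y)) ^ Suc 0)"
    by blast
  have "{2..Suc 0} = {}" by simp
  thus ?case using C' by (intro exI[of _ C'] conjI allI impI C'(2)) auto
next
  case (Suc m)
  from Suc.IH[of "max B 1 + real (Suc m)"] obtain C where C: "C > 0"
    "\<And>Y s. 1 / 2 \<le> Re s \<Longrightarrow> Re s \<le> max B 1 + real (Suc m) \<Longrightarrow> 1 \<le> Im s \<Longrightarrow> Im s \<le> real (Suc Y) \<Longrightarrow>
    norm (ztail Y s) \<le> C * real (Suc Y) powr (1 - Re s) * (1 / Im s + (Im s / real (Suc Y)) ^ Suc m)"
    by blast
  have "max B 1 \<ge> 1" "C \<ge> 0" using C by auto
  from ztail_step[OF this, of "Suc m"] obtain C' where C': "C' > 0"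
   "\<And>Y s. 1 / 2 \<le> Re s \<Longrightarrow> Re s \<le> max B 1 \<Longrightarrow> 1 \<le> Im s \<Longrightarrow> Im s \<le> real (Suc Y) \<Longrightarrow>
    (\<forall>k\<in>{2..Suc (Suc m)}. norm (ztail Y (s - 1 + of_nat k))
        \<le> C * real (Suc Y) powr (2 - Re s - real k) * (1 / Im s + (Im s / real (Suc Y)) ^ Suc m)) \<Longrightarrow>
    norm (ztail Y s) \<le> C' * real (Suc Y) powr (1 - Re s) * (1 / Im s + (Im s / real (Suc Y)) ^ Suc (Suc m))"
    by blast
  show ?case
  proof (intro exI[of _ C'] conjI allI impI C'(1))
    fix Y s assume s: "1 / 2 \<le> Re s" "Re s \<le> B" "1 \<le> Im s" "Im s \<le> real (Suc Y)"
    show "norm (ztail Y s) \<le> C' * real (Suc Y) powr (1 - Re s) * (1 / Im s + (Im s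
      / real (Suc Y)) ^ Suc (Suc m))"
    proof (rule C'(2))
      show "\<forall>k\<in>{2..Suc (Suc m)}. norm (ztail Y (s - 1 + of_nat k))
        \<le> C * real (Suc Y) powr (2 - Re s - real k) * (1 / Im s + (Im s / real (Suc Y)) ^ Suc m)"
      proof
        fix k assume k: "k \<in> {2..Suc (Suc m)}"
        have e: "1 - Re (s - 1 + of_nat k) = 2 - Re s - real k" by simp
        have "real k \<le> real (Suc (Suc m))" using k by (simp only: of_nat_le_iff) auto
        thus "norm (ztail Y (s - 1 + of_nat k))
        \<le> C * real (Suc Y) powr (2 - Re s - real k) * (1 / Im s + (Im s / real (Suc Y)) ^ Suc m)"
          using C(2)[of "s - 1 + of_nat k" Y] s k unfolding e by auto
      qed
    qed (use s in auto)
  qed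
qed

text \<open>The condition on \<open>Y\<close> says that
  \<open>(t / Suc Y) ^ Suc m \<le> 1 / t\<close> for \<open>t = Im s\<close>, so both parts of the
  bracket in \<open>ztail_bound_power\<close> are at most \<open>1 / t\<close>. It amounts to
  \<open>Suc Y \<ge> t powr (1 + 1 / (m + 1))\<close>: for large \<open>m\<close> the partial sum
  need only be slightly longer than the height.\<close>

lemma ztail_bound:
  "\<exists>C>0. \<forall>Y s. 1 / 2 \<le> Re s \<longrightarrow> Re s \<le> B \<longrightarrow> 1 \<le> Im s \<longrightarrow>
    Im s ^ Suc (Suc m) \<le> real (Suc Y) ^ Suc m \<longrightarrow>
    norm (ztail Y s) \<le> C * real (Suc Y) powr (1 - Re s) / Im s"
proof -
  from ztail_bound_power[of B m] obtain C where C: "C > 0"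
    "\<And>Y s. 1 / 2 \<le> Re s \<Longrightarrow> Re s \<le> B \<Longrightarrow> 1 \<le> Im s \<Longrightarrow> Im s \<le> real (Suc Y) \<Longrightarrow>
    norm (ztail Y s) \<le> C * real (Suc Y) powr (1 - Re s) * (1 / Im s + (Im s / real (Suc Y)) ^ Suc m)"
    by blast
  show ?thesis
  proof (intro exI[of _ "2 * C"] conjI allI impI)
    fix Y s assume s: "1 / 2 \<le> Re s" "Re s \<le> B" "1 \<le> Im s"
      and p: "Im s ^ Suc (Suc m) \<le> real (Suc Y) ^ Suc m"
    have "Im s ^ Suc m \<le> Im s ^ Suc (Suc m)" using s by (intro power_increasing) auto
    hence "Im s ^ Suc m \<le> real (Suc Y) ^ Suc m" using p by linarith
    hence le: "Im s \<le> real (Suc Y)" by (rule power_le_imp_le_base) auto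
    have "(Im s / Z) ^ Suc m \<le> 1 / Im s" if "Im s ^ Suc (Suc m) \<le> Z ^ Suc m" "Z > 0" for Z
      using that s by (simp add: power_divide divide_simps mult_ac)
    from this[OF p] have "1 / Im s + (Im s / real (Suc Y)) ^ Suc m \<le> 2 / Im s" by simp
    hence "C * real (Suc Y) powr (1 - Re s) * (1 / Im s + (Im s / real (Suc Y)) ^ Suc m)
       \<le> C * real (Suc Y) powr (1 - Re s) * (2 / Im s)" using C(1) by (intro mult_left_mono) auto
    with C(2)[OF s le] show "norm (ztail Y s) \<le> 2 * C * real (Suc Y) powr (1 - Re s) / Im s" by simp
  qed (use C in auto)
qed

text \<open>The partial sum of length about \<open>Im s\<close> is estimated trivially. A linear
  bound is enough, since only its logarithm enters later, through
  \<open>borel_caratheodory\<close>.\<close>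

lemma zeta_growth:
  "\<exists>C>0. \<forall>s. 1 / 2 \<le> Re s \<longrightarrow> Re s \<le> B \<longrightarrow> 1 \<le> Im s \<longrightarrow> norm (zeta s) \<le> C * Im s"
proof -
  from ztail_bound_power[of B 0] obtain C where C: "C > 0"
    "\<And>Y s. 1 / 2 \<le> Re s \<Longrightarrow> Re s \<le> B \<Longrightarrow> 1 \<le> Im s \<Longrightarrow> Im s \<le> real (Suc Y) \<Longrightarrow>
    norm (ztail Y s) \<le> C * real (Suc Y) powr (1 - Re s) * (1 / Im s + (Im s / real (Suc Y)) ^ Suc 0)"
    by blast
  show ?thesis
  proof (intro exI[of _ "4 * C + 1"] conjI allI impI)
    fix s assume s: "1 / 2 \<le> Re s" "Re s \<le> B" "1 \<le> Im s"
    define Y where "Y = nat \<lfloor>Im s\<rfloor>"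
    have Y: "real Y \<le> Im s" "Im s \<le> real (Suc Y)" "real (Suc Y) \<le> 2 * Im s"
      using s unfolding Y_def by linarith+
    have "1 / Im s + (Im s / real (Suc Y)) ^ Suc 0 \<le> 1 + 1"
      using s Y by (intro add_mono) (auto simp: divide_simps)
    moreover have "real (Suc Y) powr (1 - Re s) \<le> real (Suc Y) powr 1"
      using s by (intro powr_mono) auto
    ultimately have "C * real (Suc Y) powr (1 - Re s) * (1 / Im s + (Im s / real (Suc Y)) ^ Suc 0)
      \<le> C * real (Suc Y) powr 1 * 2"
      using C(1) s by (intro mult_mono mult_nonneg_nonneg add_nonneg_nonneg) auto
    also have "\<dots> = 2 * C * real (Suc Y)" by simp
    also have "\<dots> \<le> 2 * C * (2 * Im s)" using Y C(1) by (intro mult_left_mono) auto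
    finally have 1: "norm (ztail Y s) \<le> 4 * C * Im s" using C(2)[OF s Y(2)] by simp
    have "norm (\<Sum>n<Y. of_nat (Suc n) powr (- s) :: complex) \<le> (\<Sum>n<Y. 1)"
    proof (rule sum_norm_le)
      fix n
      have "norm (of_nat (Suc n) powr (- s) :: complex) = real (Suc n) powr (- Re s)"
        by (subst norm_powr_real_powr) auto
      also have "\<dots> \<le> real (Suc n) powr 0" using s by (intro powr_mono) auto
      finally show "norm (of_nat (Suc n) powr (- s) :: complex) \<le> 1" by simp
    qed
    hence 2: "norm (\<Sum>n<Y. of_nat (Suc n) powr (- s) :: complex) \<le> Im s" using Y by simp
    have "zeta s = ztail Y s + (\<Sum>n<Y. of_nat (Suc n) powr (- s))" by (simp add: ztail_def)
    hence "norm (zeta s) \<le> norm (ztail Y s) + norm (\<Sum>n<Y. of_nat (Suc n) powr (- s) :: complex)"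
      by (simp only: norm_triangle_ineq)
    hence "norm (zeta s) \<le> 4 * C * Im s + Im s" using 1 2 by linarith
    thus "norm (zeta s) \<le> (4 * C + 1) * Im s" by (simp add: algebra_simps)
  qed (use C in auto)
qed

section \<open>Mean values of Dirichlet polynomials\<close>

lemma harm_le_ln: "n > 0 \<Longrightarrow> harm n \<le> 1 + ln (real n)"
proof (induction n rule: nat_induct_non_zero)
  case (Suc n)
  have "ln (real n / (real n + 1)) \<le> real n / (real n + 1) - 1" using Suc.hyps by (intro ln_le_minus_one) auto
  moreover have "ln (real n / (real n + 1)) = ln (real n) - ln (real n + 1)" using Suc.hyps
    by (simp add: ln_div)
  moreover have "real n / (real n + 1) - 1 = - (1 / (real n + 1))" by (simp add: field_simps)
  ultimately have "1 / (real n + 1) \<le> ln (real n + 1) - ln (real n)" by linarith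
  thus ?case using Suc by (simp add: harm_Suc inverse_eq_divide add.commute)
qed (simp add: harm_def)

text \<open>The harmonic sum occurs three times: for \<open>n\<close> below \<open>m\<close>, for
  \<open>n\<close> above \<open>m\<close>, and for the extra term \<open>1 / n\<close> that
  \<open>off_diagonal_bound\<close> produces.\<close>

lemma sum_inverse_dist_le:
  fixes m Z :: nat
  assumes "m \<in> {1..Z}"
  shows "(\<Sum>n\<in>{1..Z} - {m}. 1 / \<bar>real m - real n\<bar> + 1 / real n) \<le> 3 * (1 + ln (real Z))"
proof -
  have H: "(\<Sum>j=1..Z. 1 / real j) \<le> 1 + ln (real Z)"
    using harm_le_ln[of Z] assms by (simp add: harm_def inverse_eq_divide)
  have split: "{1..Z} - {m} = {1..<m} \<union> {m<..Z}" using assms by auto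
  have "(\<Sum>n\<in>{1..<m}. 1 / \<bar>real m - real n\<bar>) = (\<Sum>j\<in>{1..<m}. 1 / real j)"
    by (rule sum.reindex_bij_witness[of _ "\<lambda>j. m - j" "\<lambda>j. m - j"]) (auto simp: of_nat_diff)
  also have "\<dots> \<le> (\<Sum>j=1..Z. 1 / real j)" using assms by (intro sum_mono2) auto
  finally have 1: "(\<Sum>n\<in>{1..<m}. 1 / \<bar>real m - real n\<bar>) \<le> 1 + ln (real Z)" using H by linarith
  have "(\<Sum>n\<in>{m<..Z}. 1 / \<bar>real m - real n\<bar>) = (\<Sum>j\<in>{1..Z-m}. 1 / real j)"
    by (rule sum.reindex_bij_witness[of _ "\<lambda>j. m + j" "\<lambda>j. j - m"]) (auto simp: of_nat_diff)
  also have "\<dots> \<le> (\<Sum>j=1..Z. 1 / real j)" using assms by (intro sum_mono2) auto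
  finally have 2: "(\<Sum>n\<in>{m<..Z}. 1 / \<bar>real m - real n\<bar>) \<le> 1 + ln (real Z)" using H by linarith
  have "(\<Sum>n\<in>{1..Z} - {m}. 1 / real n) \<le> (\<Sum>j=1..Z. 1 / real j)" by (intro sum_mono2) auto
  hence 3: "(\<Sum>n\<in>{1..Z} - {m}. 1 / real n) \<le> 1 + ln (real Z)" using H by linarith
  have "(\<Sum>n\<in>{1..Z} - {m}. 1 / \<bar>real m - real n\<bar>)
     = (\<Sum>n\<in>{1..<m}. 1 / \<bar>real m - real n\<bar>) + (\<Sum>n\<in>{m<..Z}. 1 / \<bar>real m - real n\<bar>)"
    unfolding split by (rule sum.union_disjoint) auto
  hence "(\<Sum>n\<in>{1..Z} - {m}. 1 / \<bar>real m - real n\<bar>) \<le> (1 + ln (real Z)) + (1 + ln (real Z))"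
    using add_mono[OF 1 2] by simp
  from add_mono[OF this 3] show ?thesis unfolding sum.distrib by simp
qed

lemma abs_ln_diff_ge:
  fixes m n :: nat
  assumes "1 \<le> m" "m < n"
  shows "(real n - real m) / real n \<le> ln (real n) - ln (real m)"
proof -
  have "ln (real m / real n) \<le> real m / real n - 1" using assms by (intro ln_le_minus_one) auto
  thus ?thesis using assms by (simp add: ln_div field_simps)
qed

text \<open>For \<open>m < n\<close> the difference of the logarithms is at least
  \<open>(n - m) / n\<close>; the inequality of the means, applied to \<open>x * m\<close> and
  \<open>y * n\<close>, then separates the two coefficients. The bound is written symmetrically so
  that \<open>m < n\<close> may be assumed. After summation it replaces Hilbert's inequality at the
  price of a logarithm.\<close>

lemma off_diagonal_bound:
  fixes m n :: nat and x y :: real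
  assumes "1 \<le> m" "1 \<le> n" "m \<noteq> n" "x \<ge> 0" "y \<ge> 0"
  shows "x * y * (2 / \<bar>ln (real m) - ln (real n)\<bar>)
    \<le> x\<^sup>2 * real m * (1 / \<bar>real m - real n\<bar> + 1 / real n) + y\<^sup>2 * real n * (1 / \<bar>real n - real m\<bar> + 1
      / real m)"
  using assms
proof (induction m n arbitrary: x y rule: linorder_wlog)
  case (le m n)
  define a where "a = real m"
  define b where "b = real n"
  have ab: "1 \<le> a" "a < b" using le by (auto simp: a_def b_def)
  have l: "(b - a) / b \<le> \<bar>ln a - ln b\<bar>" using abs_ln_diff_ge[of m n] le by (simp add: a_def b_def)
  have pos: "(b - a) / b > 0" using ab by simp
  have "2 / \<bar>ln a - ln b\<bar> \<le> 2 / ((b - a) / b)" using l pos by (intro divide_left_mono mult_pos_pos) auto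
  hence "x * y * (2 / \<bar>ln a - ln b\<bar>) \<le> x * y * (2 / ((b - a) / b))"
    using le by (intro mult_left_mono mult_nonneg_nonneg) auto
  also have "x * y * (2 / ((b - a) / b)) = (2 * (x * a) * (y * b)) / (a * (b - a))" using ab
    by (simp add: field_simps)
  also have "\<dots> \<le> ((x * a)\<^sup>2 + (y * b)\<^sup>2) / (a * (b - a))"
    using ab sum_squares_bound[of "x * a" "y * b"] by (intro divide_right_mono) auto
  also have "\<dots> = x\<^sup>2 * a * (1 / (b - a)) + y\<^sup>2 * b * (1 / (b - a) + 1 / a)"
  proof -
    have "b - a \<noteq> 0" "a \<noteq> 0" using ab by auto
    thus ?thesis by (simp add: divide_simps power2_eq_square)
  qed
  also have "\<dots> \<le> x\<^sup>2 * a * (1 / (b - a) + 1 / b) + y\<^sup>2 * b * (1 / (b - a) + 1 / a)"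
    using ab by (intro add_right_mono mult_left_mono) auto
  finally show ?case using ab unfolding a_def b_def by simp
next
  case (sym m n)
  have "y * x * (2 / \<bar>ln (real n) - ln (real m)\<bar>)
    \<le> y\<^sup>2 * real n * (1 / \<bar>real n - real m\<bar> + 1 / real m) + x\<^sup>2 * real m * (1 / \<bar>real m - real n\<bar> + 1
      / real n)"
    by (rule sym.IH) (use sym.prems in auto)
  thus ?case by (simp add: abs_minus_commute mult.commute add.commute)
qed

lemma integral_cos_le:
  fixes a b l :: real
  assumes "a \<le> b" "l \<noteq> 0"
  shows "((\<lambda>t. cos (t * l)) has_integral (sin (b * l) - sin (a * l)) / l) {a..b}"
    "\<bar>(sin (b * l) - sin (a * l)) / l\<bar> \<le> 2 / \<bar>l\<bar>"
proof -
  have "((\<lambda>t. cos (t * l)) has_integral sin (b * l) / l - sin (a * l) / l) {a..b}"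
    using assms
    by (intro fundamental_theorem_of_calculus)
       (auto intro!: derivative_eq_intros simp flip: has_real_derivative_iff_has_vector_derivative)
  thus "((\<lambda>t. cos (t * l)) has_integral (sin (b * l) - sin (a * l)) / l) {a..b}"
    by (simp add: diff_divide_distrib)
  have "\<bar>sin (b * l) - sin (a * l)\<bar> \<le> 2"
    using abs_sin_le_one[of "b * l"] abs_sin_le_one[of "a * l"] by linarith
  thus "\<bar>(sin (b * l) - sin (a * l)) / l\<bar> \<le> 2 / \<bar>l\<bar>"
    unfolding abs_divide by (rule divide_right_mono) simp
qed

lemma norm_sq_dirichlet_poly:
  assumes "finite A" "0 \<notin> A"
  shows "(norm (\<Sum>n\<in>A. complex_of_real (a n) * of_nat n powr (- (\<i> * of_real t))))\<^sup>2
    = (\<Sum>m\<in>A. \<Sum>n\<in>A. a m * a n * cos (t * (ln (real m) - ln (real n))))"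
proof -
  have e: "complex_of_real (a n) * of_nat n powr (- (\<i> * of_real t))
     = Complex (a n * cos (t * ln (real n))) (- (a n * sin (t * ln (real n))))" if "n \<in> A" for n
  proof -
    have n: "n > 0" using that assms by (metis gr0I)
    have "complex_of_nat n powr (- (\<i> * of_real t)) = exp (\<i> * of_real (- (t * ln (real n))))"
      using n by (simp add: powr_def Ln_of_nat mult_ac)
    also have "\<dots> = cis (- (t * ln (real n)))" by (rule cis_conv_exp[symmetric])
    finally show ?thesis by (simp add: complex_eq_iff)
  qed
  have "(norm (\<Sum>n\<in>A. complex_of_real (a n) * of_nat n powr (- (\<i> * of_real t))))\<^sup>2
    = (\<Sum>n\<in>A. a n * cos (t * ln (real n)))\<^sup>2 + (\<Sum>n\<in>A. - (a n * sin (t * ln (real n))))\<^sup>2"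
    unfolding cmod_power2 by (simp add: e cong: sum.cong)
  also have "\<dots> = (\<Sum>m\<in>A. \<Sum>n\<in>A. a m * a n * cos (t * (ln (real m) - ln (real n))))"
    by (simp add: power2_eq_square sum_product sum.distrib[symmetric] right_diff_distrib cos_diff
      algebra_simps)
  finally show ?thesis .
qed

text \<open>The diagonal of the opened square contributes the length of the interval; off the
  diagonal the cosine integrals are \<open>O(1 / |ln m - ln n|)\<close> and
  \<open>off_diagonal_bound\<close> applies. The logarithm lost against the sharp mean value theorem
  is harmless, because everything saved later is a power.\<close>

lemma mean_value:
  fixes a :: "nat \<Rightarrow> real"
  assumes A: "A \<subseteq> {1..Z}" and T: "T0 \<le> T"
  shows "integral {T0..T} (\<lambda>t. (norm (\<Sum>n\<in>A. complex_of_real (a n) * of_nat n powr (- (\<i> * of_real t))))\<^sup>2)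
    \<le> (\<Sum>n\<in>A. (a n)\<^sup>2 * ((T - T0) + 6 * real n * (1 + ln (real Z))))"
proof -
  let ?I = "integral {T0..T} (\<lambda>t. (norm (\<Sum>n\<in>A. complex_of_real (a n) * of_nat n powr (- (\<i> * of_real t))))\<^sup>2)"
  let ?D = "\<Sum>m\<in>A. (a m)\<^sup>2 * (T - T0)"
  let ?V = "\<Sum>m\<in>A. \<Sum>n\<in>A - {m}. (a m)\<^sup>2 * real m * (1 / \<bar>real m - real n\<bar> + 1 / real n)"
  let ?U = "\<Sum>m\<in>A. (a m)\<^sup>2 * real m * (3 * (1 + ln (real Z)))"
  have fin: "finite A" and A0: "0 \<notin> A" using A by (auto intro: finite_subset)
  define I where "I = (\<lambda>m n. if m = n then T - T0 else
    (sin (T * (ln (real m) - ln (real n))) - sin (T0 * (ln (real m) - ln (real n)))) / (ln (real m)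
      - ln (real n)))"
  have ln: "ln (real m) - ln (real n) \<noteq> 0" if "m \<in> A" "n \<in> A" "m \<noteq> n" for m n
  proof -
    have "real m > 0" "real n > 0" using that A by auto
    thus ?thesis using that by (simp add: ln_inj_iff)
  qed
  have hi: "((\<lambda>t. a m * a n * cos (t * (ln (real m) - ln (real n)))) has_integral a m * a n * I m n) {T0..T}"
    if "m \<in> A" "n \<in> A" for m n
  proof (rule has_integral_mult_right)
    show "((\<lambda>t. cos (t * (ln (real m) - ln (real n)))) has_integral I m n) {T0..T}"
      using integral_cos_le(1)[OF T ln[OF that]] has_integral_const_real[of "1::real" T0 T] T
      by (auto simp: I_def)
  qed
  have "integral {T0..T} (\<lambda>t. (norm (\<Sum>n\<in>A. complex_of_real (a n) * of_nat n powr (- (\<i> * of_real t))))\<^sup>2)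
     = (\<Sum>m\<in>A. \<Sum>n\<in>A. a m * a n * I m n)"
    unfolding norm_sq_dirichlet_poly[OF fin A0]
    by (intro integral_unique has_integral_sum fin hi)
  also have "\<dots> = (\<Sum>m\<in>A. (a m)\<^sup>2 * (T - T0) + (\<Sum>n\<in>A - {m}. a m * a n * I m n))"
    using fin by (intro sum.cong refl) (simp add: sum.remove I_def power2_eq_square)
  also have "\<dots> \<le> (\<Sum>m\<in>A. (a m)\<^sup>2 * (T - T0) + (\<Sum>n\<in>A - {m}.
     (a m)\<^sup>2 * real m * (1 / \<bar>real m - real n\<bar> + 1 / real n) + (a n)\<^sup>2 * real n * (1 / \<bar>real n - real m\<bar>
       + 1 / real m)))"
  proof (intro sum_mono add_left_mono)
    fix m n assume mn: "m \<in> A" "n \<in> A - {m}"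
    have "a m * a n * I m n \<le> \<bar>a m\<bar> * \<bar>a n\<bar> * \<bar>I m n\<bar>" by (metis abs_ge_self abs_mult)
    also have "\<dots> \<le> \<bar>a m\<bar> * \<bar>a n\<bar> * (2 / \<bar>ln (real m) - ln (real n)\<bar>)"
      using integral_cos_le(2)[OF T ln[of m n]] mn by (intro mult_left_mono) (auto simp: I_def)
    also have "\<dots> \<le> \<bar>a m\<bar>\<^sup>2 * real m * (1 / \<bar>real m - real n\<bar> + 1 / real n)
       + \<bar>a n\<bar>\<^sup>2 * real n * (1 / \<bar>real n - real m\<bar> + 1 / real m)"
      using mn A by (intro off_diagonal_bound) auto
    finally show "a m * a n * I m n \<le> (a m)\<^sup>2 * real m * (1 / \<bar>real m - real n\<bar> + 1 / real n)
       + (a n)\<^sup>2 * real n * (1 / \<bar>real n - real m\<bar> + 1 / real m)" by simp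
  qed
  also have "\<dots> = (\<Sum>m\<in>A. (a m)\<^sup>2 * (T - T0))
     + (\<Sum>m\<in>A. \<Sum>n\<in>A - {m}. (a m)\<^sup>2 * real m * (1 / \<bar>real m - real n\<bar> + 1 / real n))
     + (\<Sum>m\<in>A. \<Sum>n\<in>A - {m}. (a n)\<^sup>2 * real n * (1 / \<bar>real n - real m\<bar> + 1 / real m))"
    by (simp add: sum.distrib)
  \<comment> \<open>Exchanging the roles of \<open>m\<close> and \<open>n\<close> turns this half
    into the other one, which doubles the 3 of \<open>sum_inverse_dist_le\<close> to the 6 of the
    statement.\<close>
  also have "(\<Sum>m\<in>A. \<Sum>n\<in>A - {m}. (a n)\<^sup>2 * real n * (1 / \<bar>real n - real m\<bar> + 1 / real m))
     = (\<Sum>m\<in>A. \<Sum>n\<in>A - {m}. (a m)\<^sup>2 * real m * (1 / \<bar>real m - real n\<bar> + 1 / real n))"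
  proof -
    have "A - {m} = {n\<in>A. m \<noteq> n}" for m by auto
    hence "(\<Sum>m\<in>A. \<Sum>n\<in>A - {m}. (a n)\<^sup>2 * real n * (1 / \<bar>real n - real m\<bar> + 1 / real m))
      = (\<Sum>m\<in>A. \<Sum>n\<in>{n\<in>A. m \<noteq> n}. (a n)\<^sup>2 * real n * (1 / \<bar>real n - real m\<bar> + 1 / real m))" by simp
    also have "\<dots> = (\<Sum>n\<in>A. \<Sum>m\<in>{m\<in>A. m \<noteq> n}. (a n)\<^sup>2 * real n * (1 / \<bar>real n - real m\<bar> + 1 / real m))"
      by (rule sum.swap_restrict[OF fin fin])
    also have "(\<lambda>n. {m\<in>A. m \<noteq> n}) = (\<lambda>n. A - {n})" by auto
    finally show ?thesis .
  qed
  finally have le: "?I \<le> ?D + ?V + ?V" .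
  have "?V \<le> ?U"
  proof (rule sum_mono)
    fix m assume m: "m \<in> A"
    have "(\<Sum>n\<in>A - {m}. 1 / \<bar>real m - real n\<bar> + 1 / real n)
       \<le> (\<Sum>n\<in>{1..Z} - {m}. 1 / \<bar>real m - real n\<bar> + 1 / real n)"
      using A by (intro sum_mono2) auto
    also have "\<dots> \<le> 3 * (1 + ln (real Z))" using m A by (intro sum_inverse_dist_le) auto
    finally show "(\<Sum>n\<in>A - {m}. (a m)\<^sup>2 * real m * (1 / \<bar>real m - real n\<bar> + 1 / real n))
       \<le> (a m)\<^sup>2 * real m * (3 * (1 + ln (real Z)))"
      unfolding sum_distrib_left[symmetric] by (intro mult_left_mono) auto
  qed
  hence "?I \<le> ?D + ?U + ?U" using le by linarith
  also have "(\<Sum>m\<in>A. (a m)\<^sup>2 * (T - T0)) + (\<Sum>m\<in>A. (a m)\<^sup>2 * real m * (3 * (1 + ln (real Z))))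
      + (\<Sum>m\<in>A. (a m)\<^sup>2 * real m * (3 * (1 + ln (real Z))))
    = (\<Sum>n\<in>A. (a n)\<^sup>2 * ((T - T0) + 6 * real n * (1 + ln (real Z))))"
    unfolding sum.distrib[symmetric] by (intro sum.cong refl) (simp add: algebra_simps)
  finally show ?thesis .
qed

section \<open>Divisor sums and the Moebius function\<close>

text \<open>A pair of divisors \<open>d\<close>, \<open>e\<close> of \<open>n\<close> is encoded by
  the four numbers \<open>gcd d e\<close>, \<open>d / gcd d e\<close>, \<open>e / gcd d e\<close>
  and \<open>n / lcm d e\<close>. Their product is \<open>n\<close> and they determine
  \<open>(n, d, e)\<close>, so the left side is a part of the expanded fourth power. It is a finite
  form of one half of Ramanujan's formula for the series of squared divisor numbers.\<close>

lemma divisor_square_sum_le: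
  fixes a :: real
  shows "(\<Sum>n=1..Z. real (card {d. d dvd n}) ^ 2 * real n powr (- a)) \<le> (\<Sum>n=1..Z. real n powr (- a)) ^ 4"
proof -
  define I where "I = {1..Z}"
  define D where "D = (\<lambda>n::nat. {d. d dvd n})"
  define S where "S = (SIGMA n:I. D n \<times> D n)"
  define h where "h = (\<lambda>(n::nat, d::nat, e::nat). (gcd d e, d div gcd d e, e div gcd d e, n div lcm d e))"
  define w where "w = (\<lambda>(g::nat, x::nat, y::nat, k::nat). (real g powr (- a) * real x powr (- a))
    * (real y powr (- a) * real k powr (- a)))"
  have finD: "finite (D n)" if "n \<in> I" for n using that by (auto simp: D_def I_def)
  have rec: "gcd d e * (d div gcd d e) = d" "gcd d e * (e div gcd d e) = e"
      "gcd d e * (d div gcd d e) * (e div gcd d e) * (n div lcm d e) = n"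
    if "d dvd n" "e dvd n" for n d e :: nat
  proof -
    show 1: "gcd d e * (d div gcd d e) = d" "gcd d e * (e div gcd d e) = e" by simp_all
    have "gcd d e * (d div gcd d e) * (e div gcd d e) = lcm d e"
      by (simp add: lcm_nat_def div_mult_swap)
    thus "gcd d e * (d div gcd d e) * (e div gcd d e) * (n div lcm d e) = n"
      using that by (simp add: lcm_least)
  qed
  have inj: "inj_on h S"
    by (rule inj_on_inverseI[of _ "\<lambda>(g, x, y, k). (g * x * y * k, g * x, g * y)"])
       (use rec in \<open>auto simp: S_def D_def h_def\<close>)
  have sub: "h ` S \<subseteq> I \<times> I \<times> I \<times> I"
  proof (clarsimp simp: S_def D_def h_def I_def)
    fix n d e :: nat assume n: "Suc 0 \<le> n" "n \<le> Z" "d dvd n" "e dvd n"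
    have de: "d > 0" "e > 0" "d \<le> n" "e \<le> n" using n by (auto dest: dvd_imp_le intro: dvd_pos_nat)
    have "gcd d e \<le> Z" "d div gcd d e \<le> Z" "e div gcd d e \<le> Z" "n div lcm d e \<le> Z"
      using gcd_le1_nat[of d e] div_le_dividend[of d "gcd d e"] div_le_dividend[of e "gcd d e"]
        div_le_dividend[of n "lcm d e"] de n by linarith+
    moreover have "gcd d e > 0" using de by auto
    moreover have "d div gcd d e > 0" "e div gcd d e > 0" "n div lcm d e > 0"
      using de n gcd_le1_nat[of d e] gcd_le2_nat[of e d] dvd_imp_le[OF lcm_least[OF n(3,4)]]
      by (auto simp: div_greater_zero_iff lcm_pos_nat)
    ultimately show "Suc 0 \<le> gcd d e \<and> gcd d e \<le> Z \<and> Suc 0 \<le> d div gcd d e \<and> d div gcd d e \<le> Z \<and>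
       Suc 0 \<le> e div gcd d e \<and> e div gcd d e \<le> Z \<and> Suc 0 \<le> n div lcm d e \<and> n div lcm d e \<le> Z"
      by (simp add: Suc_le_eq)
  qed
  have "(\<Sum>n=1..Z. real (card {d. d dvd n}) ^ 2 * real n powr (- a))
      = (\<Sum>n\<in>I. \<Sum>p\<in>D n \<times> D n. real n powr (- a))"
    by (simp add: I_def D_def card_cartesian_product power2_eq_square)
  also have "\<dots> = (\<Sum>(n, p)\<in>S. real n powr (- a))"
    unfolding S_def using finD by (intro sum.Sigma) (auto simp: I_def)
  also have "\<dots> = (\<Sum>x\<in>S. w (h x))"
  proof (rule sum.cong)
    fix x assume "x \<in> S"
    then obtain n d e where x: "x = (n, d, e)" "d dvd n" "e dvd n" by (auto simp: S_def D_def)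
    have "real n = real (gcd d e) * real (d div gcd d e) * real (e div gcd d e) * real (n div lcm d e)"
      using rec(3)[OF x(2,3)] by (metis of_nat_mult)
    thus "(case x of (n, p) \<Rightarrow> real n powr (- a)) = w (h x)"
      unfolding x(1) w_def h_def by (simp add: powr_mult mult_ac)
  qed simp
  also have "\<dots> = (\<Sum>x\<in>h ` S. w x)" by (simp add: sum.reindex[OF inj])
  also have "\<dots> \<le> (\<Sum>x\<in>I \<times> I \<times> I \<times> I. w x)"
    using sub by (intro sum_mono2) (auto simp: I_def w_def)
  also have "\<dots> = (\<Sum>n\<in>I. real n powr (- a)) ^ 4"
    by (simp add: w_def sum.cartesian_product[symmetric] power4_eq_xxxx sum_product sum_distrib_left
      sum_distrib_right mult_ac)
  finally show ?thesis unfolding I_def .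
qed

definition moebius :: "nat \<Rightarrow> real" where
  "moebius n = (if squarefree n then (- 1) ^ card (prime_factors n) else 0)"

lemma abs_moebius_le: "\<bar>moebius n\<bar> \<le> 1"
  by (simp add: moebius_def)

lemma moebius_prime_mult:
  assumes "prime p" "squarefree (d::nat)" "\<not> p dvd d"
  shows "moebius (p * d) = - moebius d"
proof -
  have d0: "d \<noteq> 0" using assms(2) by (metis not_squarefree_0)
  have "coprime p d" using assms by (simp add: prime_imp_coprime)
  hence "squarefree (p * d)" using assms by (simp add: squarefree_mult_coprime squarefree_prime)
  moreover have "prime_factors (p * d) = insert p (prime_factors d)"
    using assms d0 by (simp add: prime_factors_product prime_prime_factors)
  moreover have "p \<notin> prime_factors d" using assms by auto
  ultimately show ?thesis using assms by (simp add: moebius_def)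
qed

text \<open>Fix a prime \<open>p\<close> dividing \<open>n\<close>. The squarefree divisors, which
  alone count, fall into pairs \<open>d\<close>, \<open>p * d\<close> with \<open>d\<close> prime to
  \<open>p\<close>, and the two values of a pair cancel.\<close>

lemma sum_moebius_divisors:
  assumes "n > 1"
  shows "(\<Sum>d | d dvd n. moebius d) = 0"
proof -
  obtain p where p: "prime p" "p dvd n" using assms prime_factor_nat[of n] by auto
  define D where "D = {d. d dvd n \<and> squarefree d}"
  define D0 where "D0 = {d\<in>D. \<not> p dvd d}"
  have fin: "finite {d. d dvd n}" using assms by simp
  have "(\<Sum>d | d dvd n. moebius d) = (\<Sum>d\<in>D. moebius d)"
    by (rule sum.mono_neutral_right) (use fin in \<open>auto simp: D_def moebius_def\<close>)
  also have "D = D0 \<union> (\<lambda>d. p * d) ` D0"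
  proof (intro equalityI subsetI)
    fix d assume d: "d \<in> D"
    show "d \<in> D0 \<union> (\<lambda>d. p * d) ` D0"
    proof (cases "p dvd d")
      case True
      then obtain e where e: "d = p * e" by blast
      have "\<not> p dvd e"
        using d p e unfolding D_def squarefree_def
        by (metis (no_types, lifting) dvd_triv_left mem_Collect_eq mult_dvd_mono not_prime_unit
          power2_eq_square dvd_refl)
      moreover have "squarefree e" using d e by (auto simp: D_def dest: squarefree_multD)
      moreover have "e dvd n" using d e by (auto simp: D_def dest: dvd_mult_right)
      ultimately show ?thesis using e by (auto simp: D0_def D_def)
    qed (use d in \<open>auto simp: D0_def\<close>)
  next
    fix d assume "d \<in> D0 \<union> (\<lambda>d. p * d) ` D0"
    thus "d \<in> D"
    proof
      assume "d \<in> (\<lambda>d. p * d) ` D0"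
      then obtain e where e: "d = p * e" "e dvd n" "squarefree e" "\<not> p dvd e" by (auto simp: D0_def D_def)
      have cop: "coprime p e" using e p by (simp add: prime_imp_coprime)
      thus "d \<in> D" using e p unfolding D_def
        by (auto simp: squarefree_mult_coprime squarefree_prime divides_mult)
    qed (auto simp: D0_def)
  qed
  also have "(\<Sum>d\<in>D0 \<union> (\<lambda>d. p * d) ` D0. moebius d) = (\<Sum>d\<in>D0. moebius d) + (\<Sum>d\<in>(\<lambda>d. p * d) ` D0. moebius d)"
    using fin by (intro sum.union_disjoint) (auto simp: D0_def D_def)
  also have "(\<Sum>d\<in>(\<lambda>d. p * d) ` D0. moebius d) = (\<Sum>d\<in>D0. moebius (p * d))"
    using p prime_gt_0_nat[OF p(1)] by (subst sum.reindex) (auto simp: inj_on_def)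
  also have "\<dots> = (\<Sum>d\<in>D0. - moebius d)"
    using p by (intro sum.cong refl moebius_prime_mult) (auto simp: D0_def D_def)
  finally show ?thesis by (simp add: sum_negf)
qed

section \<open>The mollified zeta function in mean square\<close>

text \<open>The Dirichlet series of \<open>1 / zeta\<close>, cut off at \<open>X\<close>.\<close>

definition mollifier :: "nat \<Rightarrow> complex \<Rightarrow> complex" where
  "mollifier X s = (\<Sum>d=1..X. of_real (moebius d) * of_nat d powr (- s))"

text \<open>The coefficient at \<open>n\<close> of the product of the mollifier with the first
  \<open>Y\<close> terms of the zeta series: the two conditions on \<open>d\<close> reflect the two
  cut-offs.\<close>

definition moll_coeff :: "nat \<Rightarrow> nat \<Rightarrow> nat \<Rightarrow> real" where
  "moll_coeff X Y n = (\<Sum>d | d \<in> {1..X} \<and> d dvd n \<and> n div d \<le> Y. moebius d)"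

lemma mollifier_mult_partial_sum:
  "mollifier X s * (\<Sum>n<Y. of_nat (Suc n) powr (- s))
    = (\<Sum>n=1..X*Y. of_real (moll_coeff X Y n) * of_nat n powr (- s))"
proof -
  have "(\<Sum>n<Y. of_nat (Suc n) powr (- s)) = (\<Sum>e=1..Y. of_nat e powr (- s) :: complex)"
    by (rule sum.reindex_bij_witness[of _ "\<lambda>e. e - 1" Suc]) auto
  hence "mollifier X s * (\<Sum>n<Y. of_nat (Suc n) powr (- s))
    = (\<Sum>d=1..X. \<Sum>e=1..Y. (of_real (moebius d) * of_nat d powr (- s)) * of_nat e powr (- s))"
    by (simp add: mollifier_def sum_product)
  also have "\<dots> = (\<Sum>(d, e)\<in>{1..X} \<times> {1..Y}. (of_real (moebius d) * of_nat d powr (- s)) * of_nat e powr (- s))"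
    by (rule sum.cartesian_product)
  also have "\<dots> = (\<Sum>(n, d)\<in>(SIGMA n:{1..X*Y}. {d. d \<in> {1..X} \<and> d dvd n \<and> n div d \<le> Y}).
      of_real (moebius d) * of_nat n powr (- s))"
  proof (rule sum.reindex_bij_witness[of _ "\<lambda>(n, d). (d, n div d)" "\<lambda>(d, e). (d * e, d)"])
    fix a assume "a \<in> {1..X} \<times> {1..Y}"
    then obtain d e where a: "a = (d, e)" "1 \<le> d" "d \<le> X" "1 \<le> e" "e \<le> Y" by auto
    show "(case case a of (d, e) \<Rightarrow> (d * e, d) of (n, d) \<Rightarrow> (d, n div d)) = a" using a by simp
    show "(case a of (d, e) \<Rightarrow> (d * e, d)) \<in> (SIGMA n:{1..X*Y}. {d. d \<in> {1..X} \<and> d dvd n \<and> n div d \<le> Y})"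
      using a mult_le_mono[of d X e Y] mult_le_mono[of 1 d 1 e] by simp
    show "(case case a of (d, e) \<Rightarrow> (d * e, d) of (n, d) \<Rightarrow> of_real (moebius d) * of_nat n powr (- s))
      = (case a of (d, e) \<Rightarrow> (of_real (moebius d) * of_nat d powr (- s)) * of_nat e powr (- s))"
      using a by (simp add: powr_times_real)
  next
    fix b assume "b \<in> (SIGMA n:{1..X*Y}. {d. d \<in> {1..X} \<and> d dvd n \<and> n div d \<le> Y})"
    then obtain n d where b: "b = (n, d)" "1 \<le> n" "1 \<le> d" "d \<le> X" "d dvd n" "n div d \<le> Y" by auto
    show "(case case b of (n, d) \<Rightarrow> (d, n div d) of (d, e) \<Rightarrow> (d * e, d)) = b" using b by simp
    have "n div d > 0" using b dvd_imp_le[of d n] by (simp add: div_greater_zero_iff)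
    thus "(case b of (n, d) \<Rightarrow> (d, n div d)) \<in> {1..X} \<times> {1..Y}" using b by simp
  qed
  also have "\<dots> = (\<Sum>n=1..X*Y. \<Sum>d | d \<in> {1..X} \<and> d dvd n \<and> n div d
    \<le> Y. of_real (moebius d) * of_nat n powr (- s))"
    by (rule sum.Sigma[symmetric]) auto
  also have "\<dots> = (\<Sum>n=1..X*Y. of_real (moll_coeff X Y n) * of_nat n powr (- s))"
    by (simp add: moll_coeff_def sum_distrib_right)
  finally show ?thesis .
qed

lemma abs_moll_coeff_le:
  assumes "n > 0"
  shows "\<bar>moll_coeff X Y n\<bar> \<le> real (card {d. d dvd n})"
proof -
  have fin: "finite {d. d dvd n}" using assms by simp
  have "\<bar>moll_coeff X Y n\<bar> \<le> (\<Sum>d | d \<in> {1..X} \<and> d dvd n \<and> n div d \<le> Y. \<bar>moebius d\<bar>)"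
    unfolding moll_coeff_def by (rule sum_abs)
  also have "\<dots> \<le> (\<Sum>d | d \<in> {1..X} \<and> d dvd n \<and> n div d \<le> Y. 1)"
    by (intro sum_mono abs_moebius_le)
  also have "\<dots> \<le> (\<Sum>d | d dvd n. 1)" by (rule sum_mono2[OF fin]) auto
  finally show ?thesis by simp
qed

text \<open>Neither cut-off is felt for \<open>n \<le> X\<close>, so the complete Moebius sum
  remains. Hence the mollified partial sum minus 1 consists of terms with \<open>n > X\<close> only,
  which is what makes it small in mean square.\<close>

lemma moll_coeff_small:
  assumes "0 < n" "n \<le> X" "X \<le> Y"
  shows "moll_coeff X Y n = (if n = 1 then 1 else 0)"
proof -
  have "{d. d \<in> {1..X} \<and> d dvd n \<and> n div d \<le> Y} = {d. d dvd n}"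
  proof (intro equalityI subsetI)
    fix d assume "d \<in> {d. d dvd n}"
    hence d: "d dvd n" "d > 0" "d \<le> n" using assms by (auto intro: dvd_imp_le dvd_pos_nat)
    have "n div d \<le> Y" using div_le_dividend[of n d] assms by linarith
    with d show "d \<in> {d. d \<in> {1..X} \<and> d dvd n \<and> n div d \<le> Y}" using assms by auto
  qed auto
  hence "moll_coeff X Y n = (\<Sum>d | d dvd n. moebius d)" by (simp add: moll_coeff_def)
  also have "\<dots> = (if n = 1 then 1 else 0)"
    using sum_moebius_divisors[of n] assms by (auto simp: moebius_def)
  finally show ?thesis .
qed

lemma mollifier_partial_sum_minus_one:
  assumes "1 \<le> X" "X \<le> Y"
  shows "mollifier X s * (\<Sum>n<Y. of_nat (Suc n) powr (- s)) - 1
    = (\<Sum>n\<in>{X<..X*Y}. of_real (moll_coeff X Y n) * of_nat n powr (- s))"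
proof -
  have "{1..Z} = {1..X} \<union> {X<..Z}" if "X \<le> Z" for Z using that assms by auto
  from this[of "X * Y"] have XY: "{1..X*Y} = {1..X} \<union> {X<..X*Y}" using assms by simp
  have "(\<Sum>n=1..X*Y. of_real (moll_coeff X Y n) * of_nat n powr (- s))
    = (\<Sum>n=1..X. of_real (moll_coeff X Y n) * of_nat n powr (- s))
     + (\<Sum>n\<in>{X<..X*Y}. of_real (moll_coeff X Y n) * of_nat n powr (- s))"
    unfolding XY by (rule sum.union_disjoint) auto
  also have "(\<Sum>n=1..X. of_real (moll_coeff X Y n) * of_nat n powr (- s))
     = (\<Sum>n=1..X. if n = 1 then 1 else 0 :: complex)"
    using assms by (intro sum.cong refl) (simp add: moll_coeff_small)
  also have "\<dots> = 1" using assms by simp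
  finally show ?thesis unfolding mollifier_mult_partial_sum by simp
qed

lemma mollifier_holomorphic [holomorphic_intros]: "mollifier X holomorphic_on A"
  unfolding mollifier_def by (intro holomorphic_intros) auto

lemma norm_mollifier_le:
  assumes "Re s \<ge> 0"
  shows "norm (mollifier X s) \<le> real X"
proof -
  have "norm (mollifier X s) \<le> (\<Sum>d=1..X. 1)"
    unfolding mollifier_def
  proof (rule sum_norm_le)
    fix d assume d: "d \<in> {1..X}"
    have "norm (of_real (moebius d) * of_nat d powr (- s)) = \<bar>moebius d\<bar> * real d powr (- Re s)"
      by (simp add: norm_mult norm_powr_real_powr)
    also have "\<dots> \<le> 1 * real d powr 0"
      using assms d by (intro mult_mono abs_moebius_le powr_mono) auto
    finally show "norm (of_real (moebius d) * of_nat d powr (- s)) \<le> 1" using d by simp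
  qed
  thus ?thesis by simp
qed

text \<open>The coefficients are at most the divisor number times \<open>n powr (- \<beta>)\<close>,
  and \<open>n powr (- 2 * \<beta>)\<close> is at most
  \<open>n powr (- (1 + \<eta>)) * n powr (- \<eta>)\<close>. The first factor makes the sum of the
  squared divisor numbers converge, by \<open>divisor_square_sum_le\<close>. The second, as
  \<open>n > X\<close>, gives the saving \<open>X powr (- \<eta>)\<close> on the diagonal and turns
  the weight \<open>n\<close> of the off-diagonal part into
  \<open>n powr (1 - \<eta>)\<close>.\<close>

lemma mollified_partial_sum_mean_square:
  assumes \<eta>: "0 < \<eta>" "\<eta> < 1 / 2"
  shows "\<exists>S>0. \<forall>X Y \<beta> T0 T. 1 \<le> X \<longrightarrow> X \<le> Y \<longrightarrow> 1 / 2 + \<eta> \<le> \<beta> \<longrightarrow> 0 \<le> T0 \<longrightarrow> T0 \<le> T \<longrightarrow>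
    integral {T0..T} (\<lambda>t. (norm (mollifier X (of_real \<beta> + \<i> * of_real t)
        * (\<Sum>n<Y. of_nat (Suc n) powr (- (of_real \<beta> + \<i> * of_real t))) - 1))\<^sup>2)
     \<le> S * (T * real X powr (- \<eta>) + 6 * (1 + ln (real (X * Y))) * real (X * Y) powr (1 - \<eta>))"
proof -
  define s where "s = (\<Sum>n. real n powr (- (1 + \<eta>)))"
  have sm: "summable (\<lambda>n. real n powr (- (1 + \<eta>)))" using \<eta> by (simp add: summable_real_powr_iff)
  have "s ^ 4 + 1 > 0" by (intro add_nonneg_pos) auto
  moreover have "integral {T0..T} (\<lambda>t. (norm (mollifier X (of_real \<beta> + \<i> * of_real t)
        * (\<Sum>n<Y. of_nat (Suc n) powr (- (of_real \<beta> + \<i> * of_real t))) - 1))\<^sup>2)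
     \<le> (s ^ 4 + 1) * (T * real X powr (- \<eta>) + 6 * (1 + ln (real (X * Y))) * real (X * Y) powr (1 - \<eta>))"
    if XY: "1 \<le> X" "X \<le> Y" and \<beta>: "1 / 2 + \<eta> \<le> \<beta>" and T: "0 \<le> T0" "T0 \<le> T" for X Y \<beta> T0 T
  proof -
    define Z where "Z = X * Y"
    have Z1: "Z \<ge> 1" using XY by (simp add: Z_def)
    define a where "a = (\<lambda>n. moll_coeff X Y n * real n powr (- \<beta>))"
    define W where "W = T * real X powr (- \<eta>) + 6 * (1 + ln (real Z)) * real Z powr (1 - \<eta>)"
    have lZ: "ln (real Z) \<ge> 0" using Z1 by simp
    have W0: "W \<ge> 0" unfolding W_def using T lZ by (intro add_nonneg_nonneg mult_nonneg_nonneg) auto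
    have e: "mollifier X (of_real \<beta> + \<i> * of_real t)
        * (\<Sum>n<Y. of_nat (Suc n) powr (- (of_real \<beta> + \<i> * of_real t))) - 1
      = (\<Sum>n\<in>{X<..Z}. of_real (a n) * of_nat n powr (- (\<i> * of_real t)))" for t
      unfolding mollifier_partial_sum_minus_one[OF XY] Z_def[symmetric]
    proof (rule sum.cong)
      fix n assume "n \<in> {X<..Z}"
      hence n: "n > 0" by auto
      have "of_nat n powr (- (of_real \<beta> + \<i> * of_real t))
        = of_nat n powr (of_real (- \<beta>)) * of_nat n powr (- (\<i> * of_real t))"
        by (simp add: powr_add[symmetric])
      also have "of_nat n powr (of_real (- \<beta>)) = (of_real (real n powr (- \<beta>)) :: complex)"
        using powr_of_real[of "real n" "- \<beta>"] by simp
      finally show "of_real (moll_coeff X Y n) * of_nat n powr (- (of_real \<beta> + \<i> * of_real t))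
        = of_real (a n) * of_nat n powr (- (\<i> * of_real t))" by (simp add: a_def)
    qed simp
    have "integral {T0..T} (\<lambda>t. (norm (\<Sum>n\<in>{X<..Z}. of_real (a n) * of_nat n powr (- (\<i> * of_real t))))\<^sup>2)
      \<le> (\<Sum>n\<in>{X<..Z}. (a n)\<^sup>2 * ((T - T0) + 6 * real n * (1 + ln (real Z))))"
      using T XY by (intro mean_value) auto
    also have "\<dots> \<le> (\<Sum>n\<in>{X<..Z}. (real (card {d. d dvd n}))\<^sup>2 * real n powr (- (1 + \<eta>)) * W)"
    proof (rule sum_mono)
      fix n assume n: "n \<in> {X<..Z}"
      hence n1: "real n \<ge> 1" "real n \<ge> real X" "real n \<le> real Z" using XY by auto
      have "\<bar>moll_coeff X Y n\<bar> \<le> real (card {d. d dvd n})" using n by (intro abs_moll_coeff_le) auto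
      hence c: "(moll_coeff X Y n)\<^sup>2 \<le> (real (card {d. d dvd n}))\<^sup>2"
        by (metis abs_ge_zero power2_abs power_mono)
      have p: "(real n powr (- \<beta>))\<^sup>2 * ((T - T0) + 6 * real n * (1 + ln (real Z)))
        \<le> real n powr (- (1 + \<eta>)) * W"
      proof -
        have "(real n powr (- \<beta>))\<^sup>2 = real n powr (- (2 * \<beta>))" using n1 by (simp add: powr_power)
        also have "\<dots> \<le> real n powr (- (1 + 2 * \<eta>))" using n1 \<beta> by (intro powr_mono) auto
        also have "- (1 + 2 * \<eta>) = - (1 + \<eta>) + - \<eta>" by simp
        also have "real n powr (- (1 + \<eta>) + - \<eta>) = real n powr (- (1 + \<eta>)) * real n powr (- \<eta>)"
          by (rule powr_add)
        finally have 1: "(real n powr (- \<beta>))\<^sup>2 \<le> real n powr (- (1 + \<eta>)) * real n powr (- \<eta>)" .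
        have "(real n powr (- \<beta>))\<^sup>2 * ((T - T0) + 6 * real n * (1 + ln (real Z)))
          \<le> real n powr (- (1 + \<eta>)) * real n powr (- \<eta>) * (T + 6 * real n * (1 + ln (real Z)))"
          using 1 T n1 lZ by (intro mult_mono add_mono) auto
        also have "\<dots> = real n powr (- (1 + \<eta>)) * (T * real n powr (- \<eta>) + 6 * (1 + ln (real Z))
          * (real n powr 1 * real n powr (- \<eta>)))"
          using n1 by (simp add: algebra_simps)
        also have "real n powr 1 * real n powr (- \<eta>) = real n powr (1 - \<eta>)"
          using powr_add[of "real n" 1 "- \<eta>"] by simp
        also have "real n powr (- (1 + \<eta>)) * (T * real n powr (- \<eta>) + 6 * (1 + ln (real Z))
          * real n powr (1 - \<eta>))
           \<le> real n powr (- (1 + \<eta>)) * W"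
          unfolding W_def using T n1 lZ \<eta> XY
          by (intro mult_left_mono add_mono powr_mono2 powr_mono2') auto
        finally show ?thesis .
      qed
      have "(a n)\<^sup>2 * ((T - T0) + 6 * real n * (1 + ln (real Z)))
         = (moll_coeff X Y n)\<^sup>2 * ((real n powr (- \<beta>))\<^sup>2 * ((T - T0) + 6 * real n * (1 + ln (real Z))))"
        by (simp add: a_def power_mult_distrib)
      also have "\<dots> \<le> (real (card {d. d dvd n}))\<^sup>2 * (real n powr (- (1 + \<eta>)) * W)"
        using T lZ n1 by (intro mult_mono[OF c p]) (auto intro!: mult_nonneg_nonneg add_nonneg_nonneg)
      finally show "(a n)\<^sup>2 * ((T - T0) + 6 * real n * (1 + ln (real Z)))
         \<le> (real (card {d. d dvd n}))\<^sup>2 * real n powr (- (1 + \<eta>)) * W" by (simp add: mult.assoc)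
    qed
    also have "\<dots> \<le> (\<Sum>n=1..Z. (real (card {d. d dvd n}))\<^sup>2 * real n powr (- (1 + \<eta>)) * W)"
      using W0 by (intro sum_mono2) auto
    also have "\<dots> = (\<Sum>n=1..Z. (real (card {d. d dvd n}))\<^sup>2 * real n powr (- (1 + \<eta>))) * W"
      by (simp add: sum_distrib_right)
    also have "\<dots> \<le> (\<Sum>n=1..Z. real n powr (- (1 + \<eta>))) ^ 4 * W"
      by (intro mult_right_mono divisor_square_sum_le W0)
    also have "\<dots> \<le> s ^ 4 * W"
      unfolding s_def using W0 by (intro mult_right_mono power_mono sum_le_suminf sm sum_nonneg) auto
    also have "\<dots> \<le> (s ^ 4 + 1) * W" using W0 by (intro mult_right_mono) auto
    finally show ?thesis unfolding e W_def Z_def .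
  qed
  ultimately show ?thesis by blast
qed

text \<open>Zeta is its partial sum plus \<open>ztail Y\<close>. The tail enters the product with a
  factor of modulus at most \<open>X\<close> and is \<open>O(Y powr (1 / 2 - \<eta>) / t)\<close> by
  \<open>ztail_bound\<close>; its square is integrable with integral of \<open>1 / t^2\<close> at
  most 1, because \<open>T0 \<ge> 1\<close>. This yields the third term.\<close>

lemma mollified_mean_square:
  assumes \<eta>: "0 < \<eta>" "\<eta> < 1 / 2"
  shows "\<exists>C>0. \<forall>X Y \<beta> T0 T. 1 \<le> X \<longrightarrow> X \<le> Y \<longrightarrow> 1 / 2 + \<eta> \<le> \<beta> \<longrightarrow> \<beta> \<le> 4 \<longrightarrow> 1 \<le> T0 \<longrightarrow> T0 \<le> T \<longrightarrow>
    T ^ Suc (Suc m) \<le> real (Suc Y) ^ Suc m \<longrightarrow>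
    integral {T0..T} (\<lambda>t. (norm (zeta (of_real \<beta> + \<i> * of_real t) * mollifier X (of_real \<beta> + \<i>
      * of_real t) - 1))\<^sup>2)
     \<le> C * (T * real X powr (- \<eta>) + (1 + ln (real (X * Y))) * real (X * Y) powr (1 - \<eta>)
         + real X ^ 2 * real (Suc Y) powr (1 - 2 * \<eta>))"
proof -
  from mollified_partial_sum_mean_square[OF \<eta>] obtain S where S: "S > 0"
    "\<And>X Y \<beta> T0 T. 1 \<le> X \<Longrightarrow> X \<le> Y \<Longrightarrow> 1 / 2 + \<eta> \<le> \<beta> \<Longrightarrow> 0 \<le> T0 \<Longrightarrow> T0 \<le> T \<Longrightarrow>
    integral {T0..T} (\<lambda>t. (norm (mollifier X (of_real \<beta> + \<i> * of_real t)
        * (\<Sum>n<Y. of_nat (Suc n) powr (- (of_real \<beta> + \<i> * of_real t))) - 1))\<^sup>2)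
     \<le> S * (T * real X powr (- \<eta>) + 6 * (1 + ln (real (X * Y))) * real (X * Y) powr (1 - \<eta>))" by blast
  from ztail_bound[of 4 m] obtain D where D: "D > 0"
    "\<And>Y s. 1 / 2 \<le> Re s \<Longrightarrow> Re s \<le> 4 \<Longrightarrow> 1 \<le> Im s \<Longrightarrow> Im s ^ Suc (Suc m) \<le> real (Suc Y) ^ Suc m \<Longrightarrow>
    norm (ztail Y s) \<le> D * real (Suc Y) powr (1 - Re s) / Im s" by blast
  define C where "C = 12 * S + 2 * D\<^sup>2"
  have "C > 0" using S D by (simp add: C_def add_pos_nonneg)
  moreover have "integral {T0..T} (\<lambda>t. (norm (zeta (of_real \<beta> + \<i> * of_real t) * mollifier X (of_real \<beta>
    + \<i> * of_real t) - 1))\<^sup>2)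
     \<le> C * (T * real X powr (- \<eta>) + (1 + ln (real (X * Y))) * real (X * Y) powr (1 - \<eta>)
         + real X ^ 2 * real (Suc Y) powr (1 - 2 * \<eta>))"
    if XY: "1 \<le> X" "X \<le> Y" and \<beta>: "1 / 2 + \<eta> \<le> \<beta>" "\<beta> \<le> 4" and T: "1 \<le> T0" "T0 \<le> T"
      and TY: "T ^ Suc (Suc m) \<le> real (Suc Y) ^ Suc m" for X Y \<beta> T0 T
  proof -
    define p where "p = (\<lambda>t. of_real \<beta> + \<i> * of_real t)"
    define P where "P = (\<lambda>s. mollifier X s * (\<Sum>n<Y. of_nat (Suc n) powr (- s)) - 1)"
    define G where "G = (\<lambda>s. zeta s * mollifier X s - 1)"
    define E where "E = real X ^ 2 * D\<^sup>2 * real (Suc Y) powr (1 - 2 * \<eta>)"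
    have E0: "E \<ge> 0" by (simp add: E_def)
    have rp: "Re (p t) = \<beta>" "Im (p t) = t" for t by (auto simp: p_def)
    have cp: "continuous_on A p" for A unfolding p_def by (intro continuous_intros)
    have cont: "continuous_on {T0..T} (\<lambda>t. (norm (f (p t)))\<^sup>2)" if "f holomorphic_on - {1}" for f
    proof -
      have "p t \<noteq> 1" if "t \<in> {T0..T}" for t
      proof
        assume "p t = 1"
        hence "Im (p t) = Im 1" by (rule arg_cong)
        thus False using T that by (simp add: rp)
      qed
      hence "continuous_on {T0..T} (\<lambda>t. f (p t))"
        by (intro continuous_on_compose2[OF holomorphic_on_imp_continuous_on[OF that] cp]) auto
      thus ?thesis by (intro continuous_intros)
    qed
    have hP: "P holomorphic_on - {1}" unfolding P_def by (intro holomorphic_intros)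
    have hG: "G holomorphic_on - {1}" unfolding G_def by (intro holomorphic_intros zeta_holomorphic)
    have inv: "((\<lambda>t. 1 / t\<^sup>2) has_integral (1 / T0 - 1 / T)) {T0..T}"
    proof -
      have "((\<lambda>t. 1 / t\<^sup>2) has_integral (- (1 / T) - - (1 / T0))) {T0..T}"
        using T by (intro fundamental_theorem_of_calculus)
          (auto intro!: derivative_eq_intros simp: power2_eq_square simp flip:
            has_real_derivative_iff_has_vector_derivative)
      thus ?thesis by simp
    qed
    have pt: "(norm (G (p t)))\<^sup>2 \<le> 2 * (norm (P (p t)))\<^sup>2 + 2 * E * (1 / t\<^sup>2)" if t: "t \<in> {T0..T}" for t
    proof -
      have t1: "t \<ge> 1" using t T by auto
      have z: "zeta (p t) = ztail Y (p t) + (\<Sum>n<Y. of_nat (Suc n) powr (- p t))" by (simp add: ztail_def)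
      have G: "G (p t) = P (p t) + mollifier X (p t) * ztail Y (p t)"
        unfolding G_def P_def z by (simp add: algebra_simps)
      have "t ^ Suc (Suc m) \<le> T ^ Suc (Suc m)" using t T by (intro power_mono) auto
      hence "norm (ztail Y (p t)) \<le> D * real (Suc Y) powr (1 - \<beta>) / t"
        using D(2)[of "p t" Y] TY \<beta> \<eta> t1 by (simp add: rp del: power_Suc)
      also have "\<dots> \<le> D * real (Suc Y) powr (1 / 2 - \<eta>) / t"
        using D(1) t1 \<beta> by (intro divide_right_mono mult_left_mono powr_mono) auto
      finally have "norm (mollifier X (p t) * ztail Y (p t))
        \<le> real X * (D * real (Suc Y) powr (1 / 2 - \<eta>) / t)"
        unfolding norm_mult using \<beta> \<eta> by (intro mult_mono norm_mollifier_le) (auto simp: rp)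
      hence "(norm (mollifier X (p t) * ztail Y (p t)))\<^sup>2
        \<le> (real X * (D * real (Suc Y) powr (1 / 2 - \<eta>) / t))\<^sup>2"
        by (rule power_mono) simp
      also have "\<dots> = real X ^ 2 * D\<^sup>2 * (real (Suc Y) powr (1 / 2 - \<eta>))\<^sup>2 * (1 / t\<^sup>2)"
        by (simp add: power_mult_distrib power_divide)
      also have "(real (Suc Y) powr (1 / 2 - \<eta>))\<^sup>2 = real (Suc Y) powr (1 - 2 * \<eta>)"
        by (simp add: power2_eq_square powr_add[symmetric])
      finally have 2: "(norm (mollifier X (p t) * ztail Y (p t)))\<^sup>2 \<le> E * (1 / t\<^sup>2)" by (simp add: E_def)
      have "(norm (G (p t)))\<^sup>2 \<le> (norm (P (p t)) + norm (mollifier X (p t) * ztail Y (p t)))\<^sup>2"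
        unfolding G by (intro power_mono norm_triangle_ineq) auto
      also have "\<dots> \<le> 2 * (norm (P (p t)))\<^sup>2 + 2 * (norm (mollifier X (p t) * ztail Y (p t)))\<^sup>2"
        using sum_squares_bound[of "norm (P (p t))" "norm (mollifier X (p t) * ztail Y (p t))"]
        by (simp add: power2_sum)
      finally show ?thesis using 2 by linarith
    qed
    have i1: "(\<lambda>t. (norm (P (p t)))\<^sup>2) integrable_on {T0..T}" "(\<lambda>t. (norm (G (p t)))\<^sup>2) integrable_on {T0..T}"
      using cont[OF hP] cont[OF hG] by (auto intro: integrable_continuous_real)
    have hi: "((\<lambda>t. 2 * (norm (P (p t)))\<^sup>2 + 2 * E * (1 / t\<^sup>2)) has_integral
       2 * integral {T0..T} (\<lambda>t. (norm (P (p t)))\<^sup>2) + 2 * E * (1 / T0 - 1 / T)) {T0..T}"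
      by (intro has_integral_add has_integral_mult_right inv integrable_integral i1)
    have "integral {T0..T} (\<lambda>t. (norm (G (p t)))\<^sup>2)
      \<le> 2 * integral {T0..T} (\<lambda>t. (norm (P (p t)))\<^sup>2) + 2 * E * (1 / T0 - 1 / T)"
      by (rule has_integral_le[OF integrable_integral[OF i1(2)] hi pt])
    also have "integral {T0..T} (\<lambda>t. (norm (P (p t)))\<^sup>2)
      \<le> S * (T * real X powr (- \<eta>) + 6 * (1 + ln (real (X * Y))) * real (X * Y) powr (1 - \<eta>))"
      unfolding P_def p_def using XY \<beta> T by (intro S(2)) auto
    also have "2 * E * (1 / T0 - 1 / T) \<le> 2 * E * 1"
    proof (intro mult_left_mono)
      have "1 / T0 \<le> 1" "1 / T \<ge> 0" using T by auto
      thus "1 / T0 - 1 / T \<le> 1" by linarith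
    qed (use E0 in auto)
    finally have le: "integral {T0..T} (\<lambda>t. (norm (G (p t)))\<^sup>2) \<le> 2 * (S * (T * real X powr (- \<eta>)
       + 6 * (1 + ln (real (X * Y))) * real (X * Y) powr (1 - \<eta>))) + 2 * E" by simp
    define U1 where "U1 = T * real X powr (- \<eta>)"
    define U2 where "U2 = (1 + ln (real (X * Y))) * real (X * Y) powr (1 - \<eta>)"
    define U3 where "U3 = real X ^ 2 * real (Suc Y) powr (1 - 2 * \<eta>)"
    have "real (X * Y) \<ge> 1" using XY by (simp add: mult_ge1_I)
    hence U: "U1 \<ge> 0" "U2 \<ge> 0" "U3 \<ge> 0" using T by (auto simp: U1_def U2_def U3_def)
    have "2 * (S * (U1 + 6 * U2)) + 2 * (D\<^sup>2 * U3) \<le> C * (U1 + U2 + U3)"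
    proof -
      have "0 \<le> 10 * S * U1 + 2 * D\<^sup>2 * (U1 + U2) + 12 * S * U3"
        using S D U by (intro add_nonneg_nonneg mult_nonneg_nonneg) auto
      thus ?thesis by (simp add: C_def algebra_simps)
    qed
    moreover have "integral {T0..T} (\<lambda>t. (norm (G (p t)))\<^sup>2) \<le> 2 * (S * (U1 + 6 * U2)) + 2 * (D\<^sup>2 * U3)"
      using le by (simp only: U1_def U2_def U3_def E_def mult_ac)
    ultimately show ?thesis unfolding G_def p_def U1_def U2_def U3_def by linarith
  qed
  ultimately show ?thesis by blast
qed

section \<open>Counting discs that contain a zero\<close>

text \<open>Cauchy's formula for \<open>f^2\<close>, with distance at least \<open>R2 - R1\<close>
  between \<open>z\<close> and the circle. The circle is parametrised by \<open>{0..1}\<close> so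
  that this mean can later be exchanged with an integral over the centre.\<close>

lemma norm_sq_le_circle_mean:
  assumes f: "f holomorphic_on S" "open S" "cball c R2 \<subseteq> S"
    and R: "0 \<le> R1" "R1 < R2" and z: "norm (z - c) \<le> R1"
  shows "(norm (f z))\<^sup>2 \<le> R2 / (R2 - R1) *
    integral {0..1} (\<lambda>x. (norm (f (c + of_real R2 * exp (2 * of_real pi * \<i> * of_real x))))\<^sup>2)"
proof -
  define e where "e = (\<lambda>x. c + of_real R2 * exp (2 * of_real pi * \<i> * of_real x))"
  define K where "K = 2 * pi * (R2 / (R2 - R1))"
  have hf: "(\<lambda>w. (f w)\<^sup>2) holomorphic_on cball c R2"
    by (intro holomorphic_intros holomorphic_on_subset[OF f(1,3)])
  have ne: "norm (e x - c) = R2" for x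
  proof -
    have "2 * of_real pi * \<i> * of_real x = \<i> * of_real (2 * pi * x)" by simp
    hence "norm (exp (2 * of_real pi * \<i> * of_real x)) = 1" by (simp only: norm_exp_i_times)
    thus ?thesis using R by (simp add: e_def norm_mult)
  qed
  have "((\<lambda>u. (f u)\<^sup>2 / (u - z)) has_contour_integral (2 * of_real pi * \<i> * (f z)\<^sup>2)) (circlepath c R2)"
    using z R by (intro Cauchy_integral_circlepath holomorphic_on_imp_continuous_on hf
        holomorphic_on_subset[OF hf ball_subset_cball]) (auto simp: dist_norm norm_minus_commute)
  hence "((\<lambda>x. (f (circlepath c R2 x))\<^sup>2 / (circlepath c R2 x - z)
    * vector_derivative (circlepath c R2) (at x within {0..1}))
      has_integral (2 * of_real pi * \<i> * (f z)\<^sup>2)) {0..1}"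
    unfolding has_contour_integral_def .
  hence hi: "((\<lambda>x. (f (e x))\<^sup>2 / (e x - z) * (2 * of_real pi * \<i> * of_real R2 * exp (2 * of_real pi * \<i>
    * of_real x)))
      has_integral (2 * of_real pi * \<i> * (f z)\<^sup>2)) {0..1}"
  proof (rule has_integral_eq[rotated])
    fix x :: real assume "x \<in> {0..1}"
    hence "vector_derivative (circlepath c R2) (at x within {0..1})
        = 2 * of_real pi * \<i> * of_real R2 * exp (2 * of_real pi * \<i> * of_real x)"
      using vector_derivative_circlepath01[of x c R2] by simp
    moreover have "circlepath c R2 x = e x" by (simp add: circlepath e_def)
    ultimately show "(f (circlepath c R2 x))\<^sup>2 / (circlepath c R2 x - z)
      * vector_derivative (circlepath c R2) (at x within {0..1})
        = (f (e x))\<^sup>2 / (e x - z) * (2 * of_real pi * \<i> * of_real R2 * exp (2 * of_real pi * \<i>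
          * of_real x))" by simp
  qed
  have cont: "continuous_on {0..1} (\<lambda>x. (norm (f (e x)))\<^sup>2)"
  proof -
    have "e x \<in> S" for x using f(3) ne[of x] by (auto simp: dist_norm norm_minus_commute subset_iff)
    moreover have "continuous_on {0..1} e" unfolding e_def by (intro continuous_intros)
    ultimately have "continuous_on {0..1} (\<lambda>x. f (e x))"
      by (intro continuous_on_compose2[OF holomorphic_on_imp_continuous_on[OF f(1)]]) auto
    thus ?thesis by (intro continuous_intros)
  qed
  have ii: "(\<lambda>x. (norm (f (e x)))\<^sup>2) integrable_on {0..1}" by (rule integrable_continuous_real[OF cont])
  have "norm (integral {0..1} (\<lambda>x. (f (e x))\<^sup>2 / (e x - z) * (2 * of_real pi * \<i> * of_real R2 * exp (2
    * of_real pi * \<i> * of_real x))))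
     \<le> integral {0..1} (\<lambda>x. K * (norm (f (e x)))\<^sup>2)"
  proof (rule integral_norm_bound_integral)
    fix x :: real assume "x \<in> {0..1}"
    have "R2 - R1 \<le> norm (e x - z)"
      using norm_triangle_ineq2[of "e x - c" "z - c"] ne[of x] z by simp
    hence "(norm (f (e x)))\<^sup>2 / norm (e x - z) \<le> (norm (f (e x)))\<^sup>2 / (R2 - R1)"
      using R by (intro divide_left_mono mult_pos_pos) auto
    moreover have "norm (2 * of_real pi * \<i> * of_real R2 * exp (2 * of_real pi * \<i> * of_real x))
      = 2 * pi * R2"
    proof -
      have "norm (of_real R2 * exp (2 * of_real pi * \<i> * of_real x)) = R2" using ne[of x] by (simp add: e_def)
      thus ?thesis by (simp add: norm_mult)
    qed
    ultimately have "norm ((f (e x))\<^sup>2 / (e x - z) * (2 * of_real pi * \<i> * of_real R2 * exp (2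
      * of_real pi * \<i> * of_real x)))
      \<le> (norm (f (e x)))\<^sup>2 / (R2 - R1) * (2 * pi * R2)"
      unfolding norm_mult[of "(f (e x))\<^sup>2 / (e x - z)"] norm_divide norm_power
      using R by (intro mult_mono) auto
    thus "norm ((f (e x))\<^sup>2 / (e x - z) * (2 * of_real pi * \<i> * of_real R2 * exp (2 * of_real pi * \<i>
      * of_real x)))
      \<le> K * (norm (f (e x)))\<^sup>2" by (simp add: K_def mult_ac)
  qed (use hi ii in \<open>auto intro: has_integral_integrable integrable_on_mult_right\<close>)
  also have "integral {0..1} (\<lambda>x. K * (norm (f (e x)))\<^sup>2) = K * integral {0..1} (\<lambda>x. (norm (f (e x)))\<^sup>2)"
    by simp
  finally have "2 * pi * (norm (f z))\<^sup>2 \<le> K * integral {0..1} (\<lambda>x. (norm (f (e x)))\<^sup>2)"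
    unfolding integral_unique[OF hi] by (simp add: norm_mult norm_power)
  also have "\<dots> = 2 * pi * (R2 / (R2 - R1) * integral {0..1} (\<lambda>x. (norm (f (e x)))\<^sup>2))" by (simp add: K_def)
  finally show ?thesis unfolding e_def by (rule mult_left_le_imp_le) simp
qed

lemma integral_sum_steps:
  fixes J :: "real \<Rightarrow> real"
  assumes "continuous_on UNIV J" "m \<le> n" "\<alpha> > 0"
  shows "(\<Sum>h=m..<n. integral {\<alpha> * real h..\<alpha> * real (Suc h)} J) = integral {\<alpha> * real m..\<alpha> * real n} J"
  using assms(2)
proof (induction n rule: dec_induct)
  case (step n)
  have "J integrable_on {a..b}" for a b
    by (rule integrable_continuous_real[OF continuous_on_subset[OF assms(1)]]) simp
  hence "integral {\<alpha> * real m..\<alpha> * real n} J + integral {\<alpha> * real n..\<alpha> * real (Suc n)} J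
     = integral {\<alpha> * real m..\<alpha> * real (Suc n)} J"
    using step assms(3) by (intro Henstock_Kurzweil_Integration.integral_combine) auto
  thus ?case using step by simp
qed simp

text \<open>At a zero the function \<open>zeta * mollifier - 1\<close> has the value -1, so its mean
  square over a surrounding circle cannot be small. The radii differ by \<open>\<eta>\<close>: a
  zero within \<open>3 / 2 - 3 * \<eta>\<close> of the given centre is within
  \<open>3 / 2 - 2 * \<eta>\<close> of every centre moved up by at most \<open>\<eta>\<close>, and
  the circle of radius \<open>3 / 2 - \<eta>\<close> stays in
  \<open>Re s \<ge> 1 / 2 + \<eta>\<close>. The lower bound is integrated over centres in an
  interval of length \<open>min \<alpha> \<eta>\<close>, and these intervals do not overlap for
  different \<open>h\<close> because they are no longer than \<open>\<alpha>\<close>.\<close>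

lemma card_discs_with_zero_le:
  fixes \<alpha> :: real
  assumes \<eta>: "0 < \<eta>" "\<eta> < 1 / 4" and \<alpha>: "\<alpha> > 0"
    and D: "\<And>\<beta> \<tau>0 \<tau>1. 1 / 2 + \<eta> \<le> \<beta> \<Longrightarrow> \<beta> \<le> 4 \<Longrightarrow> 1 \<le> \<tau>0 \<Longrightarrow> \<tau>0 \<le> \<tau>1 \<Longrightarrow> \<tau>1 \<le> \<alpha> * real H1 + 2 \<Longrightarrow>
      integral {\<tau>0..\<tau>1} (\<lambda>t. (norm (zeta (of_real \<beta> + \<i> * of_real t) * mollifier X (of_real \<beta> + \<i>
        * of_real t) - 1))\<^sup>2) \<le> D"
    and H: "H0 \<le> H1" "\<alpha> * real H0 \<ge> 3"
  shows "real (card {h\<in>{H0..<H1}. \<exists>z\<in>ball (2 + \<i> * of_real (\<alpha> * real h)) (3 / 2 - 3 * \<eta>). zeta z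
    = 0}) * min \<alpha> \<eta>
    \<le> (3 / 2 - \<eta>) / \<eta> * D"
proof -
  define G where "G = (\<lambda>s. zeta s * mollifier X s - 1)"
  define R2 where "R2 = 3 / 2 - \<eta>"
  define R1 where "R1 = 3 / 2 - 2 * \<eta>"
  define \<kappa> where "\<kappa> = R2 / (R2 - R1)"
  define u0 where "u0 = min \<alpha> \<eta>"
  have R: "0 \<le> R1" "R1 < R2" "R2 \<ge> 0" "R2 \<le> 3 / 2" using \<eta> by (auto simp: R1_def R2_def)
  have \<kappa>: "\<kappa> = (3 / 2 - \<eta>) / \<eta>" "\<kappa> \<ge> 0" using \<eta> by (auto simp: \<kappa>_def R1_def R2_def)
  have u0: "0 < u0" "u0 \<le> \<alpha>" "u0 \<le> \<eta>" using \<eta> \<alpha> by (auto simp: u0_def)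
  define e where "e = (\<lambda>x::real. of_real R2 * exp (2 * of_real pi * \<i> * of_real x))"
  have ne: "norm (e x) = R2" for x
  proof -
    have "2 * of_real pi * \<i> * of_real x = \<i> * of_real (2 * pi * x)" by simp
    hence "norm (exp (2 * of_real pi * \<i> * of_real x)) = 1" by (simp only: norm_exp_i_times)
    thus ?thesis using R by (simp add: e_def norm_mult)
  qed
  have bnd: "\<bar>Re (e x)\<bar> \<le> R2" "\<bar>Im (e x)\<bar> \<le> R2" for x
    using abs_Re_le_cmod[of "e x"] abs_Im_le_cmod[of "e x"] ne by auto
  define V where "V = {s. Im s > 0}"
  have hG: "G holomorphic_on V"
    unfolding G_def V_def by (intro holomorphic_intros holomorphic_on_subset[OF zeta_holomorphic]) auto
  have V: "open V" unfolding V_def by (rule open_halfspace_Im_gt)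
  \<comment> \<open>The maximum keeps the circle above the real axis, since its radius is at most 3
    / 2. Thus \<open>g\<close> is continuous everywhere; it is used for \<open>t \<ge> 3\<close>,
    where the maximum is \<open>t\<close>.\<close>
  define g where "g = (\<lambda>t x. (norm (G (2 + \<i> * of_real (max 2 t) + e x)))\<^sup>2)"
  have cg: "continuous_on UNIV (\<lambda>(t, x). g t x)"
  proof -
    have "continuous_on UNIV (\<lambda>p. G (2 + \<i> * of_real (max 2 (fst p)) + e (snd p)))"
    proof (rule continuous_on_compose2[OF holomorphic_on_imp_continuous_on[OF hG]])
      show "continuous_on UNIV (\<lambda>p. 2 + \<i> * of_real (max 2 (fst p)) + e (snd p))"
        unfolding e_def by (intro continuous_intros)
      show "(\<lambda>p. 2 + \<i> * of_real (max 2 (fst p)) + e (snd p)) ` UNIV \<subseteq> V"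
      proof safe
        fix t x :: real
        have "Im (e x) \<ge> - (3 / 2)" using bnd(2)[of x] R by linarith
        thus "2 + \<i> * of_real (max 2 (fst (t, x))) + e (snd (t, x)) \<in> V" by (auto simp: V_def)
      qed
    qed
    hence "continuous_on UNIV (\<lambda>p. (norm (G (2 + \<i> * of_real (max 2 (fst p)) + e (snd p))))\<^sup>2)"
      by (intro continuous_intros)
    thus ?thesis by (simp add: g_def case_prod_unfold)
  qed
  have cgt: "continuous_on A (g t)" for A t
    using continuous_on_compose2[OF cg continuous_on_Pair[OF continuous_on_const[of A t]
      continuous_on_id]] by simp
  have cgx: "continuous_on A (\<lambda>t. g t x)" for A x
    using continuous_on_compose2[OF cg continuous_on_Pair[OF continuous_on_id continuous_on_const[of A
      x]]] by simp
  define J where "J = (\<lambda>t. integral {0..1} (g t))"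
  have cJ: "continuous_on UNIV J"
    using integral_continuous_on_param[of UNIV 0 1 g] continuous_on_subset[OF cg] by (simp add: J_def)
  have J0: "J t \<ge> 0" for t
    unfolding J_def by (intro integral_nonneg integrable_continuous_real cgt) (simp add: g_def)
  have iJ: "J integrable_on {a..b}" for a b
    by (rule integrable_continuous_real[OF continuous_on_subset[OF cJ]]) simp
  define Bad where "Bad = {h\<in>{H0..<H1}. \<exists>z\<in>ball (2 + \<i> * of_real (\<alpha> * real h)) (3 / 2 - 3 * \<eta>). zeta z = 0}"
  have step: "u0 \<le> \<kappa> * integral {\<alpha> * real h..\<alpha> * real (Suc h)} J" if h: "h \<in> Bad" for h
  proof -
    from h obtain z where z: "z \<in> ball (2 + \<i> * of_real (\<alpha> * real h)) (3 / 2 - 3 * \<eta>)" "zeta z = 0"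
      by (auto simp: Bad_def)
    have "\<alpha> * real H0 \<le> \<alpha> * real h" using h \<alpha> by (intro mult_left_mono) (auto simp: Bad_def)
    hence ah: "\<alpha> * real h \<ge> 3" using H by linarith
    have one: "1 \<le> \<kappa> * J t" if t: "t \<in> {\<alpha> * real h..\<alpha> * real h + u0}" for t
    proof -
      define c where "c = 2 + \<i> * of_real t"
      have t3: "t \<ge> 3" using t ah by auto
      have "norm (z - c) \<le> norm (z - (2 + \<i> * of_real (\<alpha> * real h))) + norm (\<i> * of_real (\<alpha> * real h - t))"
        unfolding c_def by (rule order.trans[OF _ norm_triangle_ineq]) (simp add: algebra_simps)
      also have "norm (z - (2 + \<i> * of_real (\<alpha> * real h))) \<le> 3 / 2 - 3 * \<eta>"
        using z by (simp add: dist_norm norm_minus_commute)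
      also have "norm (\<i> * of_real (\<alpha> * real h - t)) = \<bar>\<alpha> * real h - t\<bar>"
        unfolding norm_mult norm_of_real by simp
      also have "\<bar>\<alpha> * real h - t\<bar> \<le> \<eta>" using t u0 by auto
      finally have zc: "norm (z - c) \<le> R1" by (simp add: R1_def)
      have cb: "cball c R2 \<subseteq> V"
      proof
        fix w assume "w \<in> cball c R2"
        hence "\<bar>Im (c - w)\<bar> \<le> R2" using abs_Im_le_cmod[of "c - w"] by (auto simp: dist_norm)
        thus "w \<in> V" using t3 R by (auto simp: V_def c_def)
      qed
      have "(norm (G z))\<^sup>2 \<le> \<kappa> * integral {0..1} (\<lambda>x. (norm (G (c + of_real R2 * exp (2 * of_real pi * \<i>
        * of_real x))))\<^sup>2)"
        unfolding \<kappa>_def by (rule norm_sq_le_circle_mean[OF hG V cb R(1,2) zc])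
      also have "(\<lambda>x. (norm (G (c + of_real R2 * exp (2 * of_real pi * \<i> * of_real x))))\<^sup>2) = g t"
        using t3 by (simp add: g_def c_def e_def max_def)
      finally show ?thesis using z(2) by (simp add: G_def J_def)
    qed
    have "u0 = integral {\<alpha> * real h..\<alpha> * real h + u0} (\<lambda>t. 1)" using u0 by simp
    also have "\<dots> \<le> integral {\<alpha> * real h..\<alpha> * real h + u0} (\<lambda>t. \<kappa> * J t)"
      by (rule integral_le) (use one iJ in \<open>auto intro: integrable_on_mult_right\<close>)
    also have "\<dots> = \<kappa> * integral {\<alpha> * real h..\<alpha> * real h + u0} J" by simp
    also have "\<dots> \<le> \<kappa> * integral {\<alpha> * real h..\<alpha> * real (Suc h)} J"
      using u0 \<kappa> J0 by (intro mult_left_mono integral_subset_le iJ) (auto simp: algebra_simps)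
    finally show ?thesis .
  qed
  have "real (card Bad) * u0 = (\<Sum>h\<in>Bad. u0)" by simp
  also have "\<dots> \<le> (\<Sum>h\<in>Bad. \<kappa> * integral {\<alpha> * real h..\<alpha> * real (Suc h)} J)" by (rule sum_mono[OF step])
  also have "\<dots> \<le> (\<Sum>h=H0..<H1. \<kappa> * integral {\<alpha> * real h..\<alpha> * real (Suc h)} J)"
    using \<kappa> by (intro sum_mono2 mult_nonneg_nonneg integral_nonneg iJ J0) (auto simp: Bad_def)
  also have "\<dots> = \<kappa> * integral {\<alpha> * real H0..\<alpha> * real H1} J"
    using integral_sum_steps[OF cJ H(1) \<alpha>] by (simp add: sum_distrib_left[symmetric])
  \<comment> \<open>After the exchange each point of the circle contributes an integral along a
    vertical line, to which the hypothesis \<open>D\<close> applies.\<close>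
  also have "integral {\<alpha> * real H0..\<alpha> * real H1} J
      = integral {0..1} (\<lambda>x. integral {\<alpha> * real H0..\<alpha> * real H1} (\<lambda>t. g t x))"
    unfolding J_def using integral_swap_continuous[of "\<alpha> * real H0" 0 "\<alpha>
      * real H1" 1 g] continuous_on_subset[OF cg] by simp
  also have "\<dots> \<le> integral {0..1} (\<lambda>x::real. D)"
  proof (rule integral_le)
    have "continuous_on {0..1} (\<lambda>x. integral {\<alpha> * real H0..\<alpha> * real H1} (\<lambda>t. g t x))"
    proof -
      have "continuous_on ({0..1} \<times> cbox (\<alpha> * real H0) (\<alpha> * real H1)) (\<lambda>(x, t). g t x)"
        using continuous_on_compose2[OF cg continuous_on_swap, of "{0..1} \<times> cbox (\<alpha> * real H0) (\<alpha> * real H1)"]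
        by (simp add: case_prod_unfold prod.swap_def)
      from integral_continuous_on_param[OF this] show ?thesis by simp
    qed
    thus "(\<lambda>x. integral {\<alpha> * real H0..\<alpha> * real H1} (\<lambda>t. g t x)) integrable_on {0..1}"
      by (rule integrable_continuous_real)
    fix x :: real
    define \<beta> where "\<beta> = 2 + Re (e x)"
    define k where "k = Im (e x)"
    define F where "F = (\<lambda>t. (norm (zeta (of_real \<beta> + \<i> * of_real t) * mollifier X (of_real \<beta> + \<i>
      * of_real t) - 1))\<^sup>2)"
    have k: "\<bar>k\<bar> \<le> 3 / 2" "1 / 2 + \<eta> \<le> \<beta>" "\<beta> \<le> 4" using bnd[of x] R \<eta> by (auto simp: k_def \<beta>_def R2_def)
    have le: "\<alpha> * real H0 \<le> \<alpha> * real H1" using H \<alpha> by simp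
    have eq: "g t x = F (t + k)" if "t \<ge> 2" for t
    proof -
      have "2 + \<i> * of_real (max 2 t) + e x = of_real \<beta> + \<i> * of_real (t + k)"
        using that by (simp add: complex_eq_iff \<beta>_def k_def max_def)
      thus ?thesis by (simp add: g_def F_def G_def)
    qed
    have "integral {\<alpha> * real H0..\<alpha> * real H1} (\<lambda>t. g t x)
      = integral {\<alpha> * real H0..\<alpha> * real H1} (\<lambda>t. F (t + k))"
      using H by (intro integral_cong eq) auto
    also have "\<dots> = integral {\<alpha> * real H0 + k..\<alpha> * real H1 + k} F"
    proof -
      have "continuous_on {\<alpha> * real H0..\<alpha> * real H1} (\<lambda>t. g t x)" by (rule cgx)
      hence c0: "continuous_on {\<alpha> * real H0..\<alpha> * real H1} (\<lambda>t. F (t + k))"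
        by (rule continuous_on_eq) (use eq H in auto)
      have "continuous_on {\<alpha> * real H0 + k..\<alpha> * real H1 + k} (\<lambda>t. F (t - k + k))"
        by (rule continuous_on_compose2[OF c0, of _ "\<lambda>t. t - k"]) (auto intro!: continuous_intros)
      hence "continuous_on {\<alpha> * real H0 + k..\<alpha> * real H1 + k} F" by simp
      from integral_shift[OF this] show ?thesis by (simp add: o_def)
    qed
    \<comment> \<open>The vertical shift \<open>k\<close> is at most 3 / 2 in modulus: with
      \<open>\<alpha> * H0 \<ge> 3\<close> the lower end stays above 1, and the upper end exceeds
      \<open>\<alpha> * H1\<close> by less than 2.\<close>
    also have "\<dots> \<le> D" unfolding F_def using k H le by (intro D) auto
    finally show "integral {\<alpha> * real H0..\<alpha> * real H1} (\<lambda>t. g t x) \<le> D" .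
  qed auto
  also have "integral {0..1} (\<lambda>x::real. D) = D" by simp
  finally have "real (card Bad) * u0 \<le> \<kappa> * D" using \<kappa>(2) by (simp add: mult_left_mono)
  thus ?thesis unfolding Bad_def u0_def \<kappa>(1) .
qed

section \<open>The logarithmic derivative as a Dirichlet series\<close>

text \<open>The index may start at 0, because \<open>0 powr z = 0\<close> makes the term
  \<open>n = 0\<close> vanish whatever \<open>c 0\<close> is.\<close>

definition dseries :: "(nat \<Rightarrow> real) \<Rightarrow> complex \<Rightarrow> complex" where
  "dseries c s = (\<Sum>n. of_real (c n) * of_nat n powr (- s))"

text \<open>Absolute convergence in the whole open half-plane \<open>Re s > 1\<close>. In contrast
  to convergence at one abscissa this survives multiplication of the coefficients by
  \<open>ln n\<close>, and hence differentiation.\<close>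

definition dconv :: "(nat \<Rightarrow> real) \<Rightarrow> bool" where
  "dconv c \<longleftrightarrow> (\<forall>a>1. summable (\<lambda>n. \<bar>c n\<bar> * real n powr (- a)))"

lemma norm_dseries_term: "norm (of_real (c n) * of_nat n powr (- s) :: complex)
  = \<bar>c n\<bar> * real n powr (- Re s)"
  by (simp add: norm_mult norm_powr_real_powr)

lemma dseries_summable:
  assumes "dconv c" "Re s > 1"
  shows "summable (\<lambda>n. norm (of_real (c n) * of_nat n powr (- s) :: complex))"
  using assms unfolding norm_dseries_term dconv_def by blast

lemma dconv_ln_mult:
  assumes "dconv c"
  shows "dconv (\<lambda>n. - ln (real n) * c n)"
  unfolding dconv_def
proof (intro allI impI)
  fix a :: real assume a: "a > 1"
  define d where "d = (a - 1) / 2"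
  have d: "d > 0" "a - d > 1" using a by (auto simp: d_def field_simps)
  have "summable (\<lambda>n. 1 / d * (\<bar>c n\<bar> * real n powr (- (a - d))))"
    using assms d unfolding dconv_def by (intro summable_mult) blast
  moreover have "norm (\<bar>- ln (real n) * c n\<bar> * real n powr (- a))
    \<le> 1 / d * (\<bar>c n\<bar> * real n powr (- (a - d)))" for n
  proof (cases "n = 0")
    case False
    have "\<bar>ln (real n)\<bar> \<le> real n powr d / d" using False d ln_powr_bound[of "real n" d] by simp
    hence "\<bar>ln (real n)\<bar> * (\<bar>c n\<bar> * real n powr (- a)) \<le> real n powr d / d * (\<bar>c n\<bar> * real n powr (- a))"
      by (intro mult_right_mono) auto
    also have "\<dots> = 1 / d * (\<bar>c n\<bar> * (real n powr d * real n powr (- a)))" by simp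
    also have "real n powr d * real n powr (- a) = real n powr (- (a - d))" by (simp add: powr_add[symmetric])
    finally show ?thesis by (simp add: abs_mult mult_ac)
  qed simp
  ultimately show "summable (\<lambda>n. \<bar>- ln (real n) * c n\<bar> * real n powr (- a))"
    by (rule summable_comparison_test'[where N = 0])
qed

lemma dconv_ln_power:
  assumes "dconv c"
  shows "dconv (\<lambda>n. (- ln (real n)) ^ k * c n)"
proof (induction k)
  case (Suc k)
  from dconv_ln_mult[OF this] show ?case by (simp add: mult.assoc)
qed (use assms in simp)

text \<open>Termwise differentiation, justified by the Weierstrass test on a half-plane
  \<open>Re z > b\<close> with \<open>1 < b < Re s\<close>.\<close>

lemma dseries_has_field_derivative:
  assumes c: "dconv c" and s: "Re s > 1"
  shows "(dseries c has_field_derivative dseries (\<lambda>n. - ln (real n) * c n) s) (at s)"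
proof -
  define b where "b = (1 + Re s) / 2"
  have b: "b > 1" "b < Re s" using s by (auto simp: b_def)
  define S where "S = {z. Re z > b}"
  have S: "convex S" "open S" "s \<in> S"
    using b by (auto simp: S_def convex_halfspace_Re_gt open_halfspace_Re_gt)
  show ?thesis unfolding dseries_def
  proof (rule has_field_derivative_series'(2)[of S _ _ s])
    fix n z assume "z \<in> S"
    show "((\<lambda>z. of_real (c n) * of_nat n powr (- z)) has_field_derivative
       of_real (- ln (real n) * c n) * of_nat n powr (- z)) (at z within S)"
    proof (cases "n = 0")
      case False
      hence e: "of_nat n powr (- z) = exp (- z * of_real (ln (real n)))" for z :: complex
        by (simp add: powr_def Ln_of_nat)
      show ?thesis unfolding e by (auto intro!: derivative_eq_intros)
    qed simp
  next
    show "uniformly_convergent_on S (\<lambda>n x. \<Sum>i<n. of_real (- ln (real i) * c i) * of_nat i powr (- x))"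
    proof (rule Weierstrass_m_test')
      show "summable (\<lambda>n. \<bar>- ln (real n) * c n\<bar> * real n powr (- b))"
        using dconv_ln_mult[OF c] b unfolding dconv_def by blast
      show "norm (of_real (- ln (real n) * c n) * of_nat n powr (- x) :: complex)
        \<le> \<bar>- ln (real n) * c n\<bar> * real n powr (- b)" if "x \<in> S" for n x
      proof (cases "n = 0")
        case False
        thus ?thesis using that unfolding norm_dseries_term[of "\<lambda>n. - ln (real n) * c n"] S_def
          by (intro mult_left_mono powr_mono) auto
      qed simp
    qed
    show "summable (\<lambda>n. of_real (c n) * of_nat n powr (- s) :: complex)"
      by (rule summable_norm_cancel[OF dseries_summable[OF c s]])
  qed (use S in \<open>auto simp: interior_open\<close>)
qed

lemma dseries_higher_deriv:
  assumes c: "dconv c" and s: "Re s > 1"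
  shows "(deriv ^^ k) (dseries c) s = dseries (\<lambda>n. (- ln (real n)) ^ k * c n) s"
  using s
proof (induction k arbitrary: s)
  case (Suc k)
  have "((deriv ^^ k) (dseries c) has_field_derivative
     dseries (\<lambda>n. - ln (real n) * ((- ln (real n)) ^ k * c n)) s) (at s)"
    by (rule has_field_derivative_transform_within_open[OF
        dseries_has_field_derivative[OF dconv_ln_power[OF c, of k] Suc.prems] open_halfspace_Re_gt[of 1]])
       (use Suc in auto)
  from DERIV_imp_deriv[OF this] show ?case by (simp add: mult.assoc)
qed simp

lemma dseries_holomorphic: "dconv c \<Longrightarrow> dseries c holomorphic_on {s. Re s > 1}"
  by (rule holomorphic_on_open[THEN iffD2, OF open_halfspace_Re_gt])
     (use dseries_has_field_derivative in blast)

lemma dconv_one: "dconv (\<lambda>n. 1)"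
  unfolding dconv_def by (auto simp: summable_real_powr_iff)

lemma dconv_mangoldt: "dconv mangoldt"
  unfolding dconv_def
proof (intro allI impI)
  fix a :: real assume a: "a > 1"
  show "summable (\<lambda>n. \<bar>mangoldt n\<bar> * real n powr (- a))"
  proof (rule summable_comparison_test'[of "\<lambda>n. \<bar>- ln (real n) * 1\<bar> * real n powr (- a)" 1])
    show "summable (\<lambda>n. \<bar>- ln (real n) * 1\<bar> * real n powr (- a))"
      using dconv_ln_mult[OF dconv_one] a unfolding dconv_def by blast
    show "norm (\<bar>mangoldt n\<bar> * real n powr (- a)) \<le> \<bar>- ln (real n) * 1\<bar> * real n powr (- a)" if "n \<ge> 1" for n
      using that mangoldt_le[of n] by (simp add: abs_mult mult_right_mono)
  qed
qed

lemma zeta_eq_dseries: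
  assumes "Re s > 1"
  shows "zeta s = dseries (\<lambda>n. 1) s"
proof -
  have "summable (\<lambda>n. of_real 1 * of_nat n powr (- s) :: complex)"
    by (rule summable_norm_cancel[OF dseries_summable[OF dconv_one assms]])
  from suminf_split_head[OF this] show ?thesis
    using zeta_eq_dirichlet[OF assms] by (simp add: dirichlet_def dseries_def)
qed

lemma deriv_zeta_eq_dseries:
  assumes "Re s > 1"
  shows "deriv zeta s = dseries (\<lambda>n. - ln (real n)) s"
proof -
  have "(zeta has_field_derivative dseries (\<lambda>n. - ln (real n) * 1) s) (at s)"
    by (rule has_field_derivative_transform_within_open[OF
        dseries_has_field_derivative[OF dconv_one assms] open_halfspace_Re_gt[of 1]])
       (use assms zeta_eq_dseries in auto)
  from DERIV_imp_deriv[OF this] show ?thesis by simp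
qed

lemma dseries_has_sum:
  assumes "dconv c" "Re s > 1"
  shows "((\<lambda>n. of_real (c n) * of_nat n powr (- s)) has_sum dseries c s) {0<..}"
proof -
  have "((\<lambda>n. of_real (c n) * of_nat n powr (- s)) has_sum dseries c s) UNIV"
    unfolding dseries_def
    by (rule norm_summable_imp_has_sum[OF dseries_summable[OF assms]
          summable_sums[OF summable_norm_cancel[OF dseries_summable[OF assms]]]])
  moreover have "((\<lambda>n. of_real (c n) * of_nat n powr (- s)) has_sum dseries c s) UNIV \<longleftrightarrow>
      ((\<lambda>n. of_real (c n) * of_nat n powr (- s)) has_sum dseries c s) {0<..}"
    by (rule has_sum_cong_neutral) auto
  ultimately show ?thesis by simp
qed

text \<open>The values of \<open>mangoldt\<close> at the divisors of \<open>n\<close> sum to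
  \<open>ln n\<close>. Absolute convergence allows the double series over \<open>(d, e)\<close> to
  be regrouped by the product \<open>n = d * e\<close>.\<close>

lemma mangoldt_dseries_mult_zeta:
  assumes s: "Re s > 1"
  shows "dseries mangoldt s * zeta s = - deriv zeta s"
proof -
  define P where "P = {0::nat<..}"
  define a where "a = (\<lambda>n. of_real (mangoldt n) * of_nat n powr (- s) :: complex)"
  define b where "b = (\<lambda>n. of_nat n powr (- s) :: complex)"
  have A: "(a has_sum dseries mangoldt s) P" unfolding a_def P_def
    by (rule dseries_has_sum[OF dconv_mangoldt s])
  have B: "(b has_sum zeta s) P" unfolding b_def P_def
    using dseries_has_sum[OF dconv_one s] by (simp add: zeta_eq_dseries[OF s])
  have L: "((\<lambda>n. of_real (ln (real n)) * of_nat n powr (- s)) has_sum - deriv zeta s) P"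
  proof -
    have "dconv (\<lambda>n. - ln (real n))" using dconv_ln_mult[OF dconv_one] by simp
    from has_sum_uminusI[OF dseries_has_sum[OF this s]] show ?thesis
      by (simp add: deriv_zeta_eq_dseries[OF s] P_def)
  qed
  have na: "(\<lambda>x. norm (a x)) summable_on P"
  proof (rule summable_on_subset_banach[of _ UNIV])
    have "summable (\<lambda>n. norm (norm (a n)))"
      using dseries_summable[OF dconv_mangoldt s] by (simp add: a_def)
    thus "(\<lambda>x. norm (a x)) summable_on UNIV" by (rule norm_summable_imp_summable_on)
  qed simp
  have nb: "(\<lambda>x. norm (b x)) summable_on P"
  proof (rule summable_on_subset_banach[of _ UNIV])
    have "summable (\<lambda>n. norm (norm (b n)))"
      using dseries_summable[OF dconv_one s] by (simp add: b_def)
    thus "(\<lambda>x. norm (b x)) summable_on UNIV" by (rule norm_summable_imp_summable_on)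
  qed simp
  define f where "f = (\<lambda>(d, e). a d * b e)"
  have "(\<lambda>x. norm (f x)) summable_on P \<times> P"
    unfolding Infinite_Sum.abs_summable_on_Sigma_iff
  proof (intro conjI ballI)
    show "(\<lambda>y. norm (f (x, y))) summable_on P" for x
      unfolding f_def using summable_on_cmult_right[OF nb, of "norm (a x)"] by (simp add: norm_mult)
    have "(\<lambda>x. infsum (\<lambda>y. norm (f (x, y))) P) = (\<lambda>x. norm (a x) * infsum (\<lambda>y. norm (b y)) P)"
      using nb by (simp add: f_def norm_mult infsum_cmult_right)
    thus "(\<lambda>x. norm (infsum (\<lambda>y. norm (f (x, y))) P)) summable_on P"
      using summable_on_cmult_left[OF na, of "infsum (\<lambda>y. norm (b y)) P"]
      by (simp add: infsum_nonneg abs_mult)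
  qed
  hence sf: "f summable_on P \<times> P" by (rule abs_summable_summable)
  have "(f has_sum dseries mangoldt s * zeta s) (P \<times> P)"
  proof (rule has_sum_SigmaI[OF _ _ sf])
    show "((\<lambda>y. f (x, y)) has_sum a x * zeta s) P" for x
      unfolding f_def using has_sum_cmult_right[OF B] by simp
    show "((\<lambda>x. a x * zeta s) has_sum dseries mangoldt s * zeta s) P"
      by (rule has_sum_cmult_left[OF A])
  qed
  also have "(f has_sum dseries mangoldt s * zeta s) (P \<times> P) \<longleftrightarrow>
     ((\<lambda>(n, d). a d * b (n div d)) has_sum dseries mangoldt s * zeta s) (SIGMA n:P. {d. d dvd n})"
  proof (rule has_sum_reindex_bij_witness[of _ "\<lambda>(n, d). (d, n div d)" "\<lambda>(d, e). (d * e, d)"])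
    fix x assume "x \<in> P \<times> P"
    then obtain d e where x: "x = (d, e)" "d > 0" "e > 0" by (auto simp: P_def)
    show "(case case x of (d, e) \<Rightarrow> (d * e, d) of (n, d) \<Rightarrow> (d, n div d)) = x"
      "(case x of (d, e) \<Rightarrow> (d * e, d)) \<in> (SIGMA n:P. {d. d dvd n})"
      "(case case x of (d, e) \<Rightarrow> (d * e, d) of (n, d) \<Rightarrow> a d * b (n div d)) = f x"
      using x by (simp_all add: P_def f_def)
  next
    fix y assume "y \<in> (SIGMA n:P. {d. d dvd n})"
    then obtain n d where y: "y = (n, d)" "n > 0" "d dvd n" by (auto simp: P_def)
    have "d > 0" "d \<le> n" using y by (auto intro: dvd_pos_nat dvd_imp_le)
    hence "n div d > 0" by (simp add: div_greater_zero_iff)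
    thus "(case case y of (n, d) \<Rightarrow> (d, n div d) of (d, e) \<Rightarrow> (d * e, d)) = y"
      "(case y of (n, d) \<Rightarrow> (d, n div d)) \<in> P \<times> P"
      using y \<open>d > 0\<close> by (simp_all add: P_def)
  qed simp
  finally have S: "((\<lambda>(n, d). a d * b (n div d)) has_sum dseries mangoldt s
    * zeta s) (SIGMA n:P. {d. d dvd n})" .
  have "((\<lambda>n. of_real (ln (real n)) * of_nat n powr (- s)) has_sum dseries mangoldt s * zeta s) P"
  proof (rule has_sum_SigmaD[OF S])
    fix n assume n: "n \<in> P"
    have "(\<Sum>d | d dvd n. a d * b (n div d)) = (\<Sum>d | d dvd n. of_real (mangoldt d) * of_nat n powr (- s))"
    proof (rule sum.cong)
      fix d assume "d \<in> {d. d dvd n}"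
      then obtain e where e: "n = d * e" by auto
      have "d \<noteq> 0" using n e by (auto simp: P_def)
      have "of_nat d powr (- s) * of_nat e powr (- s) = (of_nat n powr (- s) :: complex)"
        unfolding e of_nat_mult by (rule powr_times_real[symmetric]) auto
      thus "a d * b (n div d) = of_real (mangoldt d) * of_nat n powr (- s)"
        using \<open>d \<noteq> 0\<close> by (simp add: a_def b_def e mult.assoc)
    qed simp
    also have "\<dots> = of_real (\<Sum>d | d dvd n. mangoldt d) * of_nat n powr (- s)"
      by (simp add: sum_distrib_right)
    also have "(\<Sum>d | d dvd n. mangoldt d) = ln (real n)" using mangoldt_sum[of n, where 'a = real] n
      by (simp add: P_def)
    finally have "(\<Sum>d | d dvd n. a d * b (n div d)) = of_real (ln (real n)) * of_nat n powr (- s)" .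
    moreover have "finite {d. d dvd n}" using n by (simp add: P_def)
    ultimately show "((\<lambda>y. case (n, y) of (n, d) \<Rightarrow> a d * b (n div d)) has_sum of_real (ln (real n))
      * of_nat n powr (- s)) {d. d dvd n}"
      using has_sum_finite[of "{d. d dvd n}" "\<lambda>d. a d * b (n div d)"] by simp
  qed
  from has_sum_unique[OF this L] show ?thesis .
qed

section \<open>Bounds for holomorphic functions and for zeta at \<open>2 + i t\<close>\<close>

text \<open>The half-plane \<open>Re w < A\<close> is the set of points closer to 0 than to
  \<open>2 * A\<close>, so \<open>f / (2 * A - f)\<close> maps the disc into the unit disc and fixes
  0. The Schwarz lemma bounds this quotient by \<open>r / R\<close>, and solving for
  \<open>f\<close> gives the claim.\<close>

lemma borel_caratheodory:
  assumes f: "f holomorphic_on ball 0 R" "f 0 = 0" and A: "\<And>z. norm z < R \<Longrightarrow> Re (f z) < A"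
    and z: "norm z \<le> r" "r < R" and A0: "A > 0"
  shows "norm (f z) \<le> 2 * A * r / (R - r)"
proof -
  have R: "R > 0" using z norm_ge_zero[of z] by linarith
  define g where "g = (\<lambda>w. f (of_real R * w) / (2 * of_real A - f (of_real R * w)))"
  have in_ball: "norm (of_real R * w :: complex) < R" if "norm w < 1" for w
    using that R mult_strict_left_mono[of "norm w" 1 R] by (simp add: norm_mult)
  have less: "norm (f w) < norm (2 * of_real A - f w)" if "norm w < R" for w
  proof -
    have "(norm (2 * of_real A - f w))\<^sup>2 - (norm (f w))\<^sup>2 = 4 * A * (A - Re (f w))"
      unfolding cmod_power2 by (simp add: power2_eq_square algebra_simps)
    also have "\<dots> > 0" using A[OF that] A0 by simp
    finally have "(norm (f w))\<^sup>2 < (norm (2 * of_real A - f w))\<^sup>2" by simp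
    thus ?thesis by (rule power2_less_imp_less) simp
  qed
  have nz: "2 * of_real A - f w \<noteq> 0" if "norm w < R" for w
    using less[OF that] by auto
  have fR: "(\<lambda>w. f (of_real R * w)) holomorphic_on ball 0 1"
    by (rule holomorphic_on_compose_gen[OF _ f(1), unfolded o_def])
       (use in_ball in \<open>auto intro!: holomorphic_intros\<close>)
  have hol: "g holomorphic_on ball 0 1"
    unfolding g_def by (intro holomorphic_intros fR) (use nz in_ball in auto)
  have g0: "g 0 = 0" by (simp add: g_def f)
  have g1: "norm (g w) < 1" if "norm w < 1" for w
    unfolding g_def norm_divide using less[OF in_ball[OF that]]
    by (subst divide_less_eq_1_pos) (auto intro: le_less_trans[OF norm_ge_zero])
  define w where "w = z / of_real R"
  have w: "norm w < 1" "of_real R * w = z" "norm w \<le> r / R"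
    using R z by (auto simp: w_def norm_divide divide_right_mono)
  have "norm (g w) \<le> norm w" by (rule Schwarz_Lemma(1)[OF hol g0 g1 w(1)])
  hence "norm (f z) \<le> norm w * norm (2 * of_real A - f z)"
    using nz[of z] z unfolding g_def w(2) norm_divide by (simp add: divide_le_eq)
  also have "\<dots> \<le> r / R * (2 * A + norm (f z))"
  proof (rule mult_mono)
    show "norm (2 * of_real A - f z) \<le> 2 * A + norm (f z)"
      using norm_triangle_ineq4[of "2 * of_real A" "f z"] A0 by (simp add: norm_mult)
  next
    have "r \<ge> 0" using z norm_ge_zero[of z] by linarith
    thus "0 \<le> r / R" using R by simp
  qed (use w in auto)
  finally have "norm (f z) * R \<le> r * (2 * A + norm (f z))" using R by (simp add: field_simps)
  hence "norm (f z) * (R - r) \<le> 2 * A * r" by (simp add: algebra_simps)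
  thus ?thesis using z by (simp add: field_simps)
qed

text \<open>The terms of zeta after the first have total modulus at most 3 / 4: the second is 1 / 4,
  and the later ones telescope to at most 1 / 2 by comparing \<open>1 / (n + 3)^2\<close> with
  \<open>1 / (n + 2) - 1 / (n + 3)\<close>.\<close>

lemma norm_zeta_two_ge: "norm (zeta (2 + \<i> * of_real t)) \<ge> 1 / 4"
proof -
  define s where "s = 2 + \<i> * of_real t"
  have s: "Re s = 2" by (simp add: s_def)
  define f where "f = (\<lambda>n. of_nat (Suc n) powr (- s) :: complex)"
  have nf: "norm (f n) = 1 / (real (Suc n))\<^sup>2" for n
    unfolding f_def using s by (subst norm_powr_real_powr) (auto simp: powr_minus_divide powr_numeral)
  have smf: "summable f" unfolding f_def using s by (intro zeta_series_summable) simp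
  have t: "(\<lambda>n. 1 / real (n + 2) - 1 / real (Suc n + 2)) sums (1 / real (0 + 2) - 0)"
    by (rule telescope_sums') real_asymp
  have le: "norm (f (n + 2)) \<le> 1 / real (n + 2) - 1 / real (Suc n + 2)" for n
    unfolding nf by (simp add: divide_simps power2_eq_square)
  have "norm (\<Sum>n. f (n + 2)) \<le> (\<Sum>n. 1 / real (n + 2) - 1 / real (Suc n + 2))"
    by (rule norm_suminf_le[OF le sums_summable[OF t]])
  also have "\<dots> = 1 / 2" using t by (simp add: sums_iff)
  finally have tail: "norm (\<Sum>n. f (n + 2)) \<le> 1 / 2" .
  have "zeta s = suminf f" using s by (subst zeta_eq_dirichlet) (auto simp: dirichlet_def f_def)
  also have "\<dots> = (\<Sum>n. f (n + 2)) + (\<Sum>n<2. f n)" by (rule suminf_split_initial_segment[OF smf])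
  also have "(\<Sum>n<2. f n) = 1 + f 1" by (simp add: numeral_2_eq_2 f_def)
  finally have z: "zeta s = 1 + (f 1 + (\<Sum>n. f (n + 2)))" by simp
  have "norm (f 1 + (\<Sum>n. f (n + 2))) \<le> 1 / 4 + 1 / 2"
    by (rule norm_triangle_mono[OF _ tail]) (simp add: nf)
  moreover have "1 - norm (f 1 + (\<Sum>n. f (n + 2))) \<le> norm (zeta s)"
    unfolding z using norm_diff_ineq[of 1 "f 1 + (\<Sum>n. f (n + 2))"] by simp
  ultimately show ?thesis unfolding s_def by simp
qed

section \<open>The Taylor polynomial of \<open>- zeta' / zeta\<close> at
  \<open>2 + i t\<close>\<close>

text \<open>The coefficient of \<open>cos (t * ln n)\<close> in the real part, at
  \<open>\<sigma> + i t\<close>, of the Taylor polynomial of degree less than \<open>K\<close> about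
  \<open>2 + i t\<close>. The inner sum is the truncated exponential series of
  \<open>n powr (2 - \<sigma>)\<close>, so the coefficient is close to
  \<open>mangoldt n * n powr (- \<sigma>)\<close> as long as \<open>ln n\<close> is small compared
  with \<open>K\<close>.\<close>

definition taylor_coeff :: "real \<Rightarrow> nat \<Rightarrow> nat \<Rightarrow> real" where
  "taylor_coeff \<sigma> K n = mangoldt n * real n powr (- 2) * (\<Sum>k<K. ((2 - \<sigma>) * ln (real n)) ^ k / fact k)"

text \<open>The terms from index \<open>K\<close> on are at most \<open>2 powr (- K)\<close> times
  those of the series at \<open>2 * x\<close>, hence sum to at most
  \<open>exp (2 * x) / 2 ^ K\<close>. This is at most \<open>exp x / 2\<close>, because
  \<open>x \<le> (K - 1) / 2 \<le> (K - 1) * ln 2\<close>.\<close>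

lemma exp_partial_sum_ge:
  fixes x :: real
  assumes "0 \<le> x" "2 * x + 1 \<le> real K"
  shows "exp x / 2 \<le> (\<Sum>k<K. x ^ k / fact k)"
proof -
  have sm: "summable (\<lambda>k. y ^ k / fact k)" for y :: real
    using summable_exp[of y] by (simp add: divide_inverse mult.commute)
  have ex: "exp y = (\<Sum>k. y ^ k / fact k)" for y :: real
    by (simp add: exp_def divide_inverse mult.commute scaleR_conv_of_real)
  have "(\<Sum>k. x ^ (k + K) / fact (k + K)) \<le> (\<Sum>k. (1 / 2) ^ K * ((2 * x) ^ (k + K) / fact (k + K)))"
  proof (rule suminf_le)
    show "x ^ (k + K) / fact (k + K) \<le> (1 / 2) ^ K * ((2 * x) ^ (k + K) / fact (k + K))" for k
    proof -
      have "x ^ (k + K) * 1 \<le> x ^ (k + K) * 2 ^ k" using assms by (intro mult_left_mono) auto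
      also have "\<dots> = (1 / 2) ^ K * (2 * x) ^ (k + K)"
        by (simp add: power_mult_distrib power_add power_one_over field_simps)
      finally show ?thesis by (simp add: divide_right_mono)
    qed
    show "summable (\<lambda>k. x ^ (k + K) / fact (k + K))" by (rule summable_ignore_initial_segment[OF sm])
    show "summable (\<lambda>k. (1 / 2) ^ K * ((2 * x) ^ (k + K) / fact (k + K)))"
      by (intro summable_mult summable_ignore_initial_segment[OF sm, of "2 * x"])
  qed
  also have "\<dots> = (1 / 2) ^ K * (\<Sum>k. (2 * x) ^ (k + K) / fact (k + K))"
    by (rule suminf_mult[OF summable_ignore_initial_segment[OF sm]])
  also have "(\<Sum>k. (2 * x) ^ (k + K) / fact (k + K)) \<le> exp (2 * x)"
    unfolding ex suminf_minus_initial_segment[OF sm] using assms by (simp add: sum_nonneg)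
  also have "(1 / 2) ^ K * exp (2 * x) \<le> exp x / 2"
  proof -
    have "x \<le> (real K - 1) * (1 / 2)" using assms by simp
    also have "\<dots> \<le> (real K - 1) * ln 2" using assms ln2_ge_two_thirds by (intro mult_left_mono) auto
    finally have "exp x \<le> exp ((real K - 1) * ln 2)" by simp
    also have "\<dots> = 2 powr (real K - 1)" by (simp add: powr_def)
    also have "\<dots> = 2 ^ K / 2" by (simp add: powr_diff powr_realpow)
    finally have "exp x * exp x \<le> 2 ^ K / 2 * exp x" by (intro mult_right_mono) auto
    hence "exp x * exp x / 2 ^ K \<le> 2 ^ K / 2 * exp x / 2 ^ K" by (rule divide_right_mono) simp
    moreover have "(1 / 2) ^ K * exp (2 * x) = exp x * exp x / 2 ^ K"
      by (simp add: exp_double power2_eq_square power_one_over)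
    ultimately show ?thesis by simp
  qed
  finally have "(\<Sum>k. x ^ (k + K) / fact (k + K)) \<le> exp x / 2" by simp
  moreover have "exp x = (\<Sum>k. x ^ (k + K) / fact (k + K)) + (\<Sum>k<K. x ^ k / fact k)"
    unfolding ex by (rule suminf_split_initial_segment[OF sm])
  ultimately show ?thesis by simp
qed

lemma taylor_coeff_nonneg: "\<sigma> \<le> 2 \<Longrightarrow> 0 \<le> taylor_coeff \<sigma> K n"
  unfolding taylor_coeff_def by (cases "n = 0") (auto intro!: mult_nonneg_nonneg sum_nonneg mangoldt_nonneg)

text \<open>The exponent \<open>(2 - \<sigma>) * ln n\<close> is at most \<open>2 * ln n\<close>, so
  under the hypothesis on \<open>K\<close> the truncated series still has half of the value
  \<open>n powr (2 - \<sigma>)\<close>.\<close>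

lemma taylor_coeff_ge:
  assumes "\<sigma> < 2" "\<sigma> \<ge> 0" "n > 0" "4 * ln (real n) + 1 \<le> real K"
  shows "mangoldt n * real n powr (- \<sigma>) / 2 \<le> taylor_coeff \<sigma> K n"
proof -
  have l: "ln (real n) \<ge> 0" using assms by simp
  have "(2 - \<sigma>) * ln (real n) \<le> 2 * ln (real n)" using l assms by (intro mult_right_mono) auto
  hence "exp ((2 - \<sigma>) * ln (real n)) / 2 \<le> (\<Sum>k<K. ((2 - \<sigma>) * ln (real n)) ^ k / fact k)"
    using assms l by (intro exp_partial_sum_ge) auto
  hence "mangoldt n * real n powr (- 2) * (exp ((2 - \<sigma>) * ln (real n)) / 2) \<le> taylor_coeff \<sigma> K n"
    unfolding taylor_coeff_def by (intro mult_left_mono mult_nonneg_nonneg mangoldt_nonneg) auto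
  moreover have "real n powr (- 2) * exp ((2 - \<sigma>) * ln (real n)) = real n powr (- \<sigma>)"
    using assms by (simp add: powr_def exp_add[symmetric] algebra_simps)
  ultimately show ?thesis by (simp add: mult.assoc)
qed

text \<open>Writing the exponent as at most 4 times \<open>ln n / 2\<close> gives
  \<open>4 ^ k * n powr (1 / 2)\<close> for the single terms. The square root is what can be
  afforded: the weight \<open>n powr (- 2)\<close> becomes \<open>n powr (- (3 / 2))\<close>, still
  summable against \<open>mangoldt\<close>, and the sum over all \<open>n\<close> is
  \<open>O(4 ^ K)\<close>.\<close>

lemma taylor_coeff_le:
  assumes "0 \<le> \<sigma>" "\<sigma> \<le> 2"
  shows "taylor_coeff \<sigma> K n \<le> 4 ^ K * (mangoldt n * real n powr (- (3 / 2)))"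
proof (cases "n = 0")
  case False
  hence l: "ln (real n) \<ge> 0" by simp
  have "((2 - \<sigma>) * ln (real n)) ^ k / fact k \<le> 4 ^ k * real n powr (1 / 2)" for k
  proof -
    have "(2 - \<sigma>) * ln (real n) \<le> 4 * (ln (real n) / 2)"
      using l assms mult_right_mono[of "2 - \<sigma>" 2 "ln (real n)"] by simp
    hence "((2 - \<sigma>) * ln (real n)) ^ k \<le> (4 * (ln (real n) / 2)) ^ k"
      using l assms by (intro power_mono) auto
    hence "((2 - \<sigma>) * ln (real n)) ^ k / fact k \<le> 4 ^ k * ((ln (real n) / 2) ^ k / fact k)"
      unfolding power_mult_distrib by (simp add: divide_right_mono)
    also have "(ln (real n) / 2) ^ k / fact k \<le> exp (ln (real n) / 2)"
    proof -
      have "(\<Sum>j\<in>{k}. (ln (real n) / 2) ^ j /\<^sub>R fact j) \<le> exp (ln (real n) / 2)"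
        unfolding exp_def using l by (intro sum_le_suminf summable_exp_generic) auto
      thus ?thesis by (simp add: field_simps)
    qed
    also have "exp (ln (real n) / 2) = real n powr (1 / 2)" using False by (simp add: powr_def)
    finally show ?thesis by simp
  qed
  hence "(\<Sum>k<K. ((2 - \<sigma>) * ln (real n)) ^ k / fact k) \<le> (\<Sum>k<K. 4 ^ k * real n powr (1 / 2))"
    by (intro sum_mono)
  also have "\<dots> = (\<Sum>k<K. 4 ^ k) * real n powr (1 / 2)" by (simp add: sum_distrib_right)
  also have "\<dots> \<le> 4 ^ K * real n powr (1 / 2)"
  proof (rule mult_right_mono)
    show "(\<Sum>k<K. 4 ^ k) \<le> (4::real) ^ K"
    proof (induction K)
      case (Suc K)
      have "0 \<le> (4::real) ^ K" by simp
      with Suc show ?case unfolding sum.lessThan_Suc power_Suc by linarith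
    qed simp
  qed simp
  finally have "taylor_coeff \<sigma> K n \<le> mangoldt n * real n powr (- 2) * (4 ^ K * real n powr (1 / 2))"
    unfolding taylor_coeff_def by (intro mult_left_mono mult_nonneg_nonneg mangoldt_nonneg) auto
  also have "\<dots> = 4 ^ K * (mangoldt n * (real n powr (- 2) * real n powr (1 / 2)))" by simp
  also have "real n powr (- 2) * real n powr (1 / 2) = real n powr (- (3 / 2))"
    by (simp add: powr_add[symmetric])
  finally show ?thesis .
qed (simp add: taylor_coeff_def)

lemma summable_taylor_coeff:
  assumes "0 \<le> \<sigma>" "\<sigma> \<le> 2"
  shows "summable (taylor_coeff \<sigma> K)"
    "suminf (taylor_coeff \<sigma> K) \<le> 4 ^ K * (\<Sum>n. mangoldt n * real n powr (- (3 / 2)))"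
proof -
  have "summable (\<lambda>n. \<bar>mangoldt n\<bar> * real n powr (- (3 / 2)))"
    using dconv_mangoldt unfolding dconv_def by simp
  hence m: "summable (\<lambda>n. mangoldt n * real n powr (- (3 / 2)))" by simp
  show s: "summable (taylor_coeff \<sigma> K)"
    by (rule summable_comparison_test'[OF summable_mult[OF m, of "4 ^ K"], of 0])
       (use taylor_coeff_le[OF assms] taylor_coeff_nonneg[OF assms(2)] in auto)
  have "suminf (taylor_coeff \<sigma> K) \<le> (\<Sum>n. 4 ^ K * (mangoldt n * real n powr (- (3 / 2))))"
    by (intro suminf_le taylor_coeff_le[OF assms] s summable_mult m)
  also have "\<dots> = 4 ^ K * (\<Sum>n. mangoldt n * real n powr (- (3 / 2)))" by (rule suminf_mult[OF m])
  finally show "suminf (taylor_coeff \<sigma> K) \<le> 4 ^ K * (\<Sum>n. mangoldt n * real n powr (- (3 / 2)))" .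
qed

text \<open>In the zero-free disc zeta has a holomorphic logarithm \<open>g\<close>. Its real part
  exceeds the one at the centre by \<open>O(ln t)\<close>, by the growth of zeta and its lower bound
  at \<open>2 + i t\<close>; \<open>borel_caratheodory\<close> bounds \<open>g\<close>, Cauchy's
  inequality its derivative on a smaller circle, and the same inequality again the Taylor
  coefficients of \<open>F = - zeta' / zeta\<close>. The point \<open>\<sigma> + i t\<close> lies
  strictly inside that circle, so the Taylor series has a geometrically small remainder.\<close>

lemma log_deriv_taylor:
  assumes \<sigma>: "1 / 2 < \<sigma>" "\<sigma> < 1" and R: "2 - \<sigma> < R" "R \<le> 3 / 2"
  shows "\<exists>C>0. \<exists>q. 0 < q \<and> q < 1 \<and> (\<forall>t K. t \<ge> 3 \<longrightarrow>
    (\<forall>z\<in>ball (2 + \<i> * of_real t) R. zeta z \<noteq> 0) \<longrightarrow>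
    \<bar>- Re (deriv zeta (of_real \<sigma> + \<i> * of_real t) / zeta (of_real \<sigma> + \<i> * of_real t))
      - (\<Sum>n. taylor_coeff \<sigma> K n * cos (t * ln (real n)))\<bar> \<le> C * ln t * q ^ K)"
proof -
  from zeta_growth[of 4] obtain C0 where C0: "C0 > 0"
    "\<And>s. 1 / 2 \<le> Re s \<Longrightarrow> Re s \<le> 4 \<Longrightarrow> 1 \<le> Im s \<Longrightarrow> norm (zeta s) \<le> C0 * Im s" by blast
  \<comment> \<open>The radii satisfy \<open>2 - \<sigma> < r2 < r1 < R\<close>: \<open>g\<close> is
    bounded in the disc of radius \<open>r1\<close>, its derivative on the circle of radius
    \<open>r2\<close>, and the ratio \<open>q\<close> of \<open>2 - \<sigma>\<close> to
    \<open>r2\<close> governs the remainder.\<close>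
  define r2 where "r2 = (2 - \<sigma> + R) / 2"
  define r1 where "r1 = (r2 + R) / 2"
  have r: "2 - \<sigma> < r2" "r2 < r1" "r1 < R" "0 < r2" using assms by (auto simp: r1_def r2_def field_simps)
  define q where "q = (2 - \<sigma>) / r2"
  have q: "0 < q" "q < 1" using r \<sigma> by (auto simp: q_def)
  \<comment> \<open>The logarithm comes from dividing \<open>C0 * (t + 2)\<close> by the lower bound
    1 / 4 at the centre, the summand 2 from \<open>t + 2 \<le> t ^ 2\<close>. Both fit under
    \<open>C1 * ln t\<close> since \<open>t \<ge> 3\<close> implies
    \<open>ln t \<ge> 1\<close>.\<close>
  define C1 where "C1 = ln (4 * C0 + 1) + 2"
  have C1: "C1 > 0" using C0 by (auto simp: C1_def intro!: add_nonneg_pos)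
  define C2 where "C2 = 2 * r1 / (R - r1) / (r1 - r2)"
  have C2: "C2 > 0" using r by (auto simp: C2_def intro!: divide_pos_pos)
  define C where "C = C2 * C1 / (1 - q)"
  have "C > 0" using C1 C2 q by (auto simp: C_def)
  moreover have "\<bar>- Re (deriv zeta (of_real \<sigma> + \<i> * of_real t) / zeta (of_real \<sigma> + \<i> * of_real t))
      - (\<Sum>n. taylor_coeff \<sigma> K n * cos (t * ln (real n)))\<bar> \<le> C * ln t * q ^ K"
    if t: "t \<ge> 3" and nz: "\<And>z. z \<in> ball (2 + \<i> * of_real t) R \<Longrightarrow> zeta z \<noteq> 0" for t K
  proof -
    define s0 where "s0 = 2 + \<i> * of_real t"
    define w where "w = of_real \<sigma> + \<i> * of_real t"
    define B where "B = ball s0 R"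
    have inB: "1 / 2 \<le> Re z" "Re z \<le> 4" "1 \<le> Im z" "Im z \<le> t + 2" if "z \<in> B" for z
    proof -
      have "norm (z - s0) < 3 / 2" using that R by (auto simp: B_def dist_norm norm_minus_commute)
      moreover have "\<bar>Re (z - s0)\<bar> \<le> norm (z - s0)" "\<bar>Im (z - s0)\<bar> \<le> norm (z - s0)"
        by (rule abs_Re_le_cmod abs_Im_le_cmod)+
      ultimately show "1 / 2 \<le> Re z" "Re z \<le> 4" "1 \<le> Im z" "Im z \<le> t + 2"
        using t by (auto simp: s0_def)
    qed
    have "1 \<notin> B" using inB(3)[of 1] by auto
    have holz: "zeta holomorphic_on B"
      by (rule holomorphic_on_subset[OF zeta_holomorphic]) (use \<open>1 \<notin> B\<close> in auto)
    have nzB: "zeta z \<noteq> 0" if "z \<in> B" for z using nz that by (simp add: B_def s0_def)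
    have s0B: "s0 \<in> B" using r by (simp add: B_def)
    obtain g where g: "g holomorphic_on B" "\<And>z. z \<in> B \<Longrightarrow> exp (g z) = zeta z"
      by (rule holomorphic_logarithm_exists[OF _ _ holz nzB s0B]) (auto simp: B_def)
    define F where "F = (\<lambda>z. - deriv zeta z / zeta z)"
    have F: "F holomorphic_on B"
      unfolding F_def by (intro holomorphic_intros holomorphic_deriv holz nzB) (auto simp: B_def)
    have dg: "deriv g z = - F z" if "z \<in> B" for z
    proof -
      have "(g has_field_derivative deriv g z) (at z)"
        using holomorphic_derivI[OF g(1) _ that] by (simp add: B_def)
      hence "((\<lambda>z. exp (g z)) has_field_derivative exp (g z) * deriv g z) (at z)"
        by (rule DERIV_chain2[OF DERIV_exp])
      hence "(zeta has_field_derivative exp (g z) * deriv g z) (at z)"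
        by (rule has_field_derivative_transform_within_open[of _ _ _ B]) (use that g(2) in \<open>auto simp: B_def\<close>)
      hence "deriv zeta z = zeta z * deriv g z" using DERIV_imp_deriv g(2)[OF that] by metis
      thus ?thesis using nzB[OF that] by (simp add: F_def)
    qed
    define A where "A = C1 * ln t"
    have "exp 1 \<le> t" using exp_le t by linarith
    hence lt: "ln t \<ge> 1" using t by (subst ln_ge_iff) auto
    have A0: "A > 0" using C1 lt by (simp add: A_def)
    define f where "f = (\<lambda>z. g (s0 + z) - g s0)"
    have s0z: "s0 + z \<in> B" if "norm z < R" for z using that by (simp add: B_def dist_norm)
    have holf: "f holomorphic_on ball 0 R"
    proof -
      have "(\<lambda>z. g (s0 + z)) holomorphic_on ball 0 R"
        by (rule holomorphic_on_compose_gen[OF _ g(1), unfolded o_def])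
           (auto intro!: holomorphic_intros simp: B_def)
      from holomorphic_on_diff[OF this holomorphic_on_const] show ?thesis unfolding f_def .
    qed
    have ReA: "Re (f z) < A" if "norm z < R" for z
    proof -
      have n: "exp (Re (g z)) = norm (zeta z)" if "z \<in> B" for z
        using g(2)[OF that] by (metis norm_exp_eq_Re)
      have "norm (zeta (s0 + z)) \<le> C0 * Im (s0 + z)" using inB[OF s0z[OF that]] by (intro C0) auto
      also have "\<dots> \<le> C0 * (t + 2)" using inB(4)[OF s0z[OF that]] C0 by (intro mult_left_mono) auto
      finally have 1: "exp (Re (g (s0 + z))) \<le> C0 * (t + 2)" using n[OF s0z[OF that]] by simp
      have 2: "1 / 4 \<le> exp (Re (g s0))" using n[OF s0B] norm_zeta_two_ge[of t] by (simp add: s0_def)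
      have "exp (Re (f z)) = exp (Re (g (s0 + z))) / exp (Re (g s0))" by (simp add: f_def exp_diff)
      also have "\<dots> \<le> C0 * (t + 2) / (1 / 4)" using 1 2 C0 t by (intro frac_le) auto
      also have "\<dots> = 4 * C0 * (t + 2)" by simp
      also have "\<dots> < (4 * C0 + 1) * (t + 2)" using t by (simp add: algebra_simps)
      also have "\<dots> \<le> (4 * C0 + 1) * t ^ 2"
      proof (rule mult_left_mono)
        have "3 * t \<le> t * t" using t by (intro mult_right_mono) auto
        thus "t + 2 \<le> t ^ 2" using t unfolding power2_eq_square by linarith
      qed (use C0 in simp)
      finally have "Re (f z) < ln ((4 * C0 + 1) * t ^ 2)"
        using C0 t ln_less_cancel_iff[of "exp (Re (f z))" "(4 * C0 + 1) * t ^ 2"] by simp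
      also have "\<dots> = ln (4 * C0 + 1) + 2 * ln t" using C0 t by (simp add: ln_mult ln_realpow)
      also have "\<dots> \<le> ln (4 * C0 + 1) * ln t + 2 * ln t"
        using lt C0 mult_left_mono[of 1 "ln t" "ln (4 * C0 + 1)"] by simp
      finally show ?thesis by (simp add: A_def C1_def algebra_simps)
    qed
    define B1 where "B1 = 2 * A * r1 / (R - r1)"
    have bc: "norm (g z - g s0) \<le> B1" if "norm (z - s0) \<le> r1" for z
      using borel_caratheodory[OF holf _ ReA that r(3) A0] by (simp add: f_def B1_def)
    define B2 where "B2 = B1 / (r1 - r2)"
    have FB: "norm (F z) \<le> B2" if "norm (s0 - z) = r2" for z
    proof -
      have z2: "cball z (r1 - r2) \<subseteq> cball s0 r1"
      proof
        fix y assume y: "y \<in> cball z (r1 - r2)"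
        have "dist s0 y \<le> dist s0 z + dist z y" by (rule dist_triangle)
        thus "y \<in> cball s0 r1" using y that by (simp add: dist_norm[of s0 z])
      qed
      moreover have "cball s0 r1 \<subseteq> B" using r by (auto simp: B_def)
      ultimately have z: "cball z (r1 - r2) \<subseteq> B" "cball z (r1 - r2) \<subseteq> cball s0 r1" by auto
      have "norm ((deriv ^^ 1) (\<lambda>z. g z - g s0) z) \<le> fact 1 * B1 / (r1 - r2) ^ 1"
      proof (rule Cauchy_inequality)
        show "(\<lambda>z. g z - g s0) holomorphic_on ball z (r1 - r2)"
          by (intro holomorphic_intros holomorphic_on_subset[OF g(1)]) (use z ball_subset_cball in blast)
        show "continuous_on (cball z (r1 - r2)) (\<lambda>z. g z - g s0)"
          by (intro continuous_intros holomorphic_on_imp_continuous_on holomorphic_on_subset[OF g(1)] z)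
        show "norm (g x - g s0) \<le> B1" if "norm (z - x) = r1 - r2" for x
        proof (rule bc)
          have "x \<in> cball z (r1 - r2)" using that by (simp add: dist_norm)
          hence "x \<in> cball s0 r1" using z by blast
          thus "norm (x - s0) \<le> r1" by (simp add: dist_norm norm_minus_commute)
        qed
      qed (use r in auto)
      moreover have "z \<in> B" using z r by (auto simp: subset_iff)
      moreover have "deriv (\<lambda>z. g z - g s0) z = deriv g z"
        using holomorphic_on_imp_differentiable_at[OF g(1) _ \<open>z \<in> B\<close>] by (subst deriv_diff) (auto simp: B_def)
      ultimately show ?thesis using dg by (simp add: B2_def)
    qed
    define u where "u = (\<lambda>k. (deriv ^^ k) F s0 / fact k * (w - s0) ^ k)"
    have ws0: "w - s0 = of_real (\<sigma> - 2)" by (simp add: w_def s0_def)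
    have nws0: "norm (w - s0) = 2 - \<sigma>" unfolding ws0 norm_of_real using \<sigma> by simp
    have wB: "w \<in> ball s0 R" using nws0 R by (simp add: dist_norm norm_minus_commute)
    have su: "u sums F w" unfolding u_def
      by (rule holomorphic_power_series[OF F[unfolded B_def] wB])
    have B0: "B1 \<ge> 0" "B2 \<ge> 0" using A0 r by (auto simp: B1_def B2_def)
    have nu: "norm (u k) \<le> B2 * q ^ k" for k
    proof -
      have "norm ((deriv ^^ k) F s0) \<le> fact k * B2 / r2 ^ k"
      proof (rule Cauchy_inequality)
        show "F holomorphic_on ball s0 r2"
          by (rule holomorphic_on_subset[OF F]) (use r in \<open>auto simp: B_def\<close>)
        show "continuous_on (cball s0 r2) F"
          by (rule holomorphic_on_imp_continuous_on[OF holomorphic_on_subset[OF F]]) (use r in \<open>auto simp: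
            B_def\<close>)
      qed (use r FB in auto)
      hence "norm (u k) \<le> (fact k * B2 / r2 ^ k) / fact k * (2 - \<sigma>) ^ k"
        unfolding u_def norm_mult norm_divide norm_power nws0 norm_fact
        using \<sigma> by (intro mult_right_mono divide_right_mono) auto
      also have "\<dots> = B2 * q ^ k" by (simp add: q_def power_divide)
      finally show ?thesis .
    qed
    have tail: "norm (F w - (\<Sum>k<K. u k)) \<le> C * ln t * q ^ K"
    proof -
      have gs: "(\<lambda>k. B2 * q ^ K * q ^ k) sums (B2 * q ^ K * (1 / (1 - q)))"
        by (intro sums_mult geometric_sums) (use q in auto)
      have le: "norm (u (k + K)) \<le> B2 * q ^ K * q ^ k" for k
        using nu[of "k + K"] by (simp add: power_add mult_ac)
      have "F w - (\<Sum>k<K. u k) = (\<Sum>k. u (k + K))"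
        using suminf_minus_initial_segment[of u K] su by (simp add: sums_iff)
      also have "norm \<dots> \<le> (\<Sum>k. B2 * q ^ K * q ^ k)"
        by (rule norm_suminf_le[OF le sums_summable[OF gs]])
      also have "\<dots> = B2 * q ^ K * (1 / (1 - q))" using gs by (simp add: sums_iff)
      also have "\<dots> = C * ln t * q ^ K"
        by (simp add: C_def C2_def B2_def B1_def A_def)
      finally show ?thesis .
    qed
    have Re_s0: "Re s0 > 1" by (simp add: s0_def)
    define v where "v = (\<lambda>k n. mangoldt n * real n powr (- 2) * (((2 - \<sigma>) * ln (real n)) ^ k / fact k)
      * cos (t * ln (real n)))"
    have sv: "v k sums Re (u k)" for k
    proof -
      \<comment> \<open>The unit disc about \<open>s0\<close> lies in the half-plane of convergence
        and also in \<open>B\<close>, because \<open>R > 2 - \<sigma> > 1\<close>; there the two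
        functions agree.\<close>
      have "(deriv ^^ k) F s0 = (deriv ^^ k) (dseries mangoldt) s0"
      proof (rule higher_deriv_transform_within_open[of _ "ball s0 1"])
        have B1: "ball s0 1 \<subseteq> B" unfolding B_def using r \<sigma> R by (intro subset_ball) auto
        have Re1: "Re z > 1" if "z \<in> ball s0 1" for z
          using abs_Re_le_cmod[of "s0 - z"] that by (auto simp: dist_norm s0_def)
        show "F holomorphic_on ball s0 1" by (rule holomorphic_on_subset[OF F B1])
        show "dseries mangoldt holomorphic_on ball s0 1"
          by (rule holomorphic_on_subset[OF dseries_holomorphic[OF dconv_mangoldt]]) (use Re1 in auto)
        show "F z = dseries mangoldt z" if "z \<in> ball s0 1" for z
          using mangoldt_dseries_mult_zeta[OF Re1[OF that]] nzB[of z] B1 that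
            by (auto simp: F_def field_simps)
      qed auto
      also have "\<dots> = dseries (\<lambda>n. (- ln (real n)) ^ k * mangoldt n) s0"
        by (rule dseries_higher_deriv[OF dconv_mangoldt Re_s0])
      finally have d: "(deriv ^^ k) F s0 = dseries (\<lambda>n. (- ln (real n)) ^ k * mangoldt n) s0" .
      have "(\<lambda>n. of_real ((- ln (real n)) ^ k * mangoldt n) * of_nat n powr (- s0)) sums (deriv ^^ k) F s0"
        unfolding d dseries_def
        by (rule summable_sums[OF summable_norm_cancel[OF dseries_summable[OF dconv_ln_power[OF
          dconv_mangoldt] Re_s0]]])
      from sums_mult2[OF bounded_linear.sums[OF bounded_linear_Re this]]
      have "(\<lambda>n. Re (of_real ((- ln (real n)) ^ k * mangoldt n) * of_nat n powr (- s0)) * ((\<sigma> - 2) ^ k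
        / fact k))
         sums (Re ((deriv ^^ k) F s0) * ((\<sigma> - 2) ^ k / fact k))"
        .
      also have "Re ((deriv ^^ k) F s0) * ((\<sigma> - 2) ^ k / fact k) = Re (u k)"
      proof -
        have "u k = (deriv ^^ k) F s0 * of_real ((\<sigma> - 2) ^ k / fact k)"
          unfolding u_def ws0 by simp
        moreover have "Re (z * of_real x) = Re z * x" for z x by simp
        ultimately show ?thesis by (simp only:)
      qed
      also have "(\<lambda>n. Re (of_real ((- ln (real n)) ^ k * mangoldt n) * of_nat n powr (- s0)) * ((\<sigma>
        - 2) ^ k / fact k)) = v k"
      proof
        fix n
        show "Re (of_real ((- ln (real n)) ^ k * mangoldt n) * of_nat n powr (- s0)) * ((\<sigma> - 2) ^ k
          / fact k) = v k n"
        proof (cases "n = 0")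
          case False
          have pw: "real n powr (- 2) = exp (- 2 * ln (real n))"
            using False unfolding powr_def by simp
          have "of_nat n powr (- s0) = exp (of_real (- 2 * ln (real n)) + \<i> * of_real (- (t * ln (real n))))"
            using False by (simp add: powr_def Ln_of_nat s0_def algebra_simps)
          also have "exp (of_real (- 2 * ln (real n)) + \<i> * of_real (- (t * ln (real n))))
            = of_real (real n powr (- 2)) * cis (- (t * ln (real n)))"
            unfolding pw exp_add cis_conv_exp[symmetric] exp_of_real ..
          finally have f1: "Re (of_real ((- ln (real n)) ^ k * mangoldt n) * of_nat n powr (- s0))
             = (- ln (real n)) ^ k * mangoldt n * (real n powr (- 2) * cos (t * ln (real n)))" by simp
          \<comment> \<open>The sign from differentiating \<open>n powr (- s)\<close> cancels the
            sign from moving to the left, which is why all coefficients are nonnegative.\<close>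
          have f2: "(- ln (real n)) ^ k * (\<sigma> - 2) ^ k = ((2 - \<sigma>) * ln (real n)) ^ k"
            by (simp add: power_mult_distrib[symmetric] algebra_simps)
          show ?thesis unfolding v_def f1 f2[symmetric] by simp
        qed (simp add: v_def)
      qed
      finally show ?thesis .
    qed
    have "(\<lambda>n. \<Sum>k<K. v k n) sums (\<Sum>k<K. Re (u k))" by (intro sums_sum sv)
    also have "(\<lambda>n. \<Sum>k<K. v k n) = (\<lambda>n. taylor_coeff \<sigma> K n * cos (t * ln (real n)))"
      by (simp add: v_def taylor_coeff_def sum_distrib_left sum_distrib_right)
    finally have "(\<Sum>n. taylor_coeff \<sigma> K n * cos (t * ln (real n))) = (\<Sum>k<K. Re (u k))"
      by (simp add: sums_iff)
    hence "- Re (deriv zeta w / zeta w) - (\<Sum>n. taylor_coeff \<sigma> K n * cos (t * ln (real n)))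
        = Re (F w - (\<Sum>k<K. u k))" by (simp add: F_def)
    thus ?thesis using tail abs_Re_le_cmod[of "F w - (\<Sum>k<K. u k)"] unfolding w_def by linarith
  qed
  ultimately show ?thesis using q by blast
qed

section \<open>Large values of the von Mangoldt function\<close>

text \<open>Legendre's formula in logarithmic form. The terms with \<open>d > n\<close> vanish, as
  \<open>n div d = 0\<close>; a range up to any \<open>M \<ge> n\<close> allows the factorials of
  \<open>n\<close> and \<open>2 * n\<close> to be written over the same \<open>d\<close>.\<close>

lemma ln_fact_mangoldt:
  assumes "n \<le> M"
  shows "ln (fact n :: real) = (\<Sum>d=1..M. mangoldt d * real (n div d))"
proof -
  have "ln (fact n :: real) = (\<Sum>k=1..n. ln (real k))"
    by (induction n) (auto simp: ln_mult)
  also have "\<dots> = (\<Sum>k=1..n. \<Sum>d\<in>{d\<in>{1..M}. d dvd k}. mangoldt d)"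
  proof (rule sum.cong)
    fix k assume k: "k \<in> {1..n}"
    have "{d. d dvd k} = {d\<in>{1..M}. d dvd k}"
    proof (intro equalityI subsetI)
      fix d assume "d \<in> {d. d dvd k}"
      hence d: "d dvd k" by simp
      have "d \<le> k" "d > 0" using k d by (auto intro: dvd_imp_le dvd_pos_nat)
      thus "d \<in> {d\<in>{1..M}. d dvd k}" using d k assms by simp
    qed simp
    thus "ln (real k) = (\<Sum>d\<in>{d\<in>{1..M}. d dvd k}. mangoldt d)"
      using mangoldt_sum[of k, where 'a = real] k by simp
  qed simp
  also have "\<dots> = (\<Sum>d=1..M. \<Sum>k\<in>{k\<in>{1..n}. d dvd k}. mangoldt d)"
    by (rule sum.swap_restrict) auto
  also have "\<dots> = (\<Sum>d=1..M. mangoldt d * real (n div d))"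
  proof (rule sum.cong)
    fix d assume d: "d \<in> {1..M}"
    have "{k\<in>{1..n}. d dvd k} = (\<lambda>j. d * j) ` {1..n div d}"
      using d by (auto elim!: dvdE simp: less_eq_div_iff_mult_less_eq mult.commute)
    hence "card {k\<in>{1..n}. d dvd k} = n div d"
      using d by (simp add: card_image inj_on_def)
    thus "(\<Sum>k\<in>{k\<in>{1..n}. d dvd k}. mangoldt d) = mangoldt d * real (n div d)" by simp
  qed simp
  finally show ?thesis .
qed

text \<open>Chebyshev's argument: the central binomial coefficient is at least \<open>2 ^ n\<close>,
  and in its logarithm each \<open>mangoldt d\<close> has the factor
  \<open>2 * n div d - 2 * (n div d)\<close>, which is at most 1.\<close>

lemma psi_lower_bound: "real n * ln 2 \<le> (\<Sum>d=1..2*n. mangoldt d)"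
proof (cases "n = 0")
  case False
  have "(2::real) ^ n = (of_nat (2 * n) / of_nat n) ^ n" using False by simp
  also have "\<dots> \<le> of_nat ((2 * n) choose n)" by (rule binomial_ge_n_over_k_pow_k) auto
  also have "\<dots> = fact (2 * n) / (fact n * fact n)" by (simp add: binomial_fact mult_2)
  finally have "ln ((2::real) ^ n) \<le> ln (fact (2 * n) / (fact n * fact n))"
    by (subst ln_le_cancel_iff) auto
  hence "real n * ln 2 \<le> ln (fact (2 * n)) - 2 * ln (fact n :: real)"
    by (simp add: ln_div ln_mult ln_realpow)
  also have "\<dots> = (\<Sum>d=1..2*n. mangoldt d * real (2 * n div d)) - 2 * (\<Sum>d=1..2*n. mangoldt d * real (n div d))"
    using ln_fact_mangoldt[of "2 * n" "2 * n"] ln_fact_mangoldt[of n "2 * n"] by simp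
  also have "\<dots> = (\<Sum>d=1..2*n. mangoldt d * (real (2 * n div d) - 2 * real (n div d)))"
    unfolding sum_distrib_left sum_subtractf[symmetric] by (intro sum.cong refl) (simp add: algebra_simps)
  also have "\<dots> \<le> (\<Sum>d=1..2*n. mangoldt d * 1)"
  proof (intro sum_mono mult_left_mono mangoldt_nonneg)
    fix d assume d: "d \<in> {1..2*n}"
    have "2 * n div d \<le> 2 * (n div d) + 1"
    proof -
      have "n < d * (n div d + 1)" using d
        by (metis One_nat_def add.commute atLeastAtMost_iff dividend_less_times_div less_le_trans
        plus_1_eq_Suc zero_less_one mult_Suc_right)
      hence "2 * n < (2 * (n div d) + 2) * d" by (simp add: algebra_simps)
      thus ?thesis using d by (simp add: div_less_iff_less_mult flip: less_Suc_eq_le)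
    qed
    hence "real (2 * n div d) \<le> real (2 * (n div d) + 1)" by (rule of_nat_mono)
    thus "real (2 * n div d) - 2 * real (n div d) \<le> 1" by simp
  qed
  finally show ?thesis by simp
qed simp

lemma mangoldt_le_ln: "n > 0 \<Longrightarrow> mangoldt n \<le> ln (real n)"
  using mangoldt_le[of n] by simp

text \<open>The sum of \<open>mangoldt\<close> up to \<open>y\<close> is at least
  \<open>y / 6\<close>. Positive values below \<open>ln y / 2\<close> occur only at powers of primes
  below \<open>sqrt y\<close>; there are at most \<open>sqrt y * log 2 y\<close> of these, and they
  account for at most \<open>y / 12\<close>. The other half comes from the counted numbers, each
  contributing at most \<open>ln y\<close>.\<close>

lemma many_large_mangoldt:
  "\<forall>\<^sub>F y :: nat in sequentially.
     real y / (12 * ln (real y)) \<le> real (card {n\<in>{1..y}. mangoldt n \<ge> ln (real y) / 2})"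
proof -
  have "\<forall>\<^sub>F y :: nat in sequentially.
      sqrt (real y) * log 2 (real y) * (ln (real y) / 2) \<le> real y / 12"
    by real_asymp
  thus ?thesis using eventually_ge_at_top[of 2]
  proof eventually_elim
    case (elim y)
    define l where "l = ln (real y)"
    have l: "l > 0" using elim by (simp add: l_def)
    define S where "S = {n\<in>{1..y}. (mangoldt n :: real) > 0 \<and> mangoldt n < l / 2}"
    define G where "G = {n\<in>{1..y}. mangoldt n \<ge> l / 2}"
    have fin: "finite S" "finite G" by (auto simp: S_def G_def)
    have "real y / 6 \<le> real (y div 2) * ln 2"
    proof -
      have "y \<le> 3 * (y div 2)" using elim by linarith
      hence "real y \<le> real (3 * (y div 2))" by (rule of_nat_mono)
      moreover have "real (y div 2) * (1 / 2) \<le> real (y div 2) * ln 2"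
        using ln2_ge_two_thirds by (intro mult_left_mono) auto
      ultimately show ?thesis by simp
    qed
    also have "\<dots> \<le> (\<Sum>d=1..2*(y div 2). mangoldt d)" by (rule psi_lower_bound)
    also have "\<dots> \<le> (\<Sum>d=1..y. mangoldt d)"
      by (intro sum_mono2 mangoldt_nonneg) auto
    also have "\<dots> = (\<Sum>d\<in>S \<union> G. mangoldt d)"
    proof (rule sum.mono_neutral_right)
      show "\<forall>i\<in>{1..y} - (S \<union> G). mangoldt i = (0::real)"
      proof
        fix i assume "i \<in> {1..y} - (S \<union> G)"
        hence "\<not> 0 < (mangoldt i :: real)" by (auto simp: S_def G_def not_le)
        thus "mangoldt i = (0::real)" using mangoldt_nonneg[of i] by linarith
      qed
    qed (auto simp: S_def G_def)
    also have "\<dots> \<le> (\<Sum>d\<in>S. mangoldt d) + (\<Sum>d\<in>G. mangoldt d)"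
      by (subst sum.union_disjoint) (use fin in \<open>auto simp: S_def G_def\<close>)
    also have "(\<Sum>d\<in>S. mangoldt d) \<le> real (card S) * (l / 2)"
      by (rule sum_bounded_above) (auto simp: S_def)
    also have "(\<Sum>d\<in>G. mangoldt d) \<le> real (card G) * l"
    proof (rule sum_bounded_above)
      fix n assume "n \<in> G"
      hence n: "n > 0" "n \<le> y" by (auto simp: G_def)
      have "mangoldt n \<le> ln (real n)" by (rule mangoldt_le_ln[OF n(1)])
      also have "\<dots> \<le> l" using n by (simp add: l_def)
      finally show "mangoldt n \<le> l" .
    qed
    also have "real (card S) * (l / 2) \<le> sqrt (real y) * log 2 (real y) * (l / 2)"
    proof (intro mult_right_mono)
      define a where "a = nat \<lfloor>sqrt (real y)\<rfloor>"
      define b where "b = nat \<lfloor>log 2 (real y)\<rfloor>"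
      have "S \<subseteq> (\<lambda>(p, k). p ^ k) ` ({1..a} \<times> {1..b})"
      proof
        fix n assume n: "n \<in> S"
        hence "primepow n" by (auto simp: S_def mangoldt_def split: if_splits)
        then obtain p k where pk: "prime p" "k > 0" "n = p ^ k" unfolding primepow_def by auto
        have p2: "p \<ge> 2" using pk(1) prime_ge_2_nat by blast
        have "ln (real p) < l / 2" using n pk by (simp add: S_def)
        hence "ln (real p ^ 2) < l" using p2 by (simp add: ln_realpow)
        hence "real p ^ 2 < real y" using p2 elim unfolding l_def by (subst (asm) ln_less_cancel_iff) auto
        hence "real p \<le> sqrt (real y)" by (simp add: real_le_rsqrt)
        hence "p \<le> a" unfolding a_def by linarith
        have "2 ^ k \<le> p ^ k" using p2 by (rule power_mono) simp
        also have "p ^ k \<le> y" using n pk by (auto simp: S_def)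
        finally have "real (2 ^ k) \<le> real y" by (simp only: of_nat_le_iff)
        hence "2 ^ k \<le> real y" by simp
        hence "real k \<le> log 2 (real y)" using elim by (subst le_log_iff) (auto simp: powr_realpow)
        hence "k \<le> b" unfolding b_def by linarith
        thus "n \<in> (\<lambda>(p, k). p ^ k) ` ({1..a} \<times> {1..b})" using pk p2 \<open>p \<le> a\<close>
          by (intro image_eqI[of _ _ "(p, k)"]) auto
      qed
      hence "card S \<le> card ((\<lambda>(p, k). p ^ k :: nat) ` ({1..a} \<times> {1..b}))" by (rule card_mono[rotated]) simp
      also have "\<dots> \<le> card ({1..a} \<times> {1..b})" by (rule card_image_le) simp
      also have "\<dots> = a * b" by simp
      finally have "real (card S) \<le> real a * real b" by (simp only: of_nat_le_iff flip: of_nat_mult)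
      also have "\<dots> \<le> sqrt (real y) * log 2 (real y)"
        using elim unfolding a_def b_def by (intro mult_mono) auto
      finally show "real (card S) \<le> sqrt (real y) * log 2 (real y)" .
    qed (use l in auto)
    finally have "real y / 12 \<le> real (card G) * l" using elim by (simp add: l_def)
    thus ?case using l unfolding l_def[symmetric] G_def by (simp add: field_simps)
  qed
qed

section \<open>Pigeonhole pairs\<close>

text \<open>\<open>P\<close> consists of the pairs in a common box, so it is a disjoint union of
  squares \<open>A b \<times> A b\<close>. This makes every cosine sum over \<open>P\<close> a sum
  of terms \<open>|\<Sum> exp (i l \<omega>)|^2\<close>, and the Cauchy-Schwarz inequality bounds
  \<open>card P\<close> below by \<open>L^2\<close> divided by the number of boxes. Sixths are
  chosen because angles that differ by at most \<open>2 * pi / 6\<close> have a cosine of at least 1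
  / 2.\<close>

lemma pigeonhole_pairs:
  fixes x :: "'q \<Rightarrow> real" and L :: nat
  assumes "finite Q"
  obtains P where "P \<subseteq> {..<L} \<times> {..<L}" "real L ^ 2 \<le> real (card P) * 6 ^ card Q"
    "\<And>l l' q. (l, l') \<in> P \<Longrightarrow> q \<in> Q \<Longrightarrow> cos ((real l - real l') * x q) \<ge> 1 / 2"
    "\<And>\<omega>. (\<Sum>(l, l')\<in>P. cos ((real l - real l') * \<omega>)) \<ge> 0"
proof -
  define g where "g = (\<lambda>l q. real l * x q / (2 * pi))"
  define box where "box = (\<lambda>l. \<lambda>q\<in>Q. \<lfloor>6 * frac (g l q)\<rfloor>)"
  define A where "A = (\<lambda>b. {l\<in>{..<L}. box l = b})"
  define B where "B = box ` {..<L}"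
  define P where "P = (\<Union>b\<in>B. A b \<times> A b)"
  have fin: "finite B" "finite (A b)" for b by (auto simp: B_def A_def)
  have sumP: "(\<Sum>p\<in>P. f p) = (\<Sum>b\<in>B. \<Sum>l\<in>A b. \<Sum>l'\<in>A b. f (l, l'))" for f :: "nat \<times> nat \<Rightarrow> real"
  proof -
    have "(\<Sum>p\<in>P. f p) = (\<Sum>b\<in>B. \<Sum>p\<in>A b \<times> A b. f p)"
      unfolding P_def using fin by (intro sum.UNION_disjoint) (auto simp: A_def)
    thus ?thesis by (simp add: sum.cartesian_product)
  qed
  show ?thesis
  proof
    show "P \<subseteq> {..<L} \<times> {..<L}" by (auto simp: P_def A_def)
    have "B \<subseteq> (\<Pi>\<^sub>E q\<in>Q. {0..<6})"
    proof
      fix b assume "b \<in> B"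
      then obtain l where b: "b = box l" by (auto simp: B_def)
      have "0 \<le> \<lfloor>6 * frac (g l q)\<rfloor> \<and> \<lfloor>6 * frac (g l q)\<rfloor> < 6" for q
        using frac_ge_0[of "g l q"] frac_lt_1[of "g l q"] by linarith
      thus "b \<in> (\<Pi>\<^sub>E q\<in>Q. {0..<6})" unfolding b box_def by auto
    qed
    hence "card B \<le> card (\<Pi>\<^sub>E q\<in>Q. {0..<6::int})"
      using assms by (intro card_mono finite_PiE) auto
    hence cB: "card B \<le> 6 ^ card Q" using assms by (simp add: card_PiE)
    have "(\<Sum>b\<in>B. card (A b)) = card (\<Union>b\<in>B. A b)"
      using fin by (intro card_UN_disjoint[symmetric]) (auto simp: A_def)
    also have "(\<Union>b\<in>B. A b) = {..<L}" by (auto simp: A_def B_def)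
    finally have sA: "(\<Sum>b\<in>B. real (card (A b))) = real L"
      by (simp flip: of_nat_sum)
    have "real (card P) = (\<Sum>p\<in>P. 1)" by simp
    also have "\<dots> = (\<Sum>b\<in>B. (real (card (A b)))\<^sup>2)" unfolding sumP by (simp add: power2_eq_square)
    finally have cP: "real (card P) = (\<Sum>b\<in>B. (real (card (A b)))\<^sup>2)" .
    have "real L ^ 2 \<le> real (card P) * real (card B)"
      unfolding sA[symmetric] cP by (rule sum_squared_le_sum_of_squares)
    also have "\<dots> \<le> real (card P) * 6 ^ card Q"
      using cB by (intro mult_left_mono) (auto simp flip: of_nat_power)
    finally show "real L ^ 2 \<le> real (card P) * 6 ^ card Q" .
  next
    fix l l' q assume "(l, l') \<in> P" and q: "q \<in> Q"
    hence "box l = box l'" by (auto simp: P_def A_def)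
    hence "box l q = box l' q" by simp
    hence fl: "\<lfloor>6 * frac (g l q)\<rfloor> = \<lfloor>6 * frac (g l' q)\<rfloor>"
      using q by (simp add: box_def)
    define d where "d = frac (g l q) - frac (g l' q)"
    have d: "\<bar>d\<bar> \<le> 1 / 6" using fl unfolding d_def by linarith
    have "(real l - real l') * x q = 2 * pi * d + 2 * pi * of_int (\<lfloor>g l q\<rfloor> - \<lfloor>g l' q\<rfloor>)"
    proof -
      have "(real l - real l') * x q = 2 * pi * (g l q - g l' q)" by (simp add: g_def field_simps)
      also have "g l q - g l' q = d + of_int (\<lfloor>g l q\<rfloor> - \<lfloor>g l' q\<rfloor>)" by (simp add: d_def frac_def)
      finally show ?thesis by (simp add: algebra_simps)
    qed
    hence "cos ((real l - real l') * x q) = cos (2 * pi * d)"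
      by (simp only: cos_add cos_int_2pin sin_int_2pin mult_1_right mult_zero_right diff_zero)
    also have "\<dots> = cos \<bar>2 * pi * d\<bar>" by simp
    also have "\<dots> \<ge> cos (pi / 3)"
      using d by (intro cos_monotone_0_pi_le) (auto simp: abs_mult)
    finally show "cos ((real l - real l') * x q) \<ge> 1 / 2" by (simp add: cos_60)
  next
    fix \<omega> :: real
    have "(\<Sum>(l, l')\<in>P. cos ((real l - real l') * \<omega>))
       = (\<Sum>b\<in>B. (\<Sum>l\<in>A b. cos (real l * \<omega>))\<^sup>2 + (\<Sum>l\<in>A b. sin (real l * \<omega>))\<^sup>2)"
      unfolding sumP by (simp add: left_diff_distrib cos_diff sum.distrib power2_eq_square sum_product)
    also have "\<dots> \<ge> 0" by (intro sum_nonneg) auto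
    finally show "(\<Sum>(l, l')\<in>P. cos ((real l - real l') * \<omega>)) \<ge> 0" .
  qed
qed

text \<open>Suppose every shift outside \<open>Bad\<close> stays below a quarter of
  \<open>sum a Q\<close>. Summed over the pairs in \<open>P\<close>, the frequencies from
  \<open>Q\<close> give at least half of \<open>sum a Q\<close> per pair, and every other frequency
  a nonnegative total. Pairs with distance in \<open>Bad\<close> are at most
  \<open>2 * L * card Bad\<close> in number and give at most \<open>suminf a\<close> each, so the
  lower bound for \<open>card P\<close> contradicts \<open>large\<close>. The shift 0 is not
  excluded here; in the application it belongs to \<open>Bad\<close>.\<close>

lemma exists_good_shift:
  fixes a \<omega> :: "nat \<Rightarrow> real"
  assumes a: "\<And>n. a n \<ge> 0" "summable a" and Q: "finite Q" and Bad: "Bad \<subseteq> {..<L}"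
    and large: "8 * 6 ^ card Q * real (card Bad) * suminf a < sum a Q * real L"
  shows "\<exists>h<L. h \<notin> Bad \<and> sum a Q / 4 \<le> (\<Sum>n. a n * cos (real h * \<omega> n))"
proof (rule ccontr)
  assume none: "\<not> ?thesis"
  obtain P where P: "P \<subseteq> {..<L} \<times> {..<L}" "real L ^ 2 \<le> real (card P) * 6 ^ card Q"
    "\<And>l l' q. (l, l') \<in> P \<Longrightarrow> q \<in> Q \<Longrightarrow> cos ((real l - real l') * \<omega> q) \<ge> 1 / 2"
    "\<And>x. (\<Sum>(l, l')\<in>P. cos ((real l - real l') * x)) \<ge> 0"
    using pigeonhole_pairs[OF Q, of L \<omega>] by blast
  have finP: "finite P" using P(1) by (rule finite_subset) simp
  have finB: "finite Bad" using Bad by (rule finite_subset) simp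
  define A where "A = sum a Q"
  have A0: "A \<ge> 0" unfolding A_def using a by (simp add: sum_nonneg)
  have S0: "suminf a \<ge> 0" using a by (simp add: suminf_nonneg)
  have "0 \<le> 8 * 6 ^ card Q * real (card Bad) * suminf a" using S0 by simp
  hence "0 < A * real L" using large unfolding A_def by linarith
  hence L0: "L > 0" "A > 0" using A0 by (auto simp: zero_less_mult_iff)
  define D where "D = (\<lambda>p::nat \<times> nat. \<Sum>n. a n * cos ((real (fst p) - real (snd p)) * \<omega> n))"
  define dst where "dst = (\<lambda>p::nat \<times> nat. if fst p \<ge> snd p then fst p - snd p else snd p - fst p)"
  have sm: "summable (\<lambda>n. a n * cos (x * \<omega> n))" for x
    by (rule summable_comparison_test'[OF a(2), of 0])
       (use a(1) in \<open>auto simp: abs_mult intro!: mult_left_le\<close>)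
  have D: "D p = (\<Sum>n. a n * cos (real (dst p) * \<omega> n))" for p
  proof (cases "fst p \<ge> snd p")
    case False
    have "cos ((real (fst p) - real (snd p)) * x) = cos (real (snd p - fst p) * x)" for x
    proof -
      have "(real (fst p) - real (snd p)) * x = - (real (snd p - fst p) * x)"
        using False by (simp add: of_nat_diff algebra_simps)
      thus ?thesis by (simp only: cos_minus)
    qed
    thus ?thesis using False by (simp add: D_def dst_def)
  qed (simp add: D_def dst_def of_nat_diff)
  have D_le: "D p \<le> suminf a" for p
    unfolding D_def by (intro suminf_le sm a) (use a(1) in \<open>auto intro: mult_left_le\<close>)
  define PB where "PB = {p\<in>P. dst p \<in> Bad}"
  have cPB: "real (card PB) \<le> 2 * real L * real (card Bad)"
  proof -
    \<comment> \<open>A pair is determined by its first entry, its distance and its order; the order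
      accounts for the factor 2.\<close>
    define f where "f = (\<lambda>p::nat \<times> nat. (fst p, dst p, fst p \<ge> snd p))"
    have "inj_on f PB"
      by (rule inj_on_inverseI[of _ "\<lambda>(l, h, b). (l, if b then l - h else l + h)"])
         (auto simp: f_def dst_def)
    moreover have "f ` PB \<subseteq> {..<L} \<times> Bad \<times> (UNIV :: bool set)" using P(1) by (auto simp: f_def PB_def)
    ultimately have "card PB \<le> card ({..<L} \<times> Bad \<times> (UNIV :: bool set))"
      using finB by (intro card_inj_on_le[of f]) auto
    also have "\<dots> = 2 * L * card Bad" by (simp add: card_cartesian_product)
    finally show ?thesis by (metis of_nat_le_iff of_nat_mult of_nat_numeral)
  qed
  have lower: "A / 2 * real (card P) \<le> (\<Sum>p\<in>P. D p)"
  proof -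
    have e: "(\<Sum>p\<in>P. a n * cos ((real (fst p) - real (snd p)) * \<omega> n))
       = a n * (\<Sum>(l, l')\<in>P. cos ((real l - real l') * \<omega> n))" for n
      by (simp add: sum_distrib_left case_prod_unfold)
    have "A / 2 * real (card P) = (\<Sum>n\<in>Q. a n * (real (card P) * (1 / 2)))"
      by (simp add: A_def sum_distrib_right sum_divide_distrib)
    also have "\<dots> \<le> (\<Sum>n\<in>Q. \<Sum>p\<in>P. a n * cos ((real (fst p) - real (snd p)) * \<omega> n))"
      unfolding e using a(1) P(3)
      by (intro sum_mono mult_left_mono sum_bounded_below) (auto simp: case_prod_unfold)
    also have "\<dots> \<le> (\<Sum>n. \<Sum>p\<in>P. a n * cos ((real (fst p) - real (snd p)) * \<omega> n))"
      using P(4) a(1) by (intro sum_le_suminf Q summable_sum sm) (auto simp: e)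
    also have "\<dots> = (\<Sum>p\<in>P. D p)" unfolding D_def by (intro suminf_sum sm)
    finally show ?thesis .
  qed
  have "(\<Sum>p\<in>P. D p) = (\<Sum>p\<in>PB. D p) + (\<Sum>p\<in>P - PB. D p)"
    using finP by (subst sum.subset_diff[of PB P]) (auto simp: PB_def)
  also have "(\<Sum>p\<in>PB. D p) \<le> real (card PB) * suminf a" by (intro sum_bounded_above D_le)
  also have "\<dots> \<le> 2 * real L * real (card Bad) * suminf a" by (intro mult_right_mono cPB S0)
  also have "(\<Sum>p\<in>P - PB. D p) \<le> real (card (P - PB)) * (A / 4)"
  proof (rule sum_bounded_above)
    fix p assume p: "p \<in> P - PB"
    have "dst p < L" using p P(1) by (auto simp: dst_def)
    moreover have "dst p \<notin> Bad" using p by (auto simp: PB_def)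
    ultimately show "D p \<le> A / 4" using none unfolding D A_def by (auto simp: not_le intro: less_imp_le)
  qed
  also have "\<dots> \<le> real (card P) * (A / 4)"
    using finP A0 by (intro mult_right_mono) (auto intro: card_mono)
  finally have "A / 2 * real (card P) \<le> 2 * (real L * real (card Bad) * suminf a) + A / 4 * real (card P)"
    using lower by (simp add: mult_ac)
  hence "A * real (card P) \<le> 8 * (real L * real (card Bad) * suminf a)" by simp
  hence "A * real (card P) \<le> 8 * real L * real (card Bad) * suminf a" by (simp add: mult.assoc)
  hence PQ: "A * real (card P) * 6 ^ card Q \<le> 8 * real L * real (card Bad) * suminf a * 6 ^ card Q"
    by (rule mult_right_mono) simp
  have "real L * (A * real L) = A * (real L)\<^sup>2" by (simp add: power2_eq_square)
  also have "\<dots> \<le> A * (real (card P) * 6 ^ card Q)" by (intro mult_left_mono P(2) A0)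
  also have "\<dots> = A * real (card P) * 6 ^ card Q" by (simp only: mult.assoc)
  also note PQ
  also have "8 * real L * real (card Bad) * suminf a * 6 ^ card Q
      = real L * (8 * 6 ^ card Q * real (card Bad) * suminf a)" by (simp only: mult_ac)
  finally have "real L * (A * real L) \<le> real L * (8 * 6 ^ card Q * real (card Bad) * suminf a)" .
  hence "A * real L \<le> 8 * 6 ^ card Q * real (card Bad) * suminf a" using L0 by simp
  thus False using large unfolding A_def by linarith
qed

section \<open>The number of heights excluded by zeros\<close>

text \<open>The mean square is used with \<open>X\<close> about \<open>n powr \<kappa>\<close> and
  \<open>Y\<close> about \<open>n powr (1 + \<kappa>)\<close>. The term with
  \<open>X powr (- \<eta>)\<close> saves only \<open>\<eta> * \<kappa> = \<eta>^2 / 4\<close> in the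
  exponent, the other two at least \<open>\<eta> / 2\<close>. Half of the smallest saving is kept as
  \<open>e = \<eta>^2 / 8\<close>; what is left over absorbs constants and logarithms.\<close>

lemma card_zero_discs_bound:
  fixes \<alpha> \<eta> :: real
  assumes \<eta>: "0 < \<eta>" "\<eta> < 1 / 4" and \<alpha>: "\<alpha> > 0"
  shows "\<forall>\<^sub>F n in sequentially.
    real (card {h\<in>{..<n}. \<exists>z\<in>ball (2 + \<i> * of_real (\<alpha> * real h)) (3 / 2 - 3 * \<eta>). zeta z = 0})
      \<le> real n powr (1 - \<eta>\<^sup>2 / 8)"
proof -
  define \<kappa> where "\<kappa> = \<eta> / 4"
  have \<kappa>: "0 < \<kappa>" using \<eta> by (simp add: \<kappa>_def)
  \<comment> \<open>Large enough for \<open>\<kappa> * Suc m > 1\<close>. Then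
    \<open>(1 + \<kappa>) * Suc m = m + 2 + d\<close> with \<open>d > 0\<close>, so a
    \<open>Y\<close> of the size \<open>n powr (1 + \<kappa>)\<close> meets the length condition of
    the tail bound.\<close>
  define m where "m = nat \<lceil>1 / \<kappa>\<rceil>"
  define d where "d = \<kappa> * real (Suc m) - 1"
  have "1 / \<kappa> < real (Suc m)" unfolding m_def by linarith
  hence d: "d > 0" using \<kappa> by (simp add: d_def field_simps)
  have "\<eta> < 1 / 2" using \<eta> by simp
  from mollified_mean_square[OF \<eta>(1) this, of m] obtain C where C: "C > 0"
   "\<And>X Y \<beta> T0 T. 1 \<le> X \<Longrightarrow> X \<le> Y \<Longrightarrow> 1 / 2 + \<eta> \<le> \<beta> \<Longrightarrow> \<beta> \<le> 4 \<Longrightarrow> 1 \<le> T0 \<Longrightarrow> T0 \<le> T \<Longrightarrow>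
    T ^ Suc (Suc m) \<le> real (Suc Y) ^ Suc m \<Longrightarrow>
    integral {T0..T} (\<lambda>t. (norm (zeta (of_real \<beta> + \<i> * of_real t) * mollifier X (of_real \<beta> + \<i>
      * of_real t) - 1))\<^sup>2)
     \<le> C * (T * real X powr (- \<eta>) + (1 + ln (real (X * Y))) * real (X * Y) powr (1 - \<eta>)
         + real X ^ 2 * real (Suc Y) powr (1 - 2 * \<eta>))" by blast
  define H0 where "H0 = nat \<lceil>3 / \<alpha>\<rceil>"
  have "3 / \<alpha> \<le> real H0" unfolding H0_def by linarith
  hence H0: "\<alpha> * real H0 \<ge> 3" using \<alpha> by (simp add: field_simps)
  define u where "u = min \<alpha> \<eta>"
  have u: "u > 0" using \<alpha> \<eta> by (simp add: u_def)
  define c where "c = (3 / 2 - \<eta>) / \<eta> / u * C"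
  have c: "c > 0" using \<eta> u C by (simp add: c_def)
  define e where "e = \<eta>\<^sup>2 / 8"
  have e: "0 < e" "e < 1 / 2" using \<eta> power_mono[of \<eta> 1 2] by (auto simp: e_def)
  have d1: "\<eta> * \<kappa> - e > 0" using \<eta> by (simp add: \<kappa>_def e_def power2_eq_square)
  have e1: "e < \<eta> / 2" using \<eta> mult_strict_left_mono[of \<eta> 4 \<eta>] by (simp add: e_def power2_eq_square)
  define d2 where "d2 = \<eta> / 2 - e"
  have d2: "d2 > 0" using e1 by (simp add: d2_def)
  define d3 where "d3 = \<eta> * \<kappa> - e"
  have d3: "d3 > 0" using d1 by (simp add: d3_def)
  have ev1: "\<forall>\<^sub>F n in sequentially. (\<alpha> + 2) ^ Suc (Suc m) \<le> real n powr d" using d by real_asymp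
  \<comment> \<open>The heights below \<open>H0\<close> and the three terms of the mean square
    receive one quarter of \<open>n powr (1 - e)\<close> each.\<close>
  have ev2: "\<forall>\<^sub>F n in sequentially. real H0 \<le> 1 / 4 * real n powr (1 - e)"
  proof -
    have "1 - e > 0" using e by simp
    thus ?thesis by real_asymp
  qed
  have ev3: "\<forall>\<^sub>F n in sequentially. c * (\<alpha> + 2) * real n powr (- d3) \<le> 1 / 4" using d3 by real_asymp
  have ev4: "\<forall>\<^sub>F n in sequentially. c * (4 * (1 + ln 4 + 2 * ln (real n))) * real n powr (- d2) \<le> 1 / 4"
    using d2 by real_asymp
  have ev5: "\<forall>\<^sub>F n in sequentially. c * 12 * real n powr (- d2) \<le> 1 / 4" using d2 by real_asymp
  from ev1 ev2 ev3 ev4 ev5 eventually_ge_at_top[of "max 1 H0"] show ?thesis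
  proof eventually_elim
    case (elim n)
    have n: "n \<ge> 1" "n \<ge> H0" using elim by auto
    define X where "X = nat \<lceil>real n powr \<kappa>\<rceil>"
    define Y where "Y = nat \<lceil>real n powr (1 + \<kappa>)\<rceil>"
    have pk: "real n powr \<kappa> \<ge> 1" using n \<kappa> by (simp add: ge_one_powr_ge_zero)
    have pk1: "real n powr (1 + \<kappa>) \<ge> real n powr \<kappa>" using n by (intro powr_mono) auto
    have X: "real n powr \<kappa> \<le> real X" "real X \<le> 2 * real n powr \<kappa>" "1 \<le> X"
      unfolding X_def using pk by linarith+
    have Y: "real n powr (1 + \<kappa>) \<le> real Y" "real Y \<le> 2 * real n powr (1 + \<kappa>)" "real (Suc Y)
      \<le> 3 * real n powr (1 + \<kappa>)"
      unfolding Y_def using pk pk1 by linarith+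
    have XY: "X \<le> Y" unfolding X_def Y_def using pk1 by (intro nat_mono ceiling_mono)
    define T where "T = \<alpha> * real n + 2"
    have T: "T \<le> (\<alpha> + 2) * real n" "T \<ge> 0" using n \<alpha> by (auto simp: T_def algebra_simps)
    have TY: "T ^ Suc (Suc m) \<le> real (Suc Y) ^ Suc m"
    proof -
      have "T ^ Suc (Suc m) \<le> ((\<alpha> + 2) * real n) ^ Suc (Suc m)" using T by (intro power_mono)
      also have "\<dots> = (\<alpha> + 2) ^ Suc (Suc m) * real n ^ Suc (Suc m)" by (rule power_mult_distrib)
      also have "\<dots> \<le> real n powr d * real n ^ Suc (Suc m)" using elim(1) by (intro mult_right_mono) auto
      also have "real n ^ Suc (Suc m) = real n powr real (Suc (Suc m))" using n
        by (intro powr_realpow[symmetric]) auto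
      also have "real n powr d * real n powr real (Suc (Suc m)) = real n powr ((1 + \<kappa>) * real (Suc m))"
        unfolding powr_add[symmetric] by (rule arg_cong2[of _ _ _ _ "(powr)"]) (auto simp: d_def
          algebra_simps)
      also have "\<dots> = (real n powr (1 + \<kappa>)) ^ Suc m"
        using n by (simp only: powr_powr[symmetric]) (intro powr_realpow, simp)
      also have "\<dots> \<le> real (Suc Y) ^ Suc m" using Y by (intro power_mono) auto
      finally show ?thesis .
    qed
    define W where "W = T * real X powr (- \<eta>) + (1 + ln (real (X * Y))) * real (X * Y) powr (1 - \<eta>)
         + real X ^ 2 * real (Suc Y) powr (1 - 2 * \<eta>)"
    have D: "integral {\<tau>0..\<tau>1} (\<lambda>t. (norm (zeta (of_real \<beta> + \<i> * of_real t) * mollifier X (of_real \<beta> + \<i>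
      * of_real t) - 1))\<^sup>2) \<le> C * W"
      if h: "1 / 2 + \<eta> \<le> \<beta>" "\<beta> \<le> 4" "1 \<le> \<tau>0" "\<tau>0 \<le> \<tau>1" "\<tau>1 \<le> \<alpha> * real n + 2" for \<beta> \<tau>0 \<tau>1
    proof -
      have "\<tau>1 ^ Suc (Suc m) \<le> T ^ Suc (Suc m)" using h by (intro power_mono) (auto simp: T_def)
      hence "\<tau>1 ^ Suc (Suc m) \<le> real (Suc Y) ^ Suc m" using TY by linarith
      from C(2)[OF X(3) XY h(1-4) this] have
       "integral {\<tau>0..\<tau>1} (\<lambda>t. (norm (zeta (of_real \<beta> + \<i> * of_real t) * mollifier X (of_real \<beta> + \<i>
         * of_real t) - 1))\<^sup>2)
       \<le> C * (\<tau>1 * real X powr (- \<eta>) + (1 + ln (real (X * Y))) * real (X * Y) powr (1 - \<eta>)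
         + real X ^ 2 * real (Suc Y) powr (1 - 2 * \<eta>))" .
      also have "\<dots> \<le> C * W" unfolding W_def
        using h C(1) by (intro mult_left_mono add_right_mono mult_right_mono) (auto simp: T_def)
      finally show ?thesis .
    qed
    define B where "B = (\<lambda>h. \<exists>z\<in>ball (2 + \<i> * of_real (\<alpha> * real h)) (3 / 2 - 3 * \<eta>). zeta z = 0)"
    have cB: "real (card {h\<in>{H0..<n}. B h}) * u \<le> (3 / 2 - \<eta>) / \<eta> * (C * W)"
      unfolding B_def u_def by (rule card_discs_with_zero_le[OF \<eta> \<alpha> D n(2) H0])
    hence "real (card {h\<in>{H0..<n}. B h}) \<le> (3 / 2 - \<eta>) / \<eta> * (C * W) / u"
      using u by (simp only: pos_le_divide_eq)
    hence cB: "real (card {h\<in>{H0..<n}. B h}) \<le> c * W" by (simp add: c_def)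
    have "card {h\<in>{..<n}. B h} \<le> card ({..<H0} \<union> {h\<in>{H0..<n}. B h})" by (rule card_mono) auto
    also have "\<dots> \<le> card {..<H0} + card {h\<in>{H0..<n}. B h}" by (rule card_Un_le)
    finally have "real (card {h\<in>{..<n}. B h}) \<le> real H0 + c * W" using cB by simp
    also have "W \<le> (\<alpha> + 2) * real n powr (1 - e) * real n powr (- d3)
       + 4 * (1 + ln 4 + 2 * ln (real n)) * (real n powr (1 - e) * real n powr (- d2)) + 12
         * (real n powr (1 - e) * real n powr (- d2))"
    proof -
      have w1: "T * real X powr (- \<eta>) \<le> (\<alpha> + 2) * real n powr (1 - e) * real n powr (- d3)"
      proof -
        have "real X powr (- \<eta>) \<le> (real n powr \<kappa>) powr (- \<eta>)" using X pk \<eta> n by (intro powr_mono2') auto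
        also have "\<dots> = real n powr (- (\<eta> * \<kappa>))" by (simp add: powr_powr mult.commute)
        finally have "T * real X powr (- \<eta>) \<le> ((\<alpha> + 2) * real n powr 1) * real n powr (- (\<eta> * \<kappa>))"
          using T n by (intro mult_mono) auto
        also have "\<dots> = (\<alpha> + 2) * (real n powr 1 * real n powr (- (\<eta> * \<kappa>)))" by simp
        also have "real n powr 1 * real n powr (- (\<eta> * \<kappa>)) = real n powr (1 - e) * real n powr (- d3)"
          unfolding powr_add[symmetric] by (rule arg_cong2[of _ _ _ _ "(powr)"]) (auto simp: d3_def)
        finally show ?thesis by simp
      qed
      have xy: "real (X * Y) \<le> 4 * real n powr (1 + 2 * \<kappa>)"
      proof -
        have "real X * real Y \<le> (2 * real n powr \<kappa>) * (2 * real n powr (1 + \<kappa>))"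
          using X Y by (intro mult_mono) auto
        also have "\<dots> = 4 * (real n powr \<kappa> * real n powr (1 + \<kappa>))" by simp
        also have "real n powr \<kappa> * real n powr (1 + \<kappa>) = real n powr (1 + 2 * \<kappa>)"
          unfolding powr_add[symmetric] by (rule arg_cong2[of _ _ _ _ "(powr)"]) auto
        finally show ?thesis by simp
      qed
      have xy1: "real (X * Y) \<ge> 1" using X XY by (simp add: mult_ge1_I)
      have l: "ln (real n) \<ge> 0" using n by simp
      have w2: "(1 + ln (real (X * Y))) * real (X * Y) powr (1 - \<eta>)
         \<le> 4 * (1 + ln 4 + 2 * ln (real n)) * (real n powr (1 - e) * real n powr (- d2))"
      proof -
        have "ln (real (X * Y)) \<le> ln (4 * real n powr (1 + 2 * \<kappa>))"
          using xy xy1 n by (subst ln_le_cancel_iff) auto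
        also have "\<dots> = ln 4 + (1 + 2 * \<kappa>) * ln (real n)" using n by (simp add: ln_mult ln_powr)
        also have "\<dots> \<le> ln 4 + 2 * ln (real n)"
          using \<eta> l by (intro add_left_mono mult_right_mono) (auto simp: \<kappa>_def)
        finally have 1: "1 + ln (real (X * Y)) \<le> 1 + ln 4 + 2 * ln (real n)" by simp
        have "real (X * Y) powr (1 - \<eta>) \<le> (4 * real n powr (1 + 2 * \<kappa>)) powr (1 - \<eta>)"
          using xy \<eta> by (intro powr_mono2) auto
        also have "\<dots> = 4 powr (1 - \<eta>) * real n powr ((1 + 2 * \<kappa>) * (1 - \<eta>))"
          by (simp add: powr_mult powr_powr)
        also have "\<dots> \<le> 4 powr 1 * real n powr (1 - \<eta> / 2)"
        proof (intro mult_mono powr_mono)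
          show "(1 + 2 * \<kappa>) * (1 - \<eta>) \<le> 1 - \<eta> / 2" using \<eta> by (simp add: \<kappa>_def algebra_simps)
        qed (use \<eta> n in auto)
        also have "real n powr (1 - \<eta> / 2) = real n powr (1 - e) * real n powr (- d2)"
          unfolding powr_add[symmetric] by (rule arg_cong2[of _ _ _ _ "(powr)"]) (auto simp: d2_def)
        finally have 2: "real (X * Y) powr (1 - \<eta>) \<le> 4 * (real n powr (1 - e) * real n powr (- d2))" by simp
        have "(1 + ln (real (X * Y))) * real (X * Y) powr (1 - \<eta>)
          \<le> (1 + ln 4 + 2 * ln (real n)) * (4 * (real n powr (1 - e) * real n powr (- d2)))"
          using 1 2 l by (intro mult_mono) auto
        thus ?thesis by (simp only: mult_ac)
      qed
      have w3: "real X ^ 2 * real (Suc Y) powr (1 - 2 * \<eta>) \<le> 12 * (real n powr (1 - e) * real n powr (- d2))"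
      proof -
        have "real X ^ 2 \<le> (2 * real n powr \<kappa>) ^ 2" using X by (intro power_mono) auto
        also have "\<dots> = 4 * real n powr (2 * \<kappa>)" by (simp add: power2_eq_square powr_add[symmetric])
        finally have 1: "real X ^ 2 \<le> 4 * real n powr (2 * \<kappa>)" .
        have "real (Suc Y) powr (1 - 2 * \<eta>) \<le> (3 * real n powr (1 + \<kappa>)) powr (1 - 2 * \<eta>)"
          using Y(3) \<eta> by (intro powr_mono2) auto
        also have "\<dots> = 3 powr (1 - 2 * \<eta>) * real n powr ((1 + \<kappa>) * (1 - 2 * \<eta>))"
          by (simp add: powr_mult powr_powr)
        also have "\<dots> \<le> 3 powr 1 * real n powr ((1 + \<kappa>) * (1 - 2 * \<eta>))"
          using \<eta> by (intro mult_right_mono powr_mono) auto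
        finally have "real X ^ 2 * real (Suc Y) powr (1 - 2 * \<eta>)
          \<le> (4 * real n powr (2 * \<kappa>)) * (3 * real n powr ((1 + \<kappa>) * (1 - 2 * \<eta>)))"
          using 1 by (intro mult_mono) auto
        also have "\<dots> = 12 * (real n powr (2 * \<kappa>) * real n powr ((1 + \<kappa>) * (1 - 2 * \<eta>)))" by simp
        also have "real n powr (2 * \<kappa>) * real n powr ((1 + \<kappa>) * (1 - 2 * \<eta>)) \<le> real n powr (1 - \<eta> / 2)"
          unfolding powr_add[symmetric]
        proof (rule powr_mono)
          show "2 * \<kappa> + (1 + \<kappa>) * (1 - 2 * \<eta>) \<le> 1 - \<eta> / 2" using \<eta> by (simp add: \<kappa>_def algebra_simps)
        qed (use n in auto)
        also have "real n powr (1 - \<eta> / 2) = real n powr (1 - e) * real n powr (- d2)"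
          unfolding powr_add[symmetric] by (rule arg_cong2[of _ _ _ _ "(powr)"]) (auto simp: d2_def)
        finally show ?thesis by simp
      qed
      show ?thesis unfolding W_def using w1 w2 w3 by linarith
    qed
    also have "real H0 + c * \<dots> = real H0 + real n powr (1 - e) * (c * (\<alpha> + 2) * real n powr (- d3)
       + c * (4 * (1 + ln 4 + 2 * ln (real n))) * real n powr (- d2) + c * 12 * real n powr (- d2))"
      by (simp add: algebra_simps)
    also have "\<dots> \<le> 1 / 4 * real n powr (1 - e) + real n powr (1 - e) * (1 / 4 + 1 / 4 + 1 / 4)"
      using elim by (intro add_mono mult_left_mono) auto
    also have "\<dots> = real n powr (1 - e)" by simp
    finally show ?case using c unfolding B_def e_def by (simp add: mult_left_mono)
  qed
qed

section \<open>Computability of the constant\<close>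

text \<open>One program serves all pairs of oracles, as in \<open>computable_real2_on\<close>. The
  lemmas below are closure properties, so that a program for a given term is obtained by backward
  chaining over the term.\<close>

definition oracle_recursive :: "nat \<Rightarrow> ((nat \<Rightarrow> nat) \<Rightarrow> (nat \<Rightarrow> nat) \<Rightarrow> nat list \<Rightarrow> nat) \<Rightarrow> bool" where
  "oracle_recursive k f \<longleftrightarrow>
     (\<exists>p. \<forall>\<phi> \<psi> xs. length xs = k \<longrightarrow> rec_eval [\<phi>, \<psi>] p xs (f \<phi> \<psi> xs))"

lemma oracle_recursive_nth: "i < k \<Longrightarrow> oracle_recursive k (\<lambda>\<phi> \<psi> xs. xs ! i)"
  unfolding oracle_recursive_def by (intro exI[of _ "Proj i"] allI impI rec_proj) simp

lemma oracle_recursive_comp1: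
  assumes "oracle_recursive 1 (\<lambda>\<phi> \<psi> xs. g \<phi> \<psi> (xs ! 0))" "oracle_recursive k f"
  shows "oracle_recursive k (\<lambda>\<phi> \<psi> xs. g \<phi> \<psi> (f \<phi> \<psi> xs))"
proof -
  from assms obtain p q where
    p: "\<And>\<phi> \<psi> xs. length xs = 1 \<Longrightarrow> rec_eval [\<phi>, \<psi>] p xs (g \<phi> \<psi> (xs ! 0))" and
    q: "\<And>\<phi> \<psi> xs. length xs = k \<Longrightarrow> rec_eval [\<phi>, \<psi>] q xs (f \<phi> \<psi> xs)"
    unfolding oracle_recursive_def by blast
  have "rec_eval [\<phi>, \<psi>] (Comp p [q]) xs (g \<phi> \<psi> (f \<phi> \<psi> xs))" if "length xs = k" for \<phi> \<psi> xs
    by (rule rec_comp[where ys = "[f \<phi> \<psi> xs]"]) (use q[OF that] p[of "[f \<phi> \<psi> xs]"] in auto)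
  thus ?thesis unfolding oracle_recursive_def by blast
qed

lemma oracle_recursive_comp2:
  assumes "oracle_recursive 2 (\<lambda>\<phi> \<psi> xs. g \<phi> \<psi> (xs ! 0) (xs ! 1))"
    "oracle_recursive k f" "oracle_recursive k f'"
  shows "oracle_recursive k (\<lambda>\<phi> \<psi> xs. g \<phi> \<psi> (f \<phi> \<psi> xs) (f' \<phi> \<psi> xs))"
proof -
  from assms obtain p q q' where
    p: "\<And>\<phi> \<psi> xs. length xs = 2 \<Longrightarrow> rec_eval [\<phi>, \<psi>] p xs (g \<phi> \<psi> (xs ! 0) (xs ! 1))" and
    q: "\<And>\<phi> \<psi> xs. length xs = k \<Longrightarrow> rec_eval [\<phi>, \<psi>] q xs (f \<phi> \<psi> xs)"
       "\<And>\<phi> \<psi> xs. length xs = k \<Longrightarrow> rec_eval [\<phi>, \<psi>] q' xs (f' \<phi> \<psi> xs)"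
    unfolding oracle_recursive_def by blast
  have "rec_eval [\<phi>, \<psi>] (Comp p [q, q']) xs (g \<phi> \<psi> (f \<phi> \<psi> xs) (f' \<phi> \<psi> xs))"
    if "length xs = k" for \<phi> \<psi> xs
    by (rule rec_comp[where ys = "[f \<phi> \<psi> xs, f' \<phi> \<psi> xs]"])
       (use q[OF that] p[of "[f \<phi> \<psi> xs, f' \<phi> \<psi> xs]"] in auto)
  thus ?thesis unfolding oracle_recursive_def by blast
qed

text \<open>The arity 3 arises because the step program of \<open>PrimRec\<close> receives the
  counter, the previous value and the parameter; covered are the steps that are functions
  \<open>s\<close> of the counter and the previous value.\<close>

lemma oracle_recursive_primrec:
  assumes "oracle_recursive 1 (\<lambda>\<phi> \<psi> xs. b (xs ! 0))"
    "oracle_recursive 3 (\<lambda>\<phi> \<psi> xs. s (xs ! 0) (xs ! 1))"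
  shows "oracle_recursive 2 (\<lambda>\<phi> \<psi> xs. rec_nat (b (xs ! 1)) s (xs ! 0))"
proof -
  from assms obtain p q where
    p: "\<And>\<phi> \<psi> xs. length xs = 1 \<Longrightarrow> rec_eval [\<phi>, \<psi>] p xs (b (xs ! 0))" and
    q: "\<And>\<phi> \<psi> xs. length xs = 3 \<Longrightarrow> rec_eval [\<phi>, \<psi>] q xs (s (xs ! 0) (xs ! 1))"
    unfolding oracle_recursive_def by blast
  have ev: "rec_eval [\<phi>, \<psi>] (PrimRec p q) [n, y] (rec_nat (b y) s n)" for \<phi> \<psi> n y
  proof (induction n)
    case 0
    show ?case using p[of "[y]"] by (auto intro: rec_prim_0)
  next
    case (Suc n)
    show ?case
      by (rule rec_prim_Suc[OF Suc.IH]) (use q[of "[n, rec_nat (b y) s n, y]"] in simp)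
  qed
  have "rec_eval [\<phi>, \<psi>] (PrimRec p q) xs (rec_nat (b (xs ! 1)) s (xs ! 0))" if "length xs = 2" for \<phi> \<psi> xs
  proof -
    obtain n y where "xs = [n, y]" using \<open>length xs = 2\<close>
      by (metis (no_types) One_nat_def Suc_1 length_0_conv length_Suc_conv)
    thus ?thesis using ev by simp
  qed
  thus ?thesis unfolding oracle_recursive_def by blast
qed

lemma oracle_recursive_Suc:
  assumes "oracle_recursive k f"
  shows "oracle_recursive k (\<lambda>\<phi> \<psi> xs. Suc (f \<phi> \<psi> xs))"
proof (rule oracle_recursive_comp1[of "\<lambda>\<phi> \<psi>. Suc", OF _ assms])
  have "rec_eval [\<phi>, \<psi>] Succ xs (Suc (xs ! 0))" if "length xs = 1" for \<phi> \<psi> xs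
    using that by (cases xs) (auto intro: rec_succ)
  thus "oracle_recursive 1 (\<lambda>\<phi> \<psi> xs. Suc (xs ! 0))" unfolding oracle_recursive_def by blast
qed

lemma oracle_recursive_oracle1:
  assumes "oracle_recursive k f"
  shows "oracle_recursive k (\<lambda>\<phi> \<psi> xs. \<phi> (f \<phi> \<psi> xs))"
proof (rule oracle_recursive_comp1[of "\<lambda>\<phi> \<psi>. \<phi>", OF _ assms])
  have "rec_eval [\<phi>, \<psi>] (Orac 0) xs (\<phi> (xs ! 0))" if "length xs = 1" for \<phi> \<psi> xs
    using that rec_orac[of 0 "[\<phi>, \<psi>]"] by (cases xs) auto
  thus "oracle_recursive 1 (\<lambda>\<phi> \<psi> xs. \<phi> (xs ! 0))" unfolding oracle_recursive_def by blast
qed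

lemma oracle_recursive_oracle2:
  assumes "oracle_recursive k f"
  shows "oracle_recursive k (\<lambda>\<phi> \<psi> xs. \<psi> (f \<phi> \<psi> xs))"
proof (rule oracle_recursive_comp1[of "\<lambda>\<phi> \<psi>. \<psi>", OF _ assms])
  have "rec_eval [\<phi>, \<psi>] (Orac 1) xs (\<psi> (xs ! 0))" if "length xs = 1" for \<phi> \<psi> xs
    using that rec_orac[of 1 "[\<phi>, \<psi>]"] by (cases xs) auto
  thus "oracle_recursive 1 (\<lambda>\<phi> \<psi> xs. \<psi> (xs ! 0))" unfolding oracle_recursive_def by blast
qed

lemma oracle_recursive_const: "oracle_recursive k (\<lambda>\<phi> \<psi> xs. c)"
proof (induction c)
  case 0
  show ?case unfolding oracle_recursive_def by (blast intro: rec_zero)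
next
  case (Suc c)
  thus ?case by (rule oracle_recursive_Suc)
qed

lemmas oracle_recursive_basic = oracle_recursive_nth oracle_recursive_Suc oracle_recursive_oracle1
  oracle_recursive_oracle2 oracle_recursive_const

lemma oracle_recursive_iter2:
  assumes "oracle_recursive 1 (\<lambda>\<phi> \<psi> xs. b (xs ! 0))"
    "oracle_recursive 3 (\<lambda>\<phi> \<psi> xs. s (xs ! 0) (xs ! 1))"
    "\<And>n y. h n y = rec_nat (b y) s n"
    "oracle_recursive k f" "oracle_recursive k g"
  shows "oracle_recursive k (\<lambda>\<phi> \<psi> xs. h (f \<phi> \<psi> xs) (g \<phi> \<psi> xs))"
proof -
  have "h = (\<lambda>n y. rec_nat (b y) s n)" using assms(3) by blast
  thus ?thesis
    using oracle_recursive_comp2[OF oracle_recursive_primrec[OF assms(1,2)] assms(4,5)] by simp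
qed

lemma oracle_recursive_iter1:
  assumes "oracle_recursive 3 (\<lambda>\<phi> \<psi> xs. s (xs ! 0) (xs ! 1))" "\<And>n. h n = rec_nat b s n"
    "oracle_recursive k f"
  shows "oracle_recursive k (\<lambda>\<phi> \<psi> xs. h (f \<phi> \<psi> xs))"
  by (rule oracle_recursive_iter2[of "\<lambda>_. b" s "\<lambda>n _. h n", OF oracle_recursive_const assms(1) assms(2)
    assms(3)
      assms(3)])

lemma oracle_recursive_add:
  assumes "oracle_recursive k f" "oracle_recursive k g"
  shows "oracle_recursive k (\<lambda>\<phi> \<psi> xs. f \<phi> \<psi> xs + g \<phi> \<psi> xs)"
proof (rule oracle_recursive_iter2[of "\<lambda>y. y" "\<lambda>n. Suc" "(+)", OF _ _ _ assms])
  show "n + y = rec_nat y (\<lambda>n. Suc) n" for n y :: nat by (induction n) auto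
qed (rule oracle_recursive_basic | simp)+

text \<open>The step of the recursion adds the parameter \<open>y\<close> to the previous value and
  so has a form outside \<open>oracle_recursive_primrec\<close>; its program is evaluated
  directly.\<close>

lemma oracle_recursive_mult:
  "oracle_recursive k f \<Longrightarrow> oracle_recursive k g \<Longrightarrow> oracle_recursive k (\<lambda>\<phi> \<psi> xs. f \<phi> \<psi> xs * g \<phi> \<psi> xs)"
proof -
  have "oracle_recursive 2 (\<lambda>\<phi> \<psi> xs. (xs ! 0) * (xs ! 1))"
  proof -
    have 1: "oracle_recursive 1 (\<lambda>\<phi> \<psi> xs. 0)" by (rule oracle_recursive_const)
    obtain p where p: "\<And>\<phi> \<psi> xs. length xs = 3 \<Longrightarrow> rec_eval [\<phi>, \<psi>] p xs (xs ! 1 + xs ! 2)"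
      using oracle_recursive_add[OF oracle_recursive_nth[of 1 3] oracle_recursive_nth[of 2 3]]
      unfolding oracle_recursive_def by auto
    have ev: "rec_eval [\<phi>, \<psi>] (PrimRec Zero p) [n, y] (n * y)" for \<phi> \<psi> n y
    proof (induction n)
      case 0
      show ?case by (auto intro: rec_prim_0 rec_zero)
    next
      case (Suc n)
      show ?case by (rule rec_prim_Suc[OF Suc.IH]) (use p[of "[n, n * y, y]"] in \<open>simp add: add.commute\<close>)
    qed
    have "rec_eval [\<phi>, \<psi>] (PrimRec Zero p) xs (xs ! 0 * xs ! 1)" if "length xs = 2" for \<phi> \<psi> xs
    proof -
      obtain n y where "xs = [n, y]" using \<open>length xs = 2\<close>
        by (metis (no_types) One_nat_def Suc_1 length_0_conv length_Suc_conv)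
      thus ?thesis using ev by simp
    qed
    thus ?thesis unfolding oracle_recursive_def by blast
  qed
  from oracle_recursive_comp2[OF this]
  show "oracle_recursive k f \<Longrightarrow> oracle_recursive k g \<Longrightarrow> oracle_recursive k (\<lambda>\<phi> \<psi> xs. f \<phi> \<psi> xs * g \<phi> \<psi> xs)"
    by blast
qed

lemma oracle_recursive_pred:
  assumes "oracle_recursive k f"
  shows "oracle_recursive k (\<lambda>\<phi> \<psi> xs. f \<phi> \<psi> xs - 1)"
proof (rule oracle_recursive_iter1[of "\<lambda>n a. n" "\<lambda>n. n - 1" 0, OF _ _ assms])
  show "n - 1 = rec_nat 0 (\<lambda>n a. n) n" for n :: nat by (cases n) auto
qed (rule oracle_recursive_basic | simp)+

lemma oracle_recursive_diff:
  assumes "oracle_recursive k f" "oracle_recursive k g"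
  shows "oracle_recursive k (\<lambda>\<phi> \<psi> xs. f \<phi> \<psi> xs - g \<phi> \<psi> xs)"
proof (rule oracle_recursive_iter2[of "\<lambda>y. y" "\<lambda>n a. a - 1" "\<lambda>x y. y - x", OF _ _ _ assms(2,1)])
  show "y - n = rec_nat y (\<lambda>n a. a - 1) n" for n y :: nat by (induction n) auto
qed (rule oracle_recursive_pred oracle_recursive_basic | simp)+

lemma oracle_recursive_pow2:
  assumes "oracle_recursive k f"
  shows "oracle_recursive k (\<lambda>\<phi> \<psi> xs. 2 ^ f \<phi> \<psi> xs)"
proof (rule oracle_recursive_iter1[of "\<lambda>n a. a + a" "\<lambda>n. 2 ^ n" 1, OF _ _ assms])
  show "2 ^ n = rec_nat 1 (\<lambda>n a. a + a :: nat) n" for n :: nat by (induction n) auto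
qed (rule oracle_recursive_add oracle_recursive_basic | simp)+

lemma oracle_recursive_mod2:
  assumes "oracle_recursive k f"
  shows "oracle_recursive k (\<lambda>\<phi> \<psi> xs. f \<phi> \<psi> xs mod 2)"
proof (rule oracle_recursive_iter1[of "\<lambda>n a. 1 - a" "\<lambda>n. n mod 2" 0, OF _ _ assms])
  show "n mod 2 = rec_nat 0 (\<lambda>n a. 1 - a) n" for n :: nat by (induction n) (auto simp: mod_Suc)
qed (rule oracle_recursive_diff oracle_recursive_basic | simp)+

text \<open>Halving is a recursion that adds up parities, as
  \<open>Suc n div 2 = n div 2 + n mod 2\<close>.\<close>

lemma oracle_recursive_div2:
  assumes "oracle_recursive k f"
  shows "oracle_recursive k (\<lambda>\<phi> \<psi> xs. f \<phi> \<psi> xs div 2)"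
proof (rule oracle_recursive_iter1[of "\<lambda>n a. a + n mod 2" "\<lambda>n. n div 2" 0, OF _ _ assms])
  have "Suc n div 2 = n div 2 + n mod 2" for n :: nat by presburger
  thus "n div 2 = rec_nat 0 (\<lambda>n a. a + n mod 2) n" for n :: nat by (induction n) auto
qed (rule oracle_recursive_add oracle_recursive_mod2 oracle_recursive_basic | simp)+

lemma oracle_recursive_div_pow2:
  assumes "oracle_recursive k f" "oracle_recursive k g"
  shows "oracle_recursive k (\<lambda>\<phi> \<psi> xs. f \<phi> \<psi> xs div 2 ^ g \<phi> \<psi> xs)"
proof (rule oracle_recursive_iter2[of "\<lambda>y. y" "\<lambda>n a. a div 2" "\<lambda>x y. y div 2 ^ x", OF _ _ _ assms(2,1)])
  show "y div 2 ^ n = rec_nat y (\<lambda>n a. a div 2) n" for n y :: nat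
  proof (induction n)
    case (Suc n)
    have "y div 2 ^ Suc n = y div 2 ^ n div 2" by (simp only: power_Suc2 div_mult2_eq)
    thus ?case using Suc.IH by (simp del: power_Suc)
  qed simp
qed (rule oracle_recursive_div2 oracle_recursive_basic | simp)+

section \<open>Approximating the constant from names of \<open>\<sigma>\<close> and
  \<open>\<theta>\<close>\<close>

text \<open>Even codes stand for the nonnegative integers and odd codes for the negative ones, which
  are clipped to 0. In this form the clipped numerator is visibly recursive.\<close>

lemma nat_int_decode: "nat (int_decode a) = (a div 2) * (1 - a mod 2)"
  by (cases "even a") (auto simp: int_decode_def sum_decode_def odd_iff_mod_2_eq_one)

text \<open>Replacing a negative approximation by 0 can only bring it closer to a nonnegative
  number, so natural numbers suffice for the arithmetic.\<close>

lemma real_name_clip: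
  assumes "real_name \<phi> x" "x \<ge> 0"
  shows "\<bar>real (nat (int_decode (\<phi> n))) / 2 ^ n - x\<bar> \<le> 1 / 2 ^ n"
proof -
  have "\<bar>of_int (int_decode (\<phi> n)) / 2 ^ n - x\<bar> \<le> 1 / 2 ^ n" using assms by (simp add: real_name_def)
  moreover have "of_int (int_decode (\<phi> n)) / 2 ^ n \<le> (0::real)" if "int_decode (\<phi> n) \<le> 0"
    using that by (simp add: divide_nonpos_pos)
  ultimately show ?thesis using assms(2) by (cases "int_decode (\<phi> n) \<ge> 0") auto
qed

text \<open>The factors \<open>2 * \<sigma> - 1\<close> and \<open>1 - \<theta>\<close> are known up
  to \<open>2 * e\<close> and \<open>e\<close>, where \<open>e = 1 / 2 ^ n\<close>, so the product
  has an error of at most \<open>9 * e\<close>. Division by \<open>2 ^ k\<close> with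
  \<open>k \<ge> 5\<close> reduces this below \<open>e / 2\<close>, and rounding to the nearest
  multiple of \<open>e\<close> costs another \<open>e / 2\<close>. It is therefore enough to query
  both names at the precision \<open>n\<close> of the output.\<close>

lemma computable_weight:
  assumes "k \<ge> 5"
  shows "computable_real2_on ({1/2<..<1} \<times> {0<..<1}) (\<lambda>\<sigma> \<theta>. (2 * \<sigma> - 1)\<^sup>2 * (1 - \<theta>) / 2 ^ k)"
proof -
  define A where "A = (\<lambda>\<phi> (n::nat). nat (int_decode (\<phi> n)))"
  define U where "U = (\<lambda>\<phi> (n::nat). 2 * A \<phi> n - 2 ^ n)"
  define V where "V = (\<lambda>\<psi> (n::nat). 2 ^ n - A \<psi> n)"
  \<comment> \<open>The product has the denominator \<open>2 ^ (3 * n)\<close> and the output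
    \<open>2 ^ n\<close>, hence a division by \<open>2 ^ (n + n + k)\<close>; the added half of the
    divisor rounds to the nearest integer. The name itself is \<open>2 * r\<close>, the code of the
    nonnegative integer \<open>r\<close>.\<close>
  define r where "r = (\<lambda>\<phi> \<psi> (n::nat). (U \<phi> n * U \<phi> n * V \<psi> n + 2 ^ (n + n + (k - 1))) div 2 ^ (n + n + k))"
  have "oracle_recursive 1 (\<lambda>\<phi> \<psi> xs. 2 * r \<phi> \<psi> (xs ! 0))"
    unfolding r_def U_def V_def A_def nat_int_decode
    by (intro oracle_recursive_mult oracle_recursive_div_pow2 oracle_recursive_add oracle_recursive_diff
      oracle_recursive_pow2 oracle_recursive_div2 oracle_recursive_mod2 oracle_recursive_basic) simp_all
  then obtain p where p: "\<And>\<phi> \<psi> xs. length xs = 1 \<Longrightarrow> rec_eval [\<phi>, \<psi>] p xs (2 * r \<phi> \<psi> (xs ! 0))"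
    unfolding oracle_recursive_def by blast
  have nm: "real_name (\<lambda>n. 2 * r \<phi> \<psi> n) ((2 * \<sigma> - 1)\<^sup>2 * (1 - \<theta>) / 2 ^ k)"
    if st: "1/2 < \<sigma>" "\<sigma> < 1" "0 < \<theta>" "\<theta> < 1" "real_name \<phi> \<sigma>" "real_name \<psi> \<theta>" for \<sigma> \<theta> \<phi> \<psi>
    unfolding real_name_def
  proof
    fix n
    define e :: real where "e = 1 / 2 ^ n"
    have e: "0 < e" "e \<le> 1" by (auto simp: e_def)
    define a where "a = real (A \<phi> n) / 2 ^ n"
    define b where "b = real (A \<psi> n) / 2 ^ n"
    define u where "u = real (U \<phi> n) / 2 ^ n"
    define v where "v = real (V \<psi> n) / 2 ^ n"
    have a: "\<bar>a - \<sigma>\<bar> \<le> e" and b: "\<bar>b - \<theta>\<bar> \<le> e"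
      unfolding a_def b_def A_def e_def using real_name_clip st by auto
    have "real (U \<phi> n) = max 0 (2 * real (A \<phi> n) - 2 ^ n)"
      unfolding U_def by (simp add: of_nat_diff_real max_def)
    hence u': "u = max 0 (2 * a - 1)" unfolding u_def a_def by (simp add: max_def field_simps)
    have "real (V \<psi> n) = max 0 (2 ^ n - real (A \<psi> n))"
      unfolding V_def by (simp add: of_nat_diff_real max_def)
    hence v': "v = max 0 (1 - b)" unfolding v_def b_def by (simp add: max_def field_simps)
    have b0: "b \<ge> 0" unfolding b_def by simp
    have u: "0 \<le> u" "u \<le> 3" "\<bar>u - (2 * \<sigma> - 1)\<bar> \<le> 2 * e" using u' a st e by (auto simp: max_def)
    have v: "0 \<le> v" "v \<le> 1" "\<bar>v - (1 - \<theta>)\<bar> \<le> e" using v' b b0 st e by (auto simp: max_def)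
    define u0 where "u0 = 2 * \<sigma> - 1"
    define v0 where "v0 = 1 - \<theta>"
    have uv0: "0 \<le> u0" "u0 \<le> 1" "0 \<le> v0" "v0 \<le> 1" using st by (auto simp: u0_def v0_def)
    have "\<bar>u * u * v - u0\<^sup>2 * v0\<bar> = \<bar>((u - u0) * ((u + u0) * v) + u0 * u0 * (v - v0))\<bar>"
      by (simp add: algebra_simps power2_eq_square)
    also have "\<dots> \<le> \<bar>u - u0\<bar> * ((u + u0) * v) + u0 * u0 * \<bar>v - v0\<bar>"
      using u v uv0 by (intro order.trans[OF abs_triangle_ineq]) (auto simp: abs_mult)
    also have "\<dots> \<le> (2 * e) * (4 * 1) + 1 * 1 * e"
      using u v uv0 e unfolding u0_def[symmetric] v0_def[symmetric]
      by (intro add_mono mult_mono mult_nonneg_nonneg add_nonneg_nonneg) auto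
    finally have "\<bar>u * u * v - u0\<^sup>2 * v0\<bar> \<le> 9 * e" by simp
    hence "\<bar>u * u * v - u0\<^sup>2 * v0\<bar> / 2 ^ k \<le> 9 * e / 2 ^ k" by (intro divide_right_mono) auto
    also have "\<dots> \<le> 9 * e / 2 ^ 5" using assms e by (intro divide_left_mono power_increasing) auto
    finally have 1: "\<bar>u * u * v / 2 ^ k - u0\<^sup>2 * v0 / 2 ^ k\<bar> \<le> 9 / 32 * e"
      by (simp add: diff_divide_distrib[symmetric])
    show "\<bar>of_int (int_decode (2 * r \<phi> \<psi> n)) / 2 ^ n - (2 * \<sigma> - 1)\<^sup>2 * (1 - \<theta>) / 2 ^ k\<bar> \<le> 1 / 2 ^ n"
    proof -
      define X where "X = U \<phi> n * U \<phi> n * V \<psi> n"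
      define h where "h = n + n + (k - 1)"
      have h: "n + n + k = Suc h" using assms by (simp add: h_def)
      have "r \<phi> \<psi> n * 2 ^ Suc h \<le> X + 2 ^ h" "X + 2 ^ h < (r \<phi> \<psi> n + 1) * 2 ^ Suc h"
        unfolding r_def X_def[symmetric] h h_def[symmetric]
        using dividend_less_div_times[of "2 ^ Suc h" "X + 2 ^ h"]
          by (simp_all del: power_Suc add: add.commute)
      hence "real (r \<phi> \<psi> n * 2 ^ Suc h) \<le> real (X + 2 ^ h)"
        "real (X + 2 ^ h) < real ((r \<phi> \<psi> n + 1) * 2 ^ Suc h)"
          by (simp_all only: of_nat_le_iff of_nat_less_iff)
      hence "\<bar>real (r \<phi> \<psi> n) - real X / 2 ^ Suc h\<bar> \<le> 1 / 2" by (simp add: abs_le_iff field_simps)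
      also have "real X / 2 ^ Suc h = u * u * v / 2 ^ k * 2 ^ n"
        unfolding X_def h[symmetric] u_def v_def by (simp add: power_add)
      finally have "\<bar>real (r \<phi> \<psi> n) - u * u * v / 2 ^ k * 2 ^ n\<bar> * e \<le> 1 / 2 * e"
        using e by (intro mult_right_mono) auto
      hence "\<bar>(real (r \<phi> \<psi> n) - u * u * v / 2 ^ k * 2 ^ n) * e\<bar> \<le> 1 / 2 * e"
        using e by (simp add: abs_mult)
      moreover have "(real (r \<phi> \<psi> n) - u * u * v / 2 ^ k * 2 ^ n) * e
        = real (r \<phi> \<psi> n) / 2 ^ n - u * u * v / 2 ^ k"
        by (simp add: e_def field_simps)
      moreover have "int_decode (2 * r \<phi> \<psi> n) = int (r \<phi> \<psi> n)"
        by (simp add: int_decode_def sum_decode_def)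
      ultimately have "\<bar>of_int (int_decode (2 * r \<phi> \<psi> n)) / 2 ^ n - u * u * v / 2 ^ k\<bar> \<le> 1 / 2 * e" by simp
      with 1 e show ?thesis unfolding u0_def v0_def e_def[symmetric] by linarith
    qed
  qed
  show ?thesis unfolding computable_real2_on_def
  proof (intro exI[of _ p] ballI, safe)
    fix \<sigma> \<theta> :: real and \<phi> \<psi>
    assume "\<sigma> \<in> {1/2<..<1}" "\<theta> \<in> {0<..<1}" "real_name \<phi> \<sigma>" "real_name \<psi> \<theta>"
    thus "\<exists>\<rho>. real_name \<rho> ((2 * \<sigma> - 1)\<^sup>2 * (1 - \<theta>) / 2 ^ k) \<and> (\<forall>n. rec_eval [\<phi>, \<psi>] p [n] (\<rho> n))"
      using nm p[of "[_]"] by (intro exI[of _ "\<lambda>n. 2 * r \<phi> \<psi> n"]) auto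
  qed
qed

section \<open>Extreme values of the logarithmic derivative\<close>

text \<open>\<open>many_large_mangoldt\<close> is applied at \<open>y\<close> about
  \<open>24 * m * ln m\<close>; since \<open>ln y \<le> 2 * ln m\<close>, it provides at least
  \<open>m\<close> numbers. Exactly \<open>m\<close> of them are taken, because the pigeonhole
  principle costs a factor \<open>6 ^ card Q\<close>.\<close>

lemma exists_large_mangoldt_set:
  "\<forall>\<^sub>F m :: nat in sequentially. \<exists>Q. finite Q \<and> card Q = m \<and>
     (\<forall>n\<in>Q. 0 < n \<and> real n \<le> 25 * real m * ln (real m) \<and> ln (real m) / 2 \<le> mangoldt n)"
proof -
  define y where "y = (\<lambda>m::nat. nat \<lceil>24 * real m * ln (real m)\<rceil>)"
  have e3: "\<forall>\<^sub>F m :: nat in sequentially. real m \<le> 24 * real m * ln (real m)" by real_asymp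
  hence ym: "\<forall>\<^sub>F m in sequentially. m \<le> y m" by eventually_elim (simp add: y_def, linarith)
  have "filterlim y sequentially sequentially"
    by (rule filterlim_at_top_mono[OF filterlim_ident ym])
  from filterlim_iff[THEN iffD1, OF this, rule_format, OF many_large_mangoldt]
  have e0: "\<forall>\<^sub>F m in sequentially. real (y m) / (12 * ln (real (y m)))
     \<le> real (card {n\<in>{1..y m}. mangoldt n \<ge> ln (real (y m)) / 2})" .
  have e1: "\<forall>\<^sub>F m :: nat in sequentially. ln (25 * real m * ln (real m)) \<le> 2 * ln (real m)" by real_asymp
  have e2: "\<forall>\<^sub>F m :: nat in sequentially. 24 * real m * ln (real m) + 1 \<le> 25 * real m * ln (real m)"
    by real_asymp
  from e0 e1 e2 ym eventually_ge_at_top[of 2] show ?thesis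
  proof eventually_elim
    case (elim m)
    define G where "G = {n\<in>{1..y m}. mangoldt n \<ge> ln (real (y m)) / 2}"
    have lm: "ln (real m) > 0" using elim by simp
    have y1: "24 * real m * ln (real m) \<le> real (y m)" unfolding y_def by linarith
    have y2: "real (y m) \<le> 25 * real m * ln (real m)"
    proof -
      have "0 \<le> 24 * real m * ln (real m)" using lm by simp
      hence "real (y m) \<le> 24 * real m * ln (real m) + 1" unfolding y_def by linarith
      thus ?thesis using elim by linarith
    qed
    have my: "real m \<le> real (y m)" using elim by simp
    have ly: "0 < ln (real (y m))" "ln (real m) \<le> ln (real (y m))" "ln (real (y m)) \<le> 2 * ln (real m)"
    proof -
      show a: "ln (real m) \<le> ln (real (y m))" using elim my by (subst ln_le_cancel_iff) auto
      thus "0 < ln (real (y m))" using lm by linarith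
      have "ln (real (y m)) \<le> ln (25 * real m * ln (real m))"
        using elim my y2 by (subst ln_le_cancel_iff) auto
      thus "ln (real (y m)) \<le> 2 * ln (real m)" using elim by linarith
    qed
    have "real m * (12 * ln (real (y m))) \<le> real m * (12 * (2 * ln (real m)))"
      using ly by (intro mult_left_mono) auto
    also have "\<dots> \<le> real (y m)" using y1 by simp
    finally have "real m \<le> real (y m) / (12 * ln (real (y m)))" using ly by (simp add: pos_le_divide_eq)
    also have "\<dots> \<le> real (card G)" using elim unfolding G_def by simp
    finally have "m \<le> card G" by simp
    then obtain Q where Q: "Q \<subseteq> G" "card Q = m" "finite Q" by (rule obtain_subset_with_card_n)
    have "0 < n \<and> real n \<le> 25 * real m * ln (real m) \<and> ln (real m) / 2 \<le> mangoldt n" if "n \<in> Q" for n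
    proof -
      have n: "1 \<le> n" "n \<le> y m" "mangoldt n \<ge> ln (real (y m)) / 2" using that Q by (auto simp: G_def)
      have "real n \<le> real (y m)" using n by simp
      thus ?thesis using n y2 ly by auto
    qed
    thus ?case using Q by blast
  qed
qed

text \<open>The choice of parameters. With \<open>l = ln N\<close>, the set \<open>Q\<close> has
  about \<open>\<epsilon> * l\<close> elements of size at most
  \<open>25 * \<epsilon> * l * ln l\<close>, each with a coefficient of order \<open>ln l\<close>
  times the power \<open>- \<sigma>\<close> of that size, so the coefficients on \<open>Q\<close>
  sum to a multiple of \<open>(l * ln l) powr (1 - \<sigma>)\<close>.\<close>

lemma exists_large_log_deriv:
  fixes \<sigma> \<theta> \<alpha> :: real
  assumes \<sigma>: "1 / 2 < \<sigma>" "\<sigma> < 1" and \<theta>: "0 < \<theta>" "\<theta> < 1" and \<alpha>: "0 < \<alpha>"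
  shows "\<forall>\<^sub>F N :: real in at_top. \<exists>h :: nat. N powr \<theta> \<le> real h \<and> real h \<le> N \<and>
    (2 * \<sigma> - 1)\<^sup>2 * (1 - \<theta>) / 2 ^ 23 * ln N powr (1 - \<sigma>) * ln (ln N) powr (1 - \<sigma>)
      \<le> - Re (deriv zeta (of_real \<sigma> + \<i> * of_real (\<alpha> * real h)) / zeta (of_real \<sigma> + \<i> * of_real (\<alpha>
        * real h)))"
proof -
  define w where "w = (2 * \<sigma> - 1)\<^sup>2 * (1 - \<theta>)"
  \<comment> \<open>This means \<open>2 - \<sigma> = 3 / 2 - 4 * \<eta>\<close>, so the disc of
    radius \<open>3 / 2 - 3 * \<eta>\<close> about \<open>2 + i t\<close> reaches beyond
    \<open>\<sigma> + i t\<close> by \<open>\<eta>\<close>.\<close>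
  define \<eta> where "\<eta> = (2 * \<sigma> - 1) / 8"
  \<comment> \<open>At most \<open>\<epsilon> * ln N\<close> frequencies cost a factor
    \<open>6 ^ card Q \<le> N powr (3 * \<epsilon>)\<close>. The denominator 2048 ensures
    \<open>3 * \<epsilon> < 1 - \<theta>\<close> and, as
    \<open>\<delta> = (2 * \<sigma> - 1)^2 / 512\<close>, also
    \<open>3 * \<epsilon> < \<delta>\<close>.\<close>
  define \<epsilon> where "\<epsilon> = w / 2048"
  define \<delta> where "\<delta> = \<eta>\<^sup>2 / 8"
  have \<eta>: "0 < \<eta>" "\<eta> < 1 / 4" using \<sigma> by (auto simp: \<eta>_def)
  have sq: "0 < (2 * \<sigma> - 1)\<^sup>2" "(2 * \<sigma> - 1)\<^sup>2 < 1"
    using \<sigma> by (auto simp: power_less_one_iff)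
  have w: "0 < w" "w \<le> (2 * \<sigma> - 1)\<^sup>2" "w \<le> 1 - \<theta>"
    using sq \<theta> unfolding w_def by (auto intro: mult_left_le mult_left_le_one_le)
  have \<epsilon>: "0 < \<epsilon>" "\<epsilon> < 1" using w \<theta> by (auto simp: \<epsilon>_def)
  \<comment> \<open>The margins that remain for the three summands \<open>N powr \<theta>\<close>, 1
    and \<open>N powr (1 - \<delta>)\<close> in the count of excluded shifts.\<close>
  define d1 where "d1 = 1 - \<theta> - 3 * \<epsilon>"
  define d2 where "d2 = 1 - 3 * \<epsilon>"
  define d3 where "d3 = \<delta> - 3 * \<epsilon>"
  have d: "d1 > 0" "d2 > 0" "d3 > 0"
  proof -
    show "d1 > 0" "d2 > 0" using w \<theta> by (auto simp: d1_def d2_def \<epsilon>_def)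
    have "\<delta> = (2 * \<sigma> - 1)\<^sup>2 / 512" by (simp add: \<delta>_def \<eta>_def power_divide)
    thus "d3 > 0" using w sq by (simp add: d3_def \<epsilon>_def)
  qed
  have "2 - \<sigma> < 3 / 2 - 3 * \<eta>" "3 / 2 - 3 * \<eta> \<le> 3 / 2" using \<sigma> by (auto simp: \<eta>_def field_simps)
  from log_deriv_taylor[OF \<sigma> this] obtain C0 q where C0: "C0 > 0" and q: "0 < q" "q < 1" and
    app: "\<And>t K. t \<ge> 3 \<Longrightarrow> \<forall>z\<in>ball (2 + \<i> * of_real t) (3 / 2 - 3 * \<eta>). zeta z \<noteq> 0 \<Longrightarrow>
    \<bar>- Re (deriv zeta (of_real \<sigma> + \<i> * of_real t) / zeta (of_real \<sigma> + \<i> * of_real t))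
      - (\<Sum>n. taylor_coeff \<sigma> K n * cos (t * ln (real n)))\<bar> \<le> C0 * ln t * q ^ K" by blast
  \<comment> \<open>The 9 makes \<open>K\<close> large enough for \<open>taylor_coeff_ge\<close>:
    for \<open>n \<le> l^2\<close> and \<open>ln l \<ge> 1\<close> one has
    \<open>4 * ln n + 1 \<le> 9 * ln l\<close>. The other entry gives
    \<open>q ^ K \<le> l powr (- 2)\<close>, which beats the factor \<open>ln t\<close> in the
    remainder.\<close>
  define B where "B = max 9 (2 / (- ln q))"
  have lq: "- ln q > 0" using q by simp
  have B: "B \<ge> 9" "B * (- ln q) \<ge> 2"
  proof -
    show "B \<ge> 9" by (simp add: B_def)
    have "2 / (- ln q) \<le> B" by (simp add: B_def)
    thus "B * (- ln q) \<ge> 2" using lq by (simp only: pos_divide_le_eq)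
  qed
  define S where "S = (\<Sum>n. mangoldt n * real n powr (- (3 / 2))) + 1"
  have "summable (\<lambda>n. \<bar>mangoldt n\<bar> * real n powr (- (3 / 2)))"
    using dconv_mangoldt unfolding dconv_def by simp
  hence S: "S > 0" unfolding S_def by (intro add_nonneg_pos suminf_nonneg) (auto simp: mangoldt_nonneg)
  define zd where "zd = (\<lambda>h::nat. \<exists>z\<in>ball (2 + \<i> * of_real (\<alpha> * real h)) (3 / 2 - 3 * \<eta>). zeta z = 0)"
  define m where "m = (\<lambda>N. nat \<lfloor>\<epsilon> * ln N\<rfloor>)"
  have fL: "filterlim (\<lambda>N::real. nat \<lfloor>N\<rfloor>) sequentially at_top"
    by (rule filterlim_compose[OF filterlim_nat_sequentially filterlim_floor_sequentially])
  have "filterlim (\<lambda>N::real. \<epsilon> * ln N) at_top at_top" using \<epsilon> by real_asymp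
  hence fm: "filterlim m sequentially at_top"
    unfolding m_def by (rule filterlim_compose[OF fL])
  have ev1: "\<forall>\<^sub>F N in at_top. \<exists>Q. finite Q \<and> card Q = m N \<and>
     (\<forall>n\<in>Q. 0 < n \<and> real n \<le> 25 * real (m N) * ln (real (m N)) \<and> ln (real (m N)) / 2 \<le> mangoldt n)"
    using filterlim_iff[THEN iffD1, OF fm, rule_format, OF exists_large_mangoldt_set] .
  have ev2: "\<forall>\<^sub>F N :: real in at_top. real (card {h\<in>{..<nat \<lfloor>N\<rfloor>}. zd h}) \<le> real (nat \<lfloor>N\<rfloor>) powr (1 - \<delta>)"
    using filterlim_iff[THEN iffD1, OF fL, rule_format, OF card_zero_discs_bound[OF \<eta> \<alpha>]]
    unfolding zd_def \<delta>_def .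
  have ev3: "\<forall>\<^sub>F N :: real in at_top. 2 \<le> \<epsilon> * ln N" using \<epsilon> by real_asymp
  have ev4: "\<forall>\<^sub>F N :: real in at_top. 25 * \<epsilon> * ln N * ln (ln N) \<le> (ln N)\<^sup>2" using \<epsilon> by real_asymp
  have ev5: "\<forall>\<^sub>F N :: real in at_top. 1 \<le> ln (ln N)" by real_asymp
  have ev6: "\<forall>\<^sub>F N :: real in at_top. sqrt (ln N) \<le> \<epsilon> * ln N / 2" using \<epsilon> by real_asymp
  have ev7: "\<forall>\<^sub>F N :: real in at_top. C0 * (ln \<alpha> + ln N) * ln N powr (- 2) \<le> 1" by real_asymp
  have ev8: "\<forall>\<^sub>F N :: real in at_top. 3200 / \<epsilon> \<le> ln N powr (1 - \<sigma>) * ln (ln N) powr (1 - \<sigma>)"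
  proof -
    have "1 - \<sigma> > 0" using \<sigma> by simp
    thus ?thesis by real_asymp
  qed
  have ev9: "\<forall>\<^sub>F N :: real in at_top. 32 * S * ln N powr (2 * B) * N powr (- d1) \<le> 1 / 8" using d
    by real_asymp
  have ev10: "\<forall>\<^sub>F N :: real in at_top. 32 * S * ln N powr (2 * B) * N powr (- d2) \<le> 1 / 8" using d
    by real_asymp
  have ev11: "\<forall>\<^sub>F N :: real in at_top. 32 * S * ln N powr (2 * B) * N powr (- d3) \<le> 1 / 8" using d
    by real_asymp
  have ev12: "\<forall>\<^sub>F N :: real in at_top. 3 / \<alpha> \<le> N powr \<theta>" using \<theta> by real_asymp
  from ev1 ev2 ev3 ev4 ev5 ev6 ev7 ev8 ev9 ev10 ev11 ev12 eventually_ge_at_top[of "2::real"] show ?thesis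
  proof eventually_elim
    case (elim N)
    define l where "l = ln N"
    define L where "L = nat \<lfloor>N\<rfloor>"
    define M where "M = real (m N)"
    define K where "K = nat \<lceil>B * ln l\<rceil>"
    define U where "U = l powr (1 - \<sigma>) * ln l powr (1 - \<sigma>)"
    have N: "N \<ge> 2" using elim by simp
    have ll: "ln l \<ge> 1" using elim by (simp add: l_def)
    have "2 \<le> \<epsilon> * l" using elim by (simp add: l_def)
    hence l0: "l > 0" using \<epsilon> by (smt (verit) mult_nonneg_nonpos)
    have ll0: "l * ln l > 0" using l0 ll by (intro mult_pos_pos) (simp, linarith)
    have l1: "l \<ge> 1" using ll l0 ln_le_minus_one[OF l0] by linarith
    have M: "\<epsilon> * l / 2 \<le> M" "M \<le> \<epsilon> * l" "M \<ge> 1"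
      using \<open>2 \<le> \<epsilon> * l\<close> unfolding M_def m_def l_def[symmetric] by linarith+
    have "\<epsilon> * l \<le> 1 * l" using \<epsilon> l0 by (intro mult_right_mono) auto
    hence Ml: "M \<le> l" using M(2) by linarith
    have lM: "ln l / 2 \<le> ln M" "ln M \<le> ln l"
    proof -
      have "sqrt l \<le> M" using elim M by (simp add: l_def)
      hence "ln (sqrt l) \<le> ln M" using l0 M by (subst ln_le_cancel_iff) auto
      thus "ln l / 2 \<le> ln M" using l0 by (simp add: ln_sqrt)
      show "ln M \<le> ln l" using Ml M l0 by (subst ln_le_cancel_iff) auto
    qed
    have lM0: "ln M > 0" using lM ll by linarith
    define y where "y = 25 * M * ln M"
    have y: "y \<le> 25 * \<epsilon> * (l * ln l)" "y > 0"
    proof -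
      have "M * ln M \<le> (\<epsilon> * l) * ln l" using M lM lM0 by (intro mult_mono) auto
      thus "y \<le> 25 * \<epsilon> * (l * ln l)" by (simp add: y_def)
      show "y > 0" using M lM0 by (simp add: y_def)
    qed
    have yl: "y \<le> l\<^sup>2" using y elim by (simp add: l_def mult_ac)
    obtain Q where Q: "finite Q" "card Q = m N"
      "\<And>n. n \<in> Q \<Longrightarrow> 0 < n" "\<And>n. n \<in> Q \<Longrightarrow> real n \<le> y" "\<And>n. n \<in> Q \<Longrightarrow> ln M / 2 \<le> mangoldt n"
      using elim(1) unfolding M_def y_def by blast
    have K: "B * ln l \<le> real K" "real K \<le> B * ln l + 1"
    proof -
      have "0 \<le> B * ln l" using B ll by simp
      thus "B * ln l \<le> real K" "real K \<le> B * ln l + 1" unfolding K_def by linarith+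
    qed
    define a where "a = taylor_coeff \<sigma> K"
    have a0: "a n \<ge> 0" for n unfolding a_def using \<sigma> by (intro taylor_coeff_nonneg) auto
    have sa: "summable a" "suminf a \<le> 4 ^ K * S"
    proof -
      show "summable a" unfolding a_def using \<sigma> by (intro summable_taylor_coeff) auto
      have "suminf a \<le> 4 ^ K * (\<Sum>n. mangoldt n * real n powr (- (3 / 2)))"
        unfolding a_def using \<sigma> by (intro summable_taylor_coeff) auto
      also have "\<dots> \<le> 4 ^ K * S" unfolding S_def by (rule mult_left_mono) (simp_all)
      finally show "suminf a \<le> 4 ^ K * S" .
    qed
    have sumQ: "\<epsilon> / 400 * U \<le> sum a Q"
    proof -
      have an: "ln M / 4 * y powr (- \<sigma>) \<le> a n" if n: "n \<in> Q" for n
      proof -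
        have n0: "n > 0" "real n \<le> y" "ln M / 2 \<le> mangoldt n" using Q n by auto
        have "ln (real n) \<le> ln (l\<^sup>2)" using n0 yl l0 by (subst ln_le_cancel_iff) auto
        also have "\<dots> = 2 * ln l" using l0 by (simp add: ln_realpow)
        finally have "4 * ln (real n) + 1 \<le> 9 * ln l" using ll by linarith
        also have "\<dots> \<le> B * ln l" using B ll by (intro mult_right_mono) auto
        also have "\<dots> \<le> real K" by (rule K)
        finally have "mangoldt n * real n powr (- \<sigma>) / 2 \<le> a n"
          unfolding a_def using \<sigma> n0 by (intro taylor_coeff_ge) auto
        moreover have "ln M / 2 * y powr (- \<sigma>) \<le> mangoldt n * real n powr (- \<sigma>)"
          using n0 \<sigma> lM0 by (intro mult_mono powr_mono2' mangoldt_nonneg) auto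
        ultimately show ?thesis by simp
      qed
      \<comment> \<open>Giving away the power of \<open>\<epsilon>\<close> here, as
        \<open>\<epsilon> < 1\<close> permits, keeps the final constant polynomial in
        \<open>\<sigma>\<close> and \<open>\<theta>\<close>.\<close>
      have "1 / 25 \<le> (25 * \<epsilon>) powr (- \<sigma>)"
      proof -
        have "25 powr (- 1) \<le> 25 powr (- \<sigma>)" using \<sigma> by (intro powr_mono) auto
        also have "\<dots> \<le> (25 * \<epsilon>) powr (- \<sigma>)" using \<sigma> \<epsilon> by (intro powr_mono2') auto
        finally show ?thesis by (simp add: powr_minus_divide)
      qed
      hence "\<epsilon> / 400 * U \<le> \<epsilon> / 16 * ((25 * \<epsilon>) powr (- \<sigma>) * U)"
        using \<epsilon> mult_right_mono[of "1 / 25" "(25 * \<epsilon>) powr (- \<sigma>)" "\<epsilon> * U"]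
        by (simp add: U_def algebra_simps)
      also have "(25 * \<epsilon>) powr (- \<sigma>) * U = l * ln l * (25 * \<epsilon> * (l * ln l)) powr (- \<sigma>)"
      proof -
        have "U = (l * ln l) powr (1 - \<sigma>)" using l0 ll by (simp add: U_def powr_mult)
        also have "\<dots> = l * ln l * (l * ln l) powr (- \<sigma>)"
          using ll0 powr_add[of "l * ln l" 1 "- \<sigma>"] by simp
        finally have "(25 * \<epsilon>) powr (- \<sigma>) * U = l * ln l * ((25 * \<epsilon>) powr (- \<sigma>) * (l * ln l) powr (- \<sigma>))"
          by (simp only: mult_ac)
        also have "(25 * \<epsilon>) powr (- \<sigma>) * (l * ln l) powr (- \<sigma>) = (25 * \<epsilon> * (l * ln l)) powr (- \<sigma>)"
          by (rule powr_mult[symmetric])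
        finally show ?thesis .
      qed
      also have "\<epsilon> / 16 * (l * ln l * (25 * \<epsilon> * (l * ln l)) powr (- \<sigma>))
         \<le> \<epsilon> / 16 * (l * ln l * y powr (- \<sigma>))"
        using y \<epsilon> less_imp_le[OF ll0] \<sigma> by (intro mult_left_mono powr_mono2') auto
      also have "\<dots> = (\<epsilon> * l / 2) * ((ln l / 2) / 4 * y powr (- \<sigma>))" by simp
      also have "\<dots> \<le> M * (ln M / 4 * y powr (- \<sigma>))"
        using M lM ll lM0 by (intro mult_mono mult_nonneg_nonneg) auto
      also have "\<dots> = (\<Sum>n\<in>Q. ln M / 4 * y powr (- \<sigma>))" using Q by (simp add: M_def)
      also have "\<dots> \<le> sum a Q" by (intro sum_mono an)
      finally show ?thesis .
    qed
    have U: "3200 / \<epsilon> \<le> U" using elim by (simp add: U_def l_def)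
    hence U': "3200 \<le> \<epsilon> * U" using \<epsilon> by (simp add: field_simps)
    hence A1: "1 \<le> sum a Q" using sumQ by simp
    have LN: "real L \<le> N" "N / 2 \<le> real L" using N unfolding L_def by linarith+
    \<comment> \<open>The condition on small \<open>h\<close> also removes the shift 0, at which
      every cosine is 1 and the sum is trivially large.\<close>
    define Bad where "Bad = {h\<in>{..<L}. real h < N powr \<theta> \<or> zd h}"
    have cBad: "real (card Bad) \<le> N powr \<theta> + 1 + N powr (1 - \<delta>)"
    proof -
      have "Bad \<subseteq> {..<nat \<lceil>N powr \<theta>\<rceil>} \<union> {h\<in>{..<L}. zd h}"
        unfolding Bad_def by (auto simp: zless_nat_eq_int_zless less_ceiling_iff)
      hence "card Bad \<le> card ({..<nat \<lceil>N powr \<theta>\<rceil>} \<union> {h\<in>{..<L}. zd h})" by (rule card_mono[rotated]) simp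
      also have "\<dots> \<le> card {..<nat \<lceil>N powr \<theta>\<rceil>} + card {h\<in>{..<L}. zd h}" by (rule card_Un_le)
      finally have "real (card Bad) \<le> real (nat \<lceil>N powr \<theta>\<rceil>) + real (card {h\<in>{..<L}. zd h})"
        unfolding of_nat_add[symmetric] of_nat_le_iff card_lessThan .
      moreover have "real (nat \<lceil>N powr \<theta>\<rceil>) \<le> N powr \<theta> + 1"
        using powr_ge_zero[of N \<theta>] by linarith
      moreover have "real (card {h\<in>{..<L}. zd h}) \<le> real L powr (1 - \<delta>)" using elim(2) by (simp add: L_def)
      moreover have "real L powr (1 - \<delta>) \<le> N powr (1 - \<delta>)"
      proof (rule powr_mono2)
        have "\<eta>\<^sup>2 \<le> 1" using \<eta> by (intro power_le_one) auto
        thus "0 \<le> 1 - \<delta>" by (simp add: \<delta>_def)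
      qed (use LN in auto)
      ultimately show ?thesis by linarith
    qed
    have six: "6 ^ card Q \<le> N powr (3 * \<epsilon>)"
    proof -
      have "(6::real) ^ card Q \<le> 8 ^ m N" unfolding Q(2) by (intro power_mono) auto
      also have "(8::real) ^ m N = 2 ^ (3 * m N)" by (simp add: power_mult)
      also have "\<dots> = 2 powr (3 * M)" by (simp add: M_def powr_realpow[symmetric])
      also have "\<dots> = exp (3 * M * ln 2)" by (simp add: powr_def)
      also have "\<dots> \<le> exp (3 * (\<epsilon> * l))"
      proof -
        have "M * ln 2 \<le> M * 1" using M ln_2_less_1 by (intro mult_left_mono) auto
        hence "M * ln 2 \<le> \<epsilon> * l" using M by linarith
        thus ?thesis by (simp add: mult.assoc)
      qed
      also have "\<dots> = N powr (3 * \<epsilon>)" using N by (simp add: powr_def l_def)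
      finally show ?thesis .
    qed
    have four: "4 ^ K \<le> 4 * l powr (2 * B)"
    proof -
      have "(4::real) ^ K = 4 powr real K" by (simp add: powr_realpow)
      also have "\<dots> \<le> 4 powr (B * ln l + 1)" using K by (intro powr_mono) auto
      also have "\<dots> = 4 powr (B * ln l) * 4 powr 1" by (rule powr_add)
      also have "\<dots> = 4 * exp (B * ln l * ln 4)" by (simp add: powr_def)
      also have "ln 4 = 2 * ln (2::real)" using ln_realpow[of 2 2] by simp
      also have "4 * exp (B * ln l * (2 * ln 2)) \<le> 4 * exp (B * ln l * (2 * 1))"
        using B ll ln_2_less_1 by (intro mult_left_mono) auto
      also have "\<dots> = 4 * l powr (2 * B)" using l0 by (simp add: powr_def mult_ac)
      finally show ?thesis .
    qed
    have large: "8 * 6 ^ card Q * real (card Bad) * suminf a < sum a Q * real L"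
    proof -
      define c where "c = 32 * S * l powr (2 * B)"
      have "suminf a \<ge> 0" by (rule suminf_nonneg[OF sa(1) a0])
      have "suminf a \<le> 4 * l powr (2 * B) * S"
        using sa(2) four S mult_right_mono[of "4 ^ K" "4 * l powr (2 * B)" S] by linarith
      hence "8 * 6 ^ card Q * real (card Bad) * suminf a
        \<le> 8 * N powr (3 * \<epsilon>) * (N powr \<theta> + 1 + N powr (1 - \<delta>)) * (4 * l powr (2 * B) * S)"
        using six cBad \<open>suminf a \<ge> 0\<close> by (intro mult_mono) auto
      also have "\<dots> = c * (N powr (3 * \<epsilon>) * N powr \<theta>) + c * (N powr (3 * \<epsilon>) * 1) + c * (N powr (3 * \<epsilon>)
        * N powr (1 - \<delta>))"
        by (simp add: c_def algebra_simps)
      also have "N powr (3 * \<epsilon>) * N powr \<theta> = N * N powr (- d1)"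
        using N powr_add[of N 1 "- d1"] by (simp add: powr_add[symmetric] d1_def)
      also have "N powr (3 * \<epsilon>) * 1 = N * N powr (- d2)"
        using N powr_add[of N 1 "- d2"] by (simp add: d2_def)
      also have "N powr (3 * \<epsilon>) * N powr (1 - \<delta>) = N * N powr (- d3)"
      proof -
        have "3 * \<epsilon> + (1 - \<delta>) = 1 + - d3" by (simp add: d3_def)
        hence "N powr (3 * \<epsilon>) * N powr (1 - \<delta>) = N powr (1 + - d3)" by (simp only: powr_add[symmetric])
        also have "\<dots> = N powr 1 * N powr (- d3)" by (rule powr_add)
        finally show ?thesis using N by simp
      qed
      also have "c * (N * N powr (- d1)) + c * (N * N powr (- d2)) + c * (N * N powr (- d3))
         = N * (c * N powr (- d1) + c * N powr (- d2) + c * N powr (- d3))" by (simp add: algebra_simps)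
      also have "\<dots> \<le> N * (1 / 8 + 1 / 8 + 1 / 8)"
        using elim N unfolding c_def l_def by (intro mult_left_mono add_mono) auto
      also have "\<dots> < N / 2" using N by simp
      also have "\<dots> \<le> real L" by (rule LN)
      also have "\<dots> \<le> sum a Q * real L" using A1 mult_right_mono[of 1 "sum a Q" "real L"] by simp
      finally show ?thesis .
    qed
    have "Bad \<subseteq> {..<L}" by (auto simp: Bad_def)
    from exists_good_shift[OF a0 sa(1) Q(1) this large, of "\<lambda>n. \<alpha> * ln (real n)"] obtain h where h:
      "h < L" "h \<notin> Bad" "sum a Q / 4 \<le> (\<Sum>n. a n * cos (real h * (\<alpha> * ln (real n))))" by blast
    have hN: "N powr \<theta> \<le> real h" "\<not> zd h" using h by (auto simp: Bad_def not_less)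
    define t where "t = \<alpha> * real h"
    have "3 / \<alpha> \<le> real h" using elim hN by linarith
    hence t3: "t \<ge> 3" using \<alpha> by (simp add: t_def field_simps)
    have hL: "real h \<le> N" using h LN by linarith
    have "ln t \<le> ln (\<alpha> * N)" using t3 \<alpha> N hL unfolding t_def by (subst ln_le_cancel_iff) auto
    also have "\<dots> = ln \<alpha> + l" using \<alpha> N by (simp add: ln_mult l_def)
    finally have lt: "ln t \<le> ln \<alpha> + l" .
    have qK: "q ^ K \<le> l powr (- 2)"
    proof -
      have "q ^ K = exp (real K * ln q)" using q by (simp add: exp_of_nat_mult)
      also have "real K * ln q \<le> - (2 * ln l)"
      proof -
        have "2 * ln l \<le> (B * (- ln q)) * ln l" using B ll by (intro mult_right_mono) auto
        also have "\<dots> = (B * ln l) * (- ln q)" by simp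
        also have "\<dots> \<le> real K * (- ln q)" using K lq by (intro mult_right_mono) auto
        finally show ?thesis by simp
      qed
      finally show ?thesis using l0 by (simp add: powr_def)
    qed
    have lt0: "0 \<le> ln t" using t3 by simp
    have "C0 * ln t * q ^ K \<le> C0 * (ln \<alpha> + l) * l powr (- 2)"
    proof (rule mult_mono[OF _ qK])
      show "C0 * ln t \<le> C0 * (ln \<alpha> + l)" using C0 lt by (intro mult_left_mono) auto
      show "0 \<le> C0 * (ln \<alpha> + l)" using C0 lt lt0 by (intro mult_nonneg_nonneg) (linarith+)
    qed (use q in simp)
    also have "\<dots> \<le> 1" using elim by (simp add: l_def)
    finally have err: "C0 * ln t * q ^ K \<le> 1" .
    have "\<forall>z\<in>ball (2 + \<i> * of_real t) (3 / 2 - 3 * \<eta>). zeta z \<noteq> 0"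
      using hN(2) unfolding zd_def t_def by blast
    from app[OF t3 this, of K] err
    have ap: "(\<Sum>n. taylor_coeff \<sigma> K n * cos (t * ln (real n))) - 1
      \<le> - Re (deriv zeta (of_real \<sigma> + \<i> * of_real t) / zeta (of_real \<sigma> + \<i> * of_real t))" by linarith
    \<comment> \<open>Here \<open>2 ^ 23 = 2048 * 4096\<close>. A quarter of the sum over
      \<open>Q\<close> is at least \<open>\<epsilon> * U / 1600\<close>, and the error 1 of the
      Taylor approximation takes at most half of that once
      \<open>\<epsilon> * U \<ge> 3200\<close>.\<close>
    have "w / 2 ^ 23 * U \<le> \<epsilon> / 3200 * U"
      using w U \<epsilon> by (intro mult_right_mono) (auto simp: \<epsilon>_def intro: order.trans[rotated])
    also have "\<epsilon> / 3200 * U = \<epsilon> * U / 3200" by simp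
    also have "\<dots> \<le> \<epsilon> * U / 1600 - 1" using U' by linarith
    also have "\<epsilon> * U / 1600 = \<epsilon> / 400 * U / 4" by simp
    also have "\<epsilon> / 400 * U / 4 - 1 \<le> sum a Q / 4 - 1" using sumQ by linarith
    also have "\<dots> \<le> (\<Sum>n. taylor_coeff \<sigma> K n * cos (t * ln (real n))) - 1"
      using h(3) by (simp add: a_def t_def mult_ac)
    also note ap
    finally show ?case
      using hN(1) hL unfolding t_def U_def l_def w_def by (intro exI[of _ h]) (simp add: mult.assoc)
  qed
qed

theorem theorem1p2:
  shows "\<exists>C :: real \<Rightarrow> real \<Rightarrow> real.
    computable_real2_on ({1/2<..<1} \<times> {0<..<1}) C \<and>
    (\<forall>\<sigma>\<in>{1/2<..<1}. \<forall>\<theta>\<in>{0<..<1}.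
       C \<sigma> \<theta> > 0 \<and>
       (\<forall>\<alpha>>0. \<forall>\<^sub>F N :: real in at_top.
          Max ((\<lambda>l :: int.
                  let s = complex_of_real \<sigma> + \<i> * complex_of_real (\<alpha> * real_of_int l)
                  in - Re (deriv zeta s / zeta s))
               ` {l :: int. N powr \<theta> \<le> real_of_int l \<and> real_of_int l \<le> N})
          \<ge> C \<sigma> \<theta> * ln N powr (1 - \<sigma>) * ln (ln N) powr (1 - \<sigma>)))"
proof (intro exI[of _ "\<lambda>\<sigma> \<theta>. (2 * \<sigma> - 1)\<^sup>2 * (1 - \<theta>) / 2 ^ 23"] conjI ballI allI impI)
  show "computable_real2_on ({1/2<..<1} \<times> {0<..<1}) (\<lambda>\<sigma> \<theta>. (2 * \<sigma> - 1)\<^sup>2 * (1 - \<theta>) / 2 ^ 23)"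
    by (rule computable_weight) simp
next
  fix \<sigma> \<theta> :: real assume st: "\<sigma> \<in> {1/2<..<1}" "\<theta> \<in> {0<..<1}"
  show "(2 * \<sigma> - 1)\<^sup>2 * (1 - \<theta>) / 2 ^ 23 > 0" using st by auto
  fix \<alpha> :: real assume \<alpha>: "\<alpha> > 0"
  have "\<forall>\<^sub>F N :: real in at_top. \<exists>h :: nat. N powr \<theta> \<le> real h \<and> real h \<le> N \<and>
    (2 * \<sigma> - 1)\<^sup>2 * (1 - \<theta>) / 2 ^ 23 * ln N powr (1 - \<sigma>) * ln (ln N) powr (1 - \<sigma>)
      \<le> - Re (deriv zeta (of_real \<sigma> + \<i> * of_real (\<alpha> * real h)) / zeta (of_real \<sigma> + \<i> * of_real (\<alpha> * real h)))"
    using st \<alpha> by (intro exists_large_log_deriv) auto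
  thus "\<forall>\<^sub>F N :: real in at_top.
          Max ((\<lambda>l :: int.
                  let s = complex_of_real \<sigma> + \<i> * complex_of_real (\<alpha> * real_of_int l)
                  in - Re (deriv zeta s / zeta s))
               ` {l :: int. N powr \<theta> \<le> real_of_int l \<and> real_of_int l \<le> N})
          \<ge> (2 * \<sigma> - 1)\<^sup>2 * (1 - \<theta>) / 2 ^ 23 * ln N powr (1 - \<sigma>) * ln (ln N) powr (1 - \<sigma>)"
  proof eventually_elim
    case (elim N)
    then obtain h :: nat where h: "N powr \<theta> \<le> real h" "real h \<le> N"
      "(2 * \<sigma> - 1)\<^sup>2 * (1 - \<theta>) / 2 ^ 23 * ln N powr (1 - \<sigma>) * ln (ln N) powr (1 - \<sigma>)
      \<le> - Re (deriv zeta (of_real \<sigma> + \<i> * of_real (\<alpha> * real h)) / zeta (of_real \<sigma> + \<i> * of_real (\<alpha> * real h)))"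
      by blast
    have "{l :: int. N powr \<theta> \<le> real_of_int l \<and> real_of_int l \<le> N} \<subseteq> {\<lfloor>N powr \<theta>\<rfloor>..\<lceil>N\<rceil>}"
      by (auto simp: floor_le_iff le_ceiling_iff)
    hence fin: "finite {l :: int. N powr \<theta> \<le> real_of_int l \<and> real_of_int l \<le> N}"
      by (rule finite_subset) simp
    show ?case
    proof (rule order.trans[OF h(3) Max_ge])
      show "- Re (deriv zeta (of_real \<sigma> + \<i> * of_real (\<alpha> * real h)) / zeta (of_real \<sigma> + \<i> * of_real (\<alpha> * real h)))
        \<in> (\<lambda>l :: int. let s = complex_of_real \<sigma> + \<i> * complex_of_real (\<alpha> * real_of_int l)
                  in - Re (deriv zeta s / zeta s))
               ` {l :: int. N powr \<theta> \<le> real_of_int l \<and> real_of_int l \<le> N}"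
        using h by (intro image_eqI[of _ _ "int h"]) (auto simp: Let_def)
    qed (use fin in simp)
  qed
qed

end
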